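(* Consider a stochastic path problem in which every history-dependent deterministic policy is proper. Run algorithm VI-SP (defined in the context) with inputs $B\ge B_\star$ and $\delta\in(0,1)$. Then with probability at least $1-O(\delta)$, for all $K\ge 1$, with $T$ being the total number of steps in $K$ episodes, $$\mathrm{Reg}_K = O\left(R\sqrt{SAK\,\tilde\iota_{T,B,\delta}} + R_{\max} SA\ln\left(\frac{R_{\max} K}{R\delta}\right)\tilde\iota_{T,B,\delta} + BS^2A\,\tilde\iota_{T,B,\delta}\right),$$ where $\tilde\iota_{T,B,\delta} = (\ln(SA/\delta)+\ln\ln(BT))\times\ln T$.
   Context: Conventions: $x=O(y)$ means $x\le cy$ for a universal constant $c$; "probability at least $1-O(\delta)$" means at least $1-c\delta$ for a universal constant $c$. Stochastic path (SP) problem: finite state set $\mathcal S$ ($S=|\mathcal S|$), finite action set $\mathcal A$ ($A=|\mathcal A|$), initial state $s_{\mathrm{init}}\in\mathcal S$, terminal state $g\notin\mathcal S$, transition kernel $P:\mathcal S\times\mathcal A\to\Delta_{\mathcal S\cup\{g\}}$ (written $P_{s,a}(\cdot)$), reward $r:\mathcal S\times\mathcal A\to[-1,1]$. In an episode, $s_1=s_{\mathrm{init}}$; at step $i$ the player in state $s_i$ takes action $a_i$, gets $r(s_i,a_i)$, and $s_{i+1}\sim P_{s_i,a_i}$; the episode ends upon reaching $g$. Let $\tau=\min\{i: s_{i+1}=g\}$. $\Pi^{\mathrm{HD}}$ is the set of history-dependent deterministic policies (maps from state-action histories and the current state to actions). A policy is proper if $g$ is reached with probability 1 from every starting state. $V^\pi(s)=\mathbb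 E^\pi[\sum_{i=1}^\tau r(s_i,a_i)\mid s_1=s]$, $V^\pi(g)=0$. When all policies in $\Pi^{\mathrm{HD}}$ are proper, there is a stationary deterministic policy $\pi^\star$ with $V^\star:=V^{\pi^\star}\ge V^\pi$ on all states for all $\pi\in\Pi^{\mathrm{HD}}$. Define $V_\star=|V^\star(s_{\mathrm{init}})|$, $B_\star=\max_s|V^\star(s)|$, $R=\sup_{\pi\in\Pi^{\mathrm{HD}}}\sqrt{\mathbb E^\pi[(\sum_{i=1}^\tau r(s_i,a_i))^2\mid s_1=s_{\mathrm{init}}]}$, $R_{\max}=\max_s\sup_{\pi\in\Pi^{\mathrm{HD}}}\sqrt{\mathbb E^\pi[(\sum_{i=1}^\tau r(s_i,a_i))^2\mid s_1=s]}$, $T_{\max}=\max_s\sup_{\pi\in\Pi^{\mathrm{HD}}}\mathbb E^\pi[\tau\mid s_1=s]$. All of $V_\star,B_\star,R,R_{\max},T_{\max}$ are assumed to be $\ge1$. Learning protocol: the learner knows $r$ but not $P$ and interacts for $K$ episodes, each starting at $s_{\mathrm{init}}$. Time $t=1,2,\dots$ counts steps across episodes; at time $t$ the learner sees $s_t$, plays $a_t$, and transits to $s_t'\sim P_{s_t,a_t}$; $s_{t+1}=s_t'$ if $s_t'\ne g$, otherwise $s_{t+1}=s_{\mathrm{init}}$ and a new episode starts. Episode $k$ occupies times $t_k,\dots,e_k$, $e_k=t_{k+1}-1$, and $T=e_K$. The regret is $\mathrm{Reg}_K=\sum_{k=1}^K\bigl(V^\star(s_{\mathrm{init}})-\sum_{t=t_k}^{e_k}r(s_t,a_t)\bigr)$.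 Algorithm VI-SP with inputs $B\ge1$, $\delta\in(0,1)$ and sufficiently large universal constants $c_1,c_2$ with $2c_1^2\le c_2$: initialize counters $n(s,a,s')=n(s,a)=0$, $Q(s,a)=B$, $V(s)=B$ for $s\in\mathcal S$, and $V(g)=0$. At each time $t$: take $a_t=\arg\max_aQ(s_t,a)$ and observe $s_t'$; increment $n(s_t,a_t)$ and $n(s_t,a_t,s_t')$; let $n_t=n(s_t,a_t)$, $\bar P_t(s')=n(s_t,a_t,s')/n_t$, $\iota_t=\ln(SA/\delta)+\ln\ln(Bn_t)$, $b_t=\max\{c_1\sqrt{\mathbb V(\bar P_t,V)\iota_t/n_t},\,c_2B\iota_t/n_t\}$; set $Q(s_t,a_t)\leftarrow\min\{r(s_t,a_t)+\bar P_tV+b_t,\ Q(s_t,a_t)\}$ and then $V(s_t)\leftarrow\max_aQ(s_t,a)$. Here $PV=\sum_{s'}P(s')V(s')$ and $\mathbb V(P,V)=\sum_{s'}P(s')V(s')^2-(PV)^2$.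
   Formalization: In the bonus and the bound, ln ln x is read as ln(max(1, ln x)) and the last factor ln T as max(1, ln T), since ln ln(Bn) is undefined at B=n=1 and the bound vanishes at T=1; states and actions are finite sets of natural numbers. *)

theory Defs
  imports "HOL-Probability.Probability"
begin

section \<open>Random sequences given by one-step conditional laws\<close>

text \<open>
  \<open>seq_measure K\<close> is the law of the sequence \<open>\<omega> 0, \<omega> 1, \<dots>\<close> in which \<open>\<omega> n\<close> has conditional
  law \<open>K [\<omega> 0, \<dots>, \<omega> (n - 1)]\<close>; lemma \<open>seq_measure_cylinder\<close> below confirms this.
\<close>

definition seq_kernel :: "('o list \<Rightarrow> 'o pmf) \<Rightarrow> nat \<Rightarrow> (nat \<Rightarrow> 'o) \<Rightarrow> 'o measure" where
  "seq_kernel K n \<omega> = measure_pmf (K (map \<omega> [0..<n]))"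

definition seq_measure :: "('o list \<Rightarrow> 'o pmf) \<Rightarrow> (nat \<Rightarrow> 'o) measure" where
  "seq_measure K =
     projective_family.lim UNIV
       (Ionescu_Tulcea.CI (seq_kernel K) (\<lambda>_. count_space UNIV)) (\<lambda>_. count_space UNIV)"

lemma Ionescu_Tulcea_seq_kernel:
  fixes K :: "('o::countable) list \<Rightarrow> 'o pmf"
  shows "Ionescu_Tulcea (seq_kernel K) (\<lambda>_. count_space UNIV)"
proof (rule Ionescu_Tulcea.intro)
  fix i :: nat
  have "PiM {0..<i} (\<lambda>_. count_space (UNIV::'o set)) = count_space (PiE {0..<i} (\<lambda>_. UNIV))"
    by (rule count_space_PiM_finite) auto
  then show "seq_kernel K i \<in> measurable (PiM {0..<i} (\<lambda>_. count_space UNIV)) (subprob_algebra (count_space UNIV))"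
    by (auto simp: seq_kernel_def space_subprob_algebra prob_space_imp_subprob_space
        measure_pmf.prob_space_axioms)
qed (simp add: seq_kernel_def measure_pmf.prob_space_axioms)

lemma prob_space_seq_measure:
  fixes K :: "('o::countable) list \<Rightarrow> 'o pmf"
  shows "prob_space (seq_measure K)"
proof -
  interpret IT: Ionescu_Tulcea "seq_kernel K" "\<lambda>_. count_space UNIV"
    by (rule Ionescu_Tulcea_seq_kernel)
  have "emeasure IT.PF.lim (IT.PF.emb UNIV {} {\<lambda>_. undefined}) = emeasure (IT.CI {}) {\<lambda>_. undefined}"
    by (rule IT.lim) (auto simp: sets_PiM_empty)
  also have "\<dots> = 1"
    using prob_space.emeasure_space_1[OF IT.PF.prob_space_P[of "{}"]]
    by (simp add: IT.PF.space_P space_PiM)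
  also have "IT.PF.emb UNIV {} {\<lambda>_. undefined} = space IT.PF.lim"
    by (auto simp: prod_emb_def space_PiM)
  finally show ?thesis
    by (auto simp: seq_measure_def intro!: prob_spaceI)
qed

lemma seq_measure_cylinder:
  fixes K :: "('o::countable) list \<Rightarrow> 'o pmf"
  shows "measure (seq_measure K) {\<omega>. \<forall>i<length xs. \<omega> i = xs ! i} =
    (\<Prod>i<length xs. pmf (K (take i xs)) (xs ! i))"
proof -
  interpret IT: Ionescu_Tulcea "seq_kernel K" "\<lambda>_. count_space UNIV"
    by (rule Ionescu_Tulcea_seq_kernel)
  define N where "N n = PiM {0..<n} (\<lambda>_. count_space (UNIV::'o set))" for n :: nat
  have N: "N n = count_space (PiE {0..<n} (\<lambda>_. UNIV))" for n
    unfolding N_def by (rule count_space_PiM_finite) auto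
  define x where "x n = restrict ((!) xs) {0..<n}" for n
  have *: "n \<le> length xs \<Longrightarrow> emeasure (IT.C 0 n (\<lambda>_. undefined)) {x n} =
      (\<Prod>i<n. ennreal (pmf (K (take i xs)) (xs ! i)))" for n
  proof (induction n)
    case 0
    have "x 0 = (\<lambda>_. undefined)"
      by (auto simp: x_def)
    then show ?case
      by (simp add: sets_PiM_empty)
  next
    case (Suc n)
    let ?C = "IT.C 0 n (\<lambda>_. undefined)"
    have sets_C: "sets ?C = sets (N n)" and space_C: "space ?C = PiE {0..<n} (\<lambda>_. UNIV)"
      using IT.sets_C[of "\<lambda>_. undefined" 0 n] IT.space_C[of "\<lambda>_. undefined" 0 n]
      by (auto simp: N_def space_PiM)
    have Sx: "{x (Suc n)} \<in> sets (N (Suc n))"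
      unfolding N by (auto simp: x_def)
    have eP: "emeasure (IT.eP n \<omega>) {x (Suc n)} =
        ennreal (pmf (K (take n xs)) (xs ! n)) * indicator {x n} \<omega>"
      if "\<omega> \<in> space ?C" for \<omega>
    proof -
      have \<omega>: "\<omega> \<in> space (N n)" using that by (simp add: space_C N)
      have "emeasure (IT.eP n \<omega>) {x (Suc n)} =
          emeasure (seq_kernel K n \<omega>) (fun_upd \<omega> n -` {x (Suc n)})"
        using IT.emeasure_eP[of \<omega> n "{x (Suc n)}"] \<omega> Sx by (simp add: N_def)
      also have "fun_upd \<omega> n -` {x (Suc n)} = (if \<omega> = x n then {xs ! n} else {})"
      proof -
        have "fun_upd \<omega> n y = x (Suc n) \<longleftrightarrow> \<omega> = x n \<and> y = xs ! n" for y
        proof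
          assume eq: "fun_upd \<omega> n y = x (Suc n)"
          have "\<omega> i = x n i" for i
            using fun_cong[OF eq, of i] that
            by (cases "i = n") (auto simp: x_def space_C PiE_iff extensional_def split: if_splits)
          moreover have "y = xs ! n"
            using fun_cong[OF eq, of n] by (auto simp: x_def)
          ultimately show "\<omega> = x n \<and> y = xs ! n" by auto
        qed (auto simp: x_def fun_eq_iff)
        then show ?thesis by auto
      qed
      also have "emeasure (seq_kernel K n \<omega>) (if \<omega> = x n then {xs ! n} else {}) =
          ennreal (pmf (K (take n xs)) (xs ! n)) * indicator {x n} \<omega>"
      proof (cases "\<omega> = x n")
        case True
        have "map \<omega> [0..<n] = take n xs"
          using Suc.prems True by (intro nth_equalityI) (auto simp: x_def)
        then show ?thesis using True by (simp add: seq_kernel_def emeasure_pmf_single)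
      qed simp
      finally show ?thesis .
    qed
    have "emeasure (IT.C 0 (Suc n) (\<lambda>_. undefined)) {x (Suc n)} =
        (\<integral>\<^sup>+\<omega>. emeasure (IT.eP n \<omega>) {x (Suc n)} \<partial>?C)"
    proof -
      have "space ?C \<noteq> {}" by (auto simp: space_C PiE_eq_empty_iff)
      moreover have "IT.eP n \<in> measurable ?C (subprob_algebra (N (Suc n)))"
        using IT.measurable_eP[of n] sets_C unfolding N_def by (simp cong: measurable_cong_sets)
      ultimately show ?thesis using Sx by (simp add: emeasure_bind)
    qed
    also have "\<dots> = (\<integral>\<^sup>+\<omega>. ennreal (pmf (K (take n xs)) (xs ! n)) * indicator {x n} \<omega> \<partial>?C)"
      by (rule nn_integral_cong) (rule eP)
    also have "\<dots> = ennreal (pmf (K (take n xs)) (xs ! n)) * emeasure ?C {x n}"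
      by (rule nn_integral_cmult_indicator) (auto simp: sets_C N x_def)
    finally show ?case using Suc by (simp add: mult.commute)
  qed
  let ?n = "length xs"
  have "emeasure (seq_measure K) (IT.PF.emb UNIV {0..<?n} {x ?n}) = emeasure (IT.CI {0..<?n}) {x ?n}"
    unfolding seq_measure_def using N[of ?n] by (intro IT.lim) (auto simp: N_def x_def)
  also have "\<dots> = emeasure (IT.C 0 ?n (\<lambda>_. undefined)) (IT.PF.emb {0..<?n} {0..<?n} {x ?n})"
    using N[of ?n] by (intro IT.emeasure_CI) (auto simp: N_def x_def)
  also have "IT.PF.emb {0..<?n} {0..<?n} {x ?n} = {x ?n}"
    by (auto simp: prod_emb_def x_def)
  also have "IT.PF.emb UNIV {0..<?n} {x ?n} = {\<omega>. \<forall>i<?n. \<omega> i = xs ! i}"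
    by (auto simp: prod_emb_def x_def restrict_def fun_eq_iff)
       (metis atLeastLessThan_iff le0)
  finally have "emeasure (seq_measure K) {\<omega>. \<forall>i<?n. \<omega> i = xs ! i} =
      ennreal (\<Prod>i<?n. pmf (K (take i xs)) (xs ! i))"
    using *[of ?n] by (simp add: prod_ennreal)
  then show ?thesis
    by (simp add: measure_def prod_nonneg)
qed


section \<open>Stochastic path problems\<close>

text \<open>The terminal state \<open>g\<close> is \<open>None\<close>; a non-terminal state \<open>s\<close> is \<open>Some s\<close>.\<close>

record ('s, 'a) sp =
  states :: "'s set"
  actions :: "'a set"
  s_init :: 's
  trans :: "'s \<Rightarrow> 'a \<Rightarrow> 's option pmf"
  rew :: "'s \<Rightarrow> 'a \<Rightarrow> real"

definition valid_sp :: "('s, 'a) sp \<Rightarrow> bool" where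
  "valid_sp M \<longleftrightarrow>
     finite (states M) \<and> finite (actions M) \<and> actions M \<noteq> {} \<and> s_init M \<in> states M \<and>
     (\<forall>s\<in>states M. \<forall>a\<in>actions M.
        set_pmf (trans M s a) \<subseteq> insert None (Some ` states M) \<and> \<bar>rew M s a\<bar> \<le> 1)"

text \<open>A transition is a triple: state, action, next state.\<close>

type_synonym ('s, 'a) transition = "'s \<times> 'a \<times> 's option"

definition st :: "('s, 'a) transition \<Rightarrow> 's" where "st x = fst x"
definition ac :: "('s, 'a) transition \<Rightarrow> 'a" where "ac x = fst (snd x)"
definition nxt :: "('s, 'a) transition \<Rightarrow> 's option" where "nxt x = snd (snd x)"

text \<open>
  An agent picks an action from the list of all past transitions (oldest first) and the current
  state.  It starts in \<open>s0\<close>, and is put back to \<open>s0\<close> whenever it has reached the terminal state.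
\<close>

type_synonym ('s, 'a) agent = "('s, 'a) transition list \<Rightarrow> 's \<Rightarrow> 'a"

definition cur_state :: "'s \<Rightarrow> ('s, 'a) transition list \<Rightarrow> 's" where
  "cur_state s0 h =
     (if h = [] then s0 else (case nxt (last h) of None \<Rightarrow> s0 | Some s \<Rightarrow> s))"

definition step_law ::
    "('s, 'a) sp \<Rightarrow> 's \<Rightarrow> ('s, 'a) agent \<Rightarrow> ('s, 'a) transition list \<Rightarrow> ('s, 'a) transition pmf" where
  "step_law M s0 f h =
     (let s = cur_state s0 h; a = f h s in map_pmf (\<lambda>s'. (s, a, s')) (trans M s a))"

definition interaction ::
    "('s, 'a) sp \<Rightarrow> 's \<Rightarrow> ('s, 'a) agent \<Rightarrow> (nat \<Rightarrow> ('s, 'a) transition) measure" where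
  "interaction M s0 f = seq_measure (step_law M s0 f)"


subsection \<open>Policies and values\<close>

text \<open>A history-dependent policy sees the list of past state-action pairs and the current state.\<close>

type_synonym ('s, 'a) policy = "('s \<times> 'a) list \<Rightarrow> 's \<Rightarrow> 'a"

definition HD_policies :: "('s, 'a) sp \<Rightarrow> ('s, 'a) policy set" where
  "HD_policies M = {\<pi>. \<forall>h s. \<pi> h s \<in> actions M}"

text \<open>
  The law of an episode of \<open>\<pi>\<close> from \<open>s\<close> is read off from the interaction up to the first arrival at
  the terminal state: \<open>tau\<close> and \<open>episode_return\<close> do not depend on anything after that.
\<close>

definition episode ::
    "('s, 'a) sp \<Rightarrow> ('s, 'a) policy \<Rightarrow> 's \<Rightarrow> (nat \<Rightarrow> ('s, 'a) transition) measure" where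
  "episode M \<pi> s = interaction M s (\<lambda>h. \<pi> (map (\<lambda>x. (st x, ac x)) h))"

text \<open>Steps are numbered from \<open>0\<close> here, so \<open>tau\<close> is the number of steps of the episode.\<close>

definition tau :: "(nat \<Rightarrow> ('s, 'a) transition) \<Rightarrow> nat" where
  "tau \<omega> = Suc (LEAST i. nxt (\<omega> i) = None)"

definition episode_return :: "('s, 'a) sp \<Rightarrow> (nat \<Rightarrow> ('s, 'a) transition) \<Rightarrow> real" where
  "episode_return M \<omega> = (\<Sum>i<tau \<omega>. rew M (st (\<omega> i)) (ac (\<omega> i)))"

definition proper :: "('s, 'a) sp \<Rightarrow> ('s, 'a) policy \<Rightarrow> bool" where
  "proper M \<pi> \<longleftrightarrow> (\<forall>s\<in>states M. AE \<omega> in episode M \<pi> s. \<exists>i. nxt (\<omega> i) = None)"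

definition val :: "('s, 'a) sp \<Rightarrow> ('s, 'a) policy \<Rightarrow> 's \<Rightarrow> real" where
  "val M \<pi> s = (LINT \<omega>|episode M \<pi> s. episode_return M \<omega>)"

definition stationary :: "('s \<Rightarrow> 'a) \<Rightarrow> ('s, 'a) policy" where
  "stationary \<mu> = (\<lambda>h. \<mu>)"

definition optimal :: "('s, 'a) sp \<Rightarrow> ('s \<Rightarrow> 'a) \<Rightarrow> bool" where
  "optimal M \<mu> \<longleftrightarrow> stationary \<mu> \<in> HD_policies M \<and>
     (\<forall>\<pi>\<in>HD_policies M. \<forall>s\<in>states M. val M \<pi> s \<le> val M (stationary \<mu>) s)"

text \<open>
  All optimal policies have the same values on \<open>states M\<close>, so the choice is immaterial; one exists
  if all history-dependent policies are proper.
\<close>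

definition Vstar :: "('s, 'a) sp \<Rightarrow> 's \<Rightarrow> real" where
  "Vstar M = val M (stationary (SOME \<mu>. optimal M \<mu>))"

definition Vstar_init :: "('s, 'a) sp \<Rightarrow> real" where
  "Vstar_init M = \<bar>Vstar M (s_init M)\<bar>"

definition Bstar :: "('s, 'a) sp \<Rightarrow> real" where
  "Bstar M = Max ((\<lambda>s. \<bar>Vstar M s\<bar>) ` states M)"

text \<open>
  If all history-dependent policies are proper, the moments below are finite and bounded, so
  that the real-valued integrals and suprema are the intended ones.
\<close>

definition R_from :: "('s, 'a) sp \<Rightarrow> 's \<Rightarrow> real" where
  "R_from M s =
     (SUP \<pi>\<in>HD_policies M. sqrt (LINT \<omega>|episode M \<pi> s. (episode_return M \<omega>)\<^sup>2))"

definition R_bound :: "('s, 'a) sp \<Rightarrow> real" where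
  "R_bound M = R_from M (s_init M)"

definition Rmax :: "('s, 'a) sp \<Rightarrow> real" where
  "Rmax M = Max (R_from M ` states M)"

definition Tmax :: "('s, 'a) sp \<Rightarrow> real" where
  "Tmax M = Max ((\<lambda>s. SUP \<pi>\<in>HD_policies M. LINT \<omega>|episode M \<pi> s. real (tau \<omega>)) ` states M)"


section \<open>The algorithm VI-SP\<close>

text \<open>
  For \<open>x\<close> close to \<open>1\<close> the logarithm \<open>ln x\<close> vanishes and \<open>ln (ln x)\<close> is undefined or
  arbitrarily negative (already for \<open>n = 1\<close> and \<open>B < exp 1\<close> in the bonus).  As usual, \<open>ln T\<close> and the
  inner logarithm of \<open>ln (ln x)\<close> are read as \<open>max 1 (ln \<cdot>)\<close>; all other logarithms are literal.
\<close>

definition ln1 :: "real \<Rightarrow> real" where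
  "ln1 x = max 1 (ln x)"

definition iota :: "('s, 'a) sp \<Rightarrow> real \<Rightarrow> real \<Rightarrow> nat \<Rightarrow> real" where
  "iota M B \<delta> n =
     ln (real (card (states M)) * real (card (actions M)) / \<delta>) + ln (ln1 (B * real n))"

definition iota_tilde :: "('s, 'a) sp \<Rightarrow> nat \<Rightarrow> real \<Rightarrow> real \<Rightarrow> real" where
  "iota_tilde M T B \<delta> = iota M B \<delta> T * ln1 (real T)"

definition expect :: "'x set \<Rightarrow> ('x \<Rightarrow> real) \<Rightarrow> ('x \<Rightarrow> real) \<Rightarrow> real" where
  "expect X p v = (\<Sum>x\<in>X. p x * v x)"

definition varia :: "'x set \<Rightarrow> ('x \<Rightarrow> real) \<Rightarrow> ('x \<Rightarrow> real) \<Rightarrow> real" where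
  "varia X p v = expect X p (\<lambda>x. (v x)\<^sup>2) - (expect X p v)\<^sup>2"

record ('s, 'a) vi_state =
  cnt3 :: "'s \<Rightarrow> 'a \<Rightarrow> 's option \<Rightarrow> nat"
  cnt2 :: "'s \<Rightarrow> 'a \<Rightarrow> nat"
  Qv :: "'s \<Rightarrow> 'a \<Rightarrow> real"
  Vv :: "'s option \<Rightarrow> real"

definition vi_init :: "real \<Rightarrow> ('s, 'a) vi_state" where
  "vi_init B =
     \<lparr> cnt3 = (\<lambda>_ _ _. 0), cnt2 = (\<lambda>_ _. 0), Qv = (\<lambda>_ _. B),
       Vv = (\<lambda>x. case x of None \<Rightarrow> 0 | Some _ \<Rightarrow> B) \<rparr>"

definition vi_update ::
    "('s, 'a) sp \<Rightarrow> real \<Rightarrow> real \<Rightarrow> real \<Rightarrow> real \<Rightarrow>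
     ('s, 'a) transition \<Rightarrow> ('s, 'a) vi_state \<Rightarrow> ('s, 'a) vi_state" where
  "vi_update M c1 c2 B \<delta> x \<sigma> =
     (let s = st x; a = ac x; s' = nxt x;
          X = insert None (Some ` states M);
          m3 = (cnt3 \<sigma>)(s := (cnt3 \<sigma> s)(a := (cnt3 \<sigma> s a)(s' := Suc (cnt3 \<sigma> s a s'))));
          m2 = (cnt2 \<sigma>)(s := (cnt2 \<sigma> s)(a := Suc (cnt2 \<sigma> s a)));
          n = m2 s a;
          Pbar = (\<lambda>y. real (m3 s a y) / real n);
          i = iota M B \<delta> n;
          b = max (c1 * sqrt (varia X Pbar (Vv \<sigma>) * i / real n)) (c2 * B * i / real n);
          Q' = (Qv \<sigma>)(s := (Qv \<sigma> s)(a := min (rew M s a + expect X Pbar (Vv \<sigma>) + b) (Qv \<sigma> s a)));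
          V' = (Vv \<sigma>)(Some s := Max (Q' s ` actions M))
      in \<lparr> cnt3 = m3, cnt2 = m2, Qv = Q', Vv = V' \<rparr>)"

definition vi_after ::
    "('s, 'a) sp \<Rightarrow> real \<Rightarrow> real \<Rightarrow> real \<Rightarrow> real \<Rightarrow> ('s, 'a) transition list \<Rightarrow> ('s, 'a) vi_state" where
  "vi_after M c1 c2 B \<delta> h = fold (vi_update M c1 c2 B \<delta>) h (vi_init B)"

text \<open>Ties in the maximisation may be broken in any way, even depending on the past.\<close>

definition vi_sp_agent ::
    "('s, 'a) sp \<Rightarrow> real \<Rightarrow> real \<Rightarrow> real \<Rightarrow> real \<Rightarrow> ('s, 'a) agent \<Rightarrow> bool" where
  "vi_sp_agent M c1 c2 B \<delta> f \<longleftrightarrow>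
     (\<forall>h. \<forall>s\<in>states M.
        is_arg_max (Qv (vi_after M c1 c2 B \<delta> h) s) (\<lambda>a. a \<in> actions M) (f h s))"


section \<open>Regret\<close>

text \<open>
  \<open>total_steps \<omega> K\<close> is the number of steps in the first \<open>K\<close> episodes.  With times numbered
  from \<open>0\<close>, the \<open>k\<close>-th episode occupies the times \<open>total_steps \<omega> (k - 1), \<dots>, total_steps \<omega> k - 1\<close>.
\<close>

definition total_steps :: "(nat \<Rightarrow> ('s, 'a) transition) \<Rightarrow> nat \<Rightarrow> nat" where
  "total_steps \<omega> K = (LEAST t. card {i. i < t \<and> nxt (\<omega> i) = None} = K)"

definition regret :: "('s, 'a) sp \<Rightarrow> (nat \<Rightarrow> ('s, 'a) transition) \<Rightarrow> nat \<Rightarrow> real" where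
  "regret M \<omega> K =
     (\<Sum>k=1..K. Vstar M (s_init M) -
        (\<Sum>t\<in>{total_steps \<omega> (k - 1)..<total_steps \<omega> k}. rew M (st (\<omega> t)) (ac (\<omega> t))))"

definition regret_bound :: "('s, 'a) sp \<Rightarrow> real \<Rightarrow> real \<Rightarrow> nat \<Rightarrow> nat \<Rightarrow> real" where
  "regret_bound M B \<delta> K T =
     (let S = real (card (states M)); A = real (card (actions M));
          R = R_bound M; L = iota_tilde M T B \<delta>
      in R * sqrt (S * A * real K * L)
         + Rmax M * S * A * ln (Rmax M * real K / (R * \<delta>)) * L
         + B * S\<^sup>2 * A * L)"

end

theory Submission
  imports Defs
begin

text \<open>
  Write \<open>X\<^sub>t = V\<^sub>t - V\<^sup>*\<close> for the excess of the value estimates and \<open>adv s a\<close> for the gap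
  \<open>V\<^sup>* s - Q\<^sup>* s a\<close>. The bonus is monotone in the value function, so an empirical Bernstein
  inequality for the fixed function \<open>V\<^sup>*\<close> gives optimism, \<open>X\<^sub>t \<ge> 0\<close>. The regret telescopes to the
  sum of the gaps of the chosen actions plus a martingale whose quadratic variation is the sum
  \<open>Y\<close> of the variances of \<open>V\<^sup>*\<close> under the transitions. A recursive estimate of the variances of
  \<open>X\<^sub>t\<close> shows that both are \<open>O(sqrt (S A L Y) + B S\<^sup>2 A L)\<close>, where \<open>L\<close> is the logarithmic factor.

  It remains to bound \<open>Y\<close>. Let \<open>c\<close> and \<open>D\<close> be the sums of the rewards and of the gaps so far in an
  episode. Then \<open>c + V\<^sup>* + D\<close> is a martingale with final value \<open>c + D\<close>, and comparing its square with
  the largest second moment of the return shows that, up to lower-order terms, \<open>Y\<close> is at most a multiple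
  of \<open>K R\<^sup>2\<close> plus the sum of gap times \<open>D\<close>. As the expected sum of the remaining gaps is at most
  \<open>2 Rmax\<close>, the sums \<open>D\<close> have exponential tails, so that \<open>Y\<close> is at most a multiple of \<open>K R\<^sup>2\<close> plus
  \<open>Rmax ln (Rmax K / (R \<delta>))\<close> times the sum of all gaps. Solving the resulting quadratic inequality
  gives the theorem. All probabilistic estimates are instances of the maximal inequality for
  nonnegative supermartingales on histories.
\<close>

section \<open>Histories and the maximal inequality\<close>

text \<open>Two obstacles shape the proof. Properness is only qualitative, so a finite bound
  \<open>ht\<close> on the remaining time under every choice of actions has to be constructed first;
  it makes moments finite and limits legitimate, but does not enter the regret bound. And the
  leading term may contain only \<open>R_bound\<close>, a second moment from the initial state,
  whereas the exponential supermartingale for the variances needs a potential bounded at every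
  history, whatever has been collected so far. The potential \<open>Hm\<close> is therefore a
  minimum: \<open>Hp\<close> starts each episode at no more than twice the square of
  \<open>R_bound\<close>, and \<open>varpot\<close> is at most 18 times the square of
  \<open>Rmax\<close> everywhere. The extra factor \<open>S\<close> in the last term has a separate
  origin. \<open>Vs\<close> is a fixed function, so its deviations cost no factor for the number
  \<open>nX\<close> of possible next states. The estimates depend on the data and are controlled
  through the frequency of each next state; this costs a factor \<open>nX\<close>, but only in front
  of the variance of the excess over \<open>Vs\<close> and in lower-order terms.\<close>

primrec hist :: "('o list \<Rightarrow> 'o pmf) \<Rightarrow> nat \<Rightarrow> 'o list pmf" where
  "hist K 0 = return_pmf []"
| "hist K (Suc n) = bind_pmf (hist K n) (\<lambda>h. map_pmf (\<lambda>x. h @ [x]) (K h))"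

abbreviation prefix_of :: "(nat \<Rightarrow> 'o) \<Rightarrow> nat \<Rightarrow> 'o list" where
  "prefix_of \<omega> n \<equiv> map \<omega> [0..<n]"

text \<open>The same product as in \<open>seq_measure_cylinder\<close>, which is how
  \<open>hist\<close> is matched with the marginals of \<open>seq_measure\<close>.\<close>

lemma pmf_hist:
  "pmf (hist K n) xs =
     (if length xs = n then (\<Prod>i<n. pmf (K (take i xs)) (xs ! i)) else 0)"
proof (induction n arbitrary: xs)
  case 0
  then show ?case by (auto simp: indicator_def)
next
  case (Suc n)
  have eq: "pmf (map_pmf (\<lambda>x. h @ [x]) (K h)) xs =
      (if xs \<noteq> [] then indicator {butlast xs} h * pmf (K (butlast xs)) (last xs) else 0)" for h
  proof (cases "xs \<noteq> [] \<and> h = butlast xs")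
    case True
    then have "xs = h @ [last xs]" by simp
    then have "pmf (map_pmf (\<lambda>x. h @ [x]) (K h)) xs = pmf (map_pmf (\<lambda>x. h @ [x]) (K h)) (h @ [last xs])"
      by simp
    also have "\<dots> = pmf (K h) (last xs)"
      by (intro pmf_map_inj') (auto simp: inj_def)
    finally show ?thesis using True by simp
  next
    case False
    then have "xs \<notin> (\<lambda>x. h @ [x]) ` set_pmf (K h)" by auto
    then show ?thesis using False by (auto simp: pmf_map_outside indicator_def)
  qed
  have "pmf (hist K (Suc n)) xs = (LINT h|measure_pmf (hist K n). pmf (map_pmf (\<lambda>x. h @ [x]) (K h)) xs)"
    by (simp add: pmf_bind)
  also have "\<dots> = (if xs \<noteq> [] then pmf (hist K n) (butlast xs) * pmf (K (butlast xs)) (last xs) else 0)"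
    by (simp add: eq measure_pmf_single)
  also have "\<dots> = (if length xs = Suc n then (\<Prod>i<Suc n. pmf (K (take i xs)) (xs ! i)) else 0)"
  proof (cases xs rule: rev_cases)
    case (snoc ys y)
    then show ?thesis by (auto simp: Suc nth_append intro!: prod.cong)
  qed auto
  finally show ?case .
qed

lemma sets_seq_measure:
  fixes K :: "('o::countable) list \<Rightarrow> 'o pmf"
  shows "sets (seq_measure K) = sets (PiM UNIV (\<lambda>_. count_space UNIV))"
proof -
  interpret IT: Ionescu_Tulcea "seq_kernel K" "\<lambda>_. count_space UNIV"
    by (rule Ionescu_Tulcea_seq_kernel)
  show ?thesis unfolding seq_measure_def using IT.PF.sets_lim by simp
qed

lemma space_seq_measure [simp]:
  fixes K :: "('o::countable) list \<Rightarrow> 'o pmf"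
  shows "space (seq_measure K) = UNIV"
  using sets_eq_imp_space_eq[OF sets_seq_measure[of K]] by (simp add: space_PiM)

lemma prefix_of_eq_iff: "prefix_of \<omega> n = xs \<longleftrightarrow> length xs = n \<and> (\<forall>i<length xs. \<omega> i = xs ! i)"
  by (auto simp: list_eq_iff_nth_eq)

lemma measurable_prefix_of [measurable]:
  fixes K :: "('o::countable) list \<Rightarrow> 'o pmf"
  shows "(\<lambda>\<omega>. prefix_of \<omega> n) \<in> measurable (seq_measure K) (count_space UNIV)"
proof (subst measurable_count_space_eq2_countable, safe)
  fix xs :: "'o list"
  have coord: "(\<lambda>\<omega>. \<omega> i) \<in> measurable (seq_measure K) (count_space UNIV)" for i
    unfolding measurable_cong_sets[OF sets_seq_measure[of K] refl] by measurable
  have "{\<omega> \<in> space (seq_measure K). \<forall>i\<in>{..<length xs}. \<omega> i = xs ! i} \<in> sets (seq_measure K)"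
    by (intro sets.sets_Collect_countable_Ball predE pred_count_space_const1 coord)
  then show "(\<lambda>\<omega>. prefix_of \<omega> n) -` {xs} \<inter> space (seq_measure K) \<in> sets (seq_measure K)"
    by (cases "length xs = n") (auto simp: vimage_def prefix_of_eq_iff Ball_def)
qed auto

text \<open>Lists over a countable type are countable, so it suffices to compare singletons: both
  masses are the product of the conditional probabilities, and lists of the wrong length have mass
  zero on both sides.\<close>

lemma distr_prefix_of:
  fixes K :: "('o::countable) list \<Rightarrow> 'o pmf"
  shows "distr (seq_measure K) (count_space UNIV) (\<lambda>\<omega>. prefix_of \<omega> n) = measure_pmf (hist K n)"
proof (rule measure_eqI_countable[where A=UNIV])
  interpret prob_space "seq_measure K" by (rule prob_space_seq_measure)
  fix xs :: "'o list"
  have "emeasure (distr (seq_measure K) (count_space UNIV) (\<lambda>\<omega>. prefix_of \<omega> n)) {xs}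
      = emeasure (seq_measure K) {\<omega>. length xs = n \<and> (\<forall>i<length xs. \<omega> i = xs ! i)}"
    by (subst emeasure_distr) (auto simp: vimage_def prefix_of_eq_iff)
  also have "\<dots> = emeasure (measure_pmf (hist K n)) {xs}"
    using seq_measure_cylinder[of K xs]
    by (cases "length xs = n") (auto simp: emeasure_eq_measure emeasure_pmf_single pmf_hist)
  finally show "emeasure (distr (seq_measure K) (count_space UNIV) (\<lambda>\<omega>. prefix_of \<omega> n)) {xs} =
    emeasure (measure_pmf (hist K n)) {xs}" .
qed auto

lemma integral_prefix_of:
  fixes K :: "('o::countable) list \<Rightarrow> 'o pmf" and g :: "'o list \<Rightarrow> real"
  shows "(LINT \<omega>|seq_measure K. g (prefix_of \<omega> n)) = measure_pmf.expectation (hist K n) g"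
  by (subst distr_prefix_of[symmetric], subst integral_distr) auto

lemma nn_integral_prefix_of:
  fixes K :: "('o::countable) list \<Rightarrow> 'o pmf"
  shows "(\<integral>\<^sup>+\<omega>. g (prefix_of \<omega> n) \<partial>seq_measure K) = (\<integral>\<^sup>+h. g h \<partial>measure_pmf (hist K n))"
  by (subst distr_prefix_of[symmetric], subst nn_integral_distr) auto

lemma AE_prefix_of:
  fixes K :: "('o::countable) list \<Rightarrow> 'o pmf"
  shows "AE \<omega> in seq_measure K. \<forall>n. prefix_of \<omega> n \<in> set_pmf (hist K n)"
proof (subst AE_all_countable, rule allI)
  fix n
  have "AE h in distr (seq_measure K) (count_space UNIV) (\<lambda>\<omega>. prefix_of \<omega> n). h \<in> set_pmf (hist K n)"
    unfolding distr_prefix_of by (simp add: AE_measure_pmf_iff)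
  then show "AE \<omega> in seq_measure K. prefix_of \<omega> n \<in> set_pmf (hist K n)"
    by (subst (asm) AE_distr_iff) auto
qed

section \<open>Supermartingales on histories with finitely supported steps\<close>

locale rand_seq =
  fixes K :: "('o::countable) list \<Rightarrow> 'o pmf" and G :: "'o list \<Rightarrow> bool"
  assumes G_Nil: "G []"
    and G_snoc: "\<And>h x. G h \<Longrightarrow> x \<in> set_pmf (K h) \<Longrightarrow> G (h @ [x])"
    and fin_K: "\<And>h. G h \<Longrightarrow> finite (set_pmf (K h))"
begin

text \<open>The conditional expectation of \<open>W\<close> one step ahead. It is a finite sum only
  where \<open>G\<close> holds: a step law may be arbitrary on histories that leave the state space,
  and the invariant \<open>G\<close> excludes these.\<close>

definition stepE :: "('o list \<Rightarrow> real) \<Rightarrow> 'o list \<Rightarrow> real" where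
  "stepE W h = (\<Sum>x\<in>set_pmf (K h). pmf (K h) x * W (h @ [x]))"

lemma hist_good: "h \<in> set_pmf (hist K n) \<Longrightarrow> G h"
  by (induction n arbitrary: h) (auto simp: G_Nil G_snoc)

lemma finite_hist: "finite (set_pmf (hist K n))"
  by (induction n) (auto simp: fin_K hist_good)

lemma integrable_hist [simp]: "integrable (measure_pmf (hist K n)) (W :: 'o list \<Rightarrow> real)"
  by (rule integrable_measure_pmf_finite) (rule finite_hist)

lemma sum_K: "G h \<Longrightarrow> (\<Sum>x\<in>set_pmf (K h). pmf (K h) x) = 1"
  by (rule sum_pmf_eq_1) (auto simp: fin_K)

lemma expectation_hist_Suc:
  "measure_pmf.expectation (hist K (Suc n)) W = measure_pmf.expectation (hist K n) (stepE W)"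
proof -
  have "measure_pmf.expectation (hist K (Suc n)) W =
      (\<Sum>h\<in>set_pmf (hist K n). pmf (hist K n) h *\<^sub>R
         measure_pmf.expectation (map_pmf (\<lambda>x. h @ [x]) (K h)) W)"
    unfolding hist.simps
    by (rule pmf_expectation_bind) (auto simp: finite_hist fin_K hist_good)
  also have "\<dots> = (\<Sum>h\<in>set_pmf (hist K n). pmf (hist K n) h *\<^sub>R stepE W h)"
    by (intro sum.cong refl)
      (auto simp: stepE_def integral_measure_pmf[OF fin_K[OF hist_good]] mult_ac)
  also have "\<dots> = measure_pmf.expectation (hist K n) (stepE W)"
    by (subst integral_measure_pmf[where A="set_pmf (hist K n)"]) (auto simp: finite_hist)
  finally show ?thesis .
qed

lemma expectation_hist_mono:
  fixes W W' :: "'o list \<Rightarrow> real"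
  assumes "\<And>h. G h \<Longrightarrow> W h \<le> W' h"
  shows "measure_pmf.expectation (hist K n) W \<le> measure_pmf.expectation (hist K n) W'"
  by (intro integral_mono_AE integrable_hist) (auto simp: AE_measure_pmf_iff assms hist_good)

lemma expectation_supermart:
  assumes "\<And>h. G h \<Longrightarrow> stepE W h \<le> W h"
  shows "measure_pmf.expectation (hist K n) W \<le> W []"
proof (induction n)
  case (Suc n)
  have "measure_pmf.expectation (hist K (Suc n)) W \<le> measure_pmf.expectation (hist K n) W"
    unfolding expectation_hist_Suc by (rule expectation_hist_mono) (rule assms)
  with Suc show ?case by simp
qed simp

lemma stepE_uminus: "stepE (\<lambda>h. - W h) h = - stepE W h"
  by (simp add: stepE_def sum_negf)

lemma expectation_submart:
  assumes "\<And>h. G h \<Longrightarrow> W h \<le> stepE W h"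
  shows "W [] \<le> measure_pmf.expectation (hist K n) W"
  using expectation_supermart[of "\<lambda>h. - W h" n] assms by (simp add: stepE_uminus)

lemma AE_good: "AE \<omega> in seq_measure K. \<forall>n. G (prefix_of \<omega> n) \<and> \<omega> n \<in> set_pmf (K (prefix_of \<omega> n))"
  using AE_prefix_of[of K]
proof eventually_elim
  case (elim \<omega>)
  have "\<omega> n \<in> set_pmf (K (prefix_of \<omega> n))" for n
  proof -
    have "prefix_of \<omega> (Suc n) \<in> set_pmf (hist K (Suc n))" using elim by blast
    then show ?thesis by auto
  qed
  with elim show ?case using hist_good by blast
qed

lemma maximal_inequality_finite:
  assumes pos: "\<And>h. G h \<Longrightarrow> 0 \<le> W h" and sup: "\<And>h. G h \<Longrightarrow> stepE W h \<le> W h" and c: "0 < c"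
  shows "measure_pmf.prob (hist K n) {h. \<exists>m\<le>length h. c \<le> W (take m h)} \<le> W [] / c"
proof -
  define bad where "bad h = (\<exists>m\<le>length h. c \<le> W (take m h))" for h
  define W' where "W' h = (if bad h then c else W h)" for h
  have bad_snoc: "bad (h @ [x]) \<longleftrightarrow> bad h \<or> c \<le> W (h @ [x])" for h x
    unfolding bad_def
  proof (safe, goal_cases)
    case (1 m) then show ?case by (cases "m \<le> length h") (auto simp: le_Suc_eq)
  next
    case (2 m) then show ?case by (intro exI[of _ m]) auto
  next
    case 3 then show ?case by (intro exI[of _ "Suc (length h)"]) auto
  qed
  have step: "stepE W' h \<le> W' h" if "G h" for h
  proof (cases "bad h")
    case True
    then show ?thesis
      using sum_K[OF that] by (simp add: stepE_def W'_def bad_snoc flip: sum_distrib_right)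
  next
    case False
    have "stepE W' h \<le> stepE W h"
      unfolding stepE_def by (intro sum_mono mult_left_mono) (auto simp: W'_def bad_snoc False)
    with sup[OF that] False show ?thesis by (simp add: W'_def)
  qed
  have "c * measure_pmf.prob (hist K n) {h. bad h} = measure_pmf.expectation (hist K n) (\<lambda>h. c * indicator {h. bad h} h)"
    by simp
  also have "\<dots> \<le> measure_pmf.expectation (hist K n) W'"
    by (rule expectation_hist_mono) (auto simp: W'_def indicator_def pos)
  also have "\<dots> \<le> W' []" by (rule expectation_supermart) (rule step)
  also have "\<dots> \<le> W []" by (auto simp: W'_def bad_def)
  finally show ?thesis using c unfolding bad_def by (simp add: field_simps)
qed

text \<open>The finite-horizon events increase to the event of ever reaching \<open>c\<close>, so
  the bound passes to the limit.\<close>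

lemma maximal_inequality:
  assumes "\<And>h. G h \<Longrightarrow> 0 \<le> W h" "\<And>h. G h \<Longrightarrow> stepE W h \<le> W h" "0 < c"
  shows "measure (seq_measure K) {\<omega>. \<exists>n. c \<le> W (prefix_of \<omega> n)} \<le> W [] / c"
proof -
  interpret prob_space "seq_measure K" by (rule prob_space_seq_measure)
  define A where "A n = {\<omega>. \<exists>m\<le>n. c \<le> W (prefix_of \<omega> m)}" for n
  have tk: "take m (prefix_of \<omega> n) = prefix_of \<omega> m" if "m \<le> n" for \<omega> :: "nat \<Rightarrow> 'o" and m n
    using that by (simp add: take_map)
  have Aeq: "A n = (\<lambda>\<omega>. prefix_of \<omega> n) -` {h. \<exists>m\<le>length h. c \<le> W (take m h)} \<inter> space (seq_measure K)" for n
    by (auto simp: A_def tk)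
  have meas: "A n \<in> events" for n
    unfolding Aeq by (rule measurable_sets[OF measurable_prefix_of]) auto
  have "prob (A n) \<le> W [] / c" for n
  proof -
    have "prob (A n) = measure (distr (seq_measure K) (count_space UNIV) (\<lambda>\<omega>. prefix_of \<omega> n)) {h. \<exists>m\<le>length h. c \<le> W (take m h)}"
      unfolding Aeq by (subst measure_distr) auto
    also have "\<dots> \<le> W [] / c"
      unfolding distr_prefix_of by (rule maximal_inequality_finite) (use assms in auto)
    finally show ?thesis .
  qed
  moreover have "(\<lambda>n. prob (A n)) \<longlonglongrightarrow> prob (\<Union>n. A n)"
    by (rule finite_Lim_measure_incseq) (use meas in \<open>auto simp: incseq_def A_def intro: le_trans\<close>)
  ultimately have "prob (\<Union>n. A n) \<le> W [] / c"
    by (intro LIMSEQ_le_const2) auto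
  moreover have "(\<Union>n. A n) = {\<omega>. \<exists>n. c \<le> W (prefix_of \<omega> n)}"
    by (auto simp: A_def)
  ultimately show ?thesis by simp
qed

text \<open>Any predicate will do, because histories are countable. The bad events below all have
  this form, so their measurability comes for free.\<close>

lemma sets_ex_prefix [measurable]: "{\<omega>. \<exists>n. Pr n (prefix_of \<omega> n)} \<in> sets (seq_measure K)"
proof -
  have "(\<Union>n. (\<lambda>\<omega>. prefix_of \<omega> n) -` {h. Pr n h} \<inter> space (seq_measure K)) \<in> sets (seq_measure K)"
    by (intro sets.countable_UN'' measurable_sets[OF measurable_prefix_of]) auto
  also have "(\<Union>n. (\<lambda>\<omega>. prefix_of \<omega> n) -` {h. Pr n h} \<inter> space (seq_measure K)) = {\<omega>. \<exists>n. Pr n (prefix_of \<omega> n)}"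
    by auto
  finally show ?thesis .
qed

end

lemma sums_inverse_consecutive: "(\<lambda>i. 1 / (real (i + 1) * real (i + 2))) sums 1"
proof -
  have "(\<lambda>i. 1 / real (Suc i)) \<longlonglongrightarrow> 0"
    using LIMSEQ_inverse_real_of_nat by (simp add: inverse_eq_divide)
  from telescope_sums'[OF this] show ?thesis
    by (simp add: field_simps)
qed

text \<open>The thresholds are the reciprocals of the weights
  \<open>d / ((i + 1) * (i + 2))\<close>, which sum to \<open>d\<close> by telescoping; a union
  bound over \<open>i\<close> follows.\<close>

lemma (in rand_seq) maximal_inequality_family:
  assumes "\<And>i h. G h \<Longrightarrow> 0 \<le> W i h" "\<And>i h. G h \<Longrightarrow> stepE (W i) h \<le> W i h" "\<And>i. W i [] \<le> 1" "0 < d"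
  shows "measure (seq_measure K) {\<omega>. \<exists>i n. real (i + 1) * real (i + 2) / d \<le> W i (prefix_of \<omega> n)} \<le> d"
proof -
  interpret prob_space "seq_measure K" by (rule prob_space_seq_measure)
  define A where "A i = {\<omega>. \<exists>n. real (i + 1) * real (i + 2) / d \<le> W i (prefix_of \<omega> n)}" for i
  have le: "prob (A i) \<le> d * (1 / (real (i + 1) * real (i + 2)))" for i
  proof -
    have "prob (A i) \<le> W i [] / (real (i + 1) * real (i + 2) / d)"
      unfolding A_def using assms by (intro maximal_inequality) auto
    also have "\<dots> \<le> 1 / (real (i + 1) * real (i + 2) / d)"
      using assms by (intro divide_right_mono) auto
    finally show ?thesis by simp
  qed
  have sums: "(\<lambda>i. d * (1 / (real (i + 1) * real (i + 2)))) sums (d * 1)"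
    by (intro sums_mult sums_inverse_consecutive)
  have summ: "summable (\<lambda>i. prob (A i))"
    by (rule summable_comparison_test'[OF sums_summable[OF sums]]) (use le in auto)
  have "prob (\<Union>i. A i) \<le> (\<Sum>i. prob (A i))"
    using sets_ex_prefix by (intro finite_measure_subadditive_countably summ) (auto simp: A_def)
  also have "\<dots> \<le> (\<Sum>i. d * (1 / (real (i + 1) * real (i + 2))))"
    by (intro suminf_le le summ sums_summable[OF sums])
  also have "\<dots> = d" using sums by (simp add: sums_iff)
  also have "(\<Union>i. A i) = {\<omega>. \<exists>i n. real (i + 1) * real (i + 2) / d \<le> W i (prefix_of \<omega> n)}"
    by (auto simp: A_def)
  finally show ?thesis .
qed

section \<open>Transitions and agents\<close>

text \<open>The set \<open>X\<close> of \<open>vi_update\<close>. It contains every successor of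
  every state, so true and empirical expectations are sums over one fixed finite set.\<close>

definition next_states :: "('s, 'a) sp \<Rightarrow> 's option set" where
  "next_states M = insert None (Some ` states M)"

definition Pv :: "('s, 'a) sp \<Rightarrow> 's \<Rightarrow> 'a \<Rightarrow> ('s option \<Rightarrow> real) \<Rightarrow> real" where
  "Pv M s a v = expect (next_states M) (pmf (trans M s a)) v"

definition good_tr :: "('s, 'a) sp \<Rightarrow> ('s, 'a) transition \<Rightarrow> bool" where
  "good_tr M x \<longleftrightarrow> st x \<in> states M \<and> ac x \<in> actions M \<and> nxt x \<in> next_states M"

abbreviation good_hist :: "('s, 'a) sp \<Rightarrow> ('s, 'a) transition list \<Rightarrow> bool" where
  "good_hist M h \<equiv> \<forall>x\<in>set h. good_tr M x"

lemma tr_simps [simp]: "st (s, a, y) = s" "ac (s, a, y) = a" "nxt (s, a, y) = y"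
  by (simp_all add: st_def ac_def nxt_def)

lemma None_in_next_states [simp]: "None \<in> next_states M"
  and Some_in_next_states [simp]: "Some s \<in> next_states M \<longleftrightarrow> s \<in> states M"
  by (auto simp: next_states_def)

lemma cur_state_Nil [simp]: "cur_state s0 [] = s0"
  and cur_state_snoc [simp]: "cur_state s0 (h @ [x]) = (case nxt x of None \<Rightarrow> s0 | Some s \<Rightarrow> s)"
  by (simp_all add: cur_state_def)

locale sp =
  fixes M :: "('s::countable, 'a::countable) sp"
  assumes valid: "valid_sp M"
begin

lemma fin_states [simp]: "finite (states M)" and fin_actions [simp]: "finite (actions M)"
  and actions_ne [simp]: "actions M \<noteq> {}" and init_in_states [simp]: "s_init M \<in> states M"
  using valid by (auto simp: valid_sp_def)

lemma fin_next_states [simp]: "finite (next_states M)"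
  by (simp add: next_states_def)

lemma rew_le: "s \<in> states M \<Longrightarrow> a \<in> actions M \<Longrightarrow> \<bar>rew M s a\<bar> \<le> 1"
  using valid by (auto simp: valid_sp_def)

lemma set_trans: "s \<in> states M \<Longrightarrow> a \<in> actions M \<Longrightarrow> set_pmf (trans M s a) \<subseteq> next_states M"
  using valid by (auto simp: valid_sp_def next_states_def)

lemma sum_trans: "s \<in> states M \<Longrightarrow> a \<in> actions M \<Longrightarrow> (\<Sum>y\<in>next_states M. pmf (trans M s a) y) = 1"
  by (rule sum_pmf_eq_1) (auto simp: set_trans)

lemma Pv_const: "s \<in> states M \<Longrightarrow> a \<in> actions M \<Longrightarrow> Pv M s a (\<lambda>_. c) = c"
  using sum_trans[of s a] by (simp add: Pv_def expect_def flip: sum_distrib_right)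

lemma Pv_add: "Pv M s a (\<lambda>y. v y + w y) = Pv M s a v + Pv M s a w"
  and Pv_diff: "Pv M s a (\<lambda>y. v y - w y) = Pv M s a v - Pv M s a w"
  and Pv_cmult: "Pv M s a (\<lambda>y. c * v y) = c * Pv M s a v"
  and Pv_uminus: "Pv M s a (\<lambda>y. - v y) = - Pv M s a v"
  by (simp_all add: Pv_def expect_def algebra_simps sum.distrib sum_subtractf sum_distrib_left sum_negf)

lemma Pv_sum: "Pv M s a (\<lambda>y. \<Sum>i\<in>I. v i y) = (\<Sum>i\<in>I. Pv M s a (v i))"
  unfolding Pv_def expect_def by (simp add: sum_distrib_left) (rule sum.swap)

lemma Pv_add_const:
  "s \<in> states M \<Longrightarrow> a \<in> actions M \<Longrightarrow> Pv M s a (\<lambda>y. c + v y) = c + Pv M s a v"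
  by (simp add: Pv_add Pv_const)

lemma Pv_mono: "(\<And>y. y \<in> next_states M \<Longrightarrow> v y \<le> w y) \<Longrightarrow> Pv M s a v \<le> Pv M s a w"
  unfolding Pv_def expect_def by (intro sum_mono mult_left_mono) auto

lemma Pv_cong: "(\<And>y. y \<in> next_states M \<Longrightarrow> v y = w y) \<Longrightarrow> Pv M s a v = Pv M s a w"
  unfolding Pv_def expect_def by (intro sum.cong) auto

lemma Pv_le_const:
  "s \<in> states M \<Longrightarrow> a \<in> actions M \<Longrightarrow> (\<And>y. y \<in> next_states M \<Longrightarrow> v y \<le> c) \<Longrightarrow> Pv M s a v \<le> c"
  using Pv_mono[of v "\<lambda>_. c" s a] by (simp add: Pv_const)

lemma Pv_ge_const:
  "s \<in> states M \<Longrightarrow> a \<in> actions M \<Longrightarrow> (\<And>y. y \<in> next_states M \<Longrightarrow> c \<le> v y) \<Longrightarrow> c \<le> Pv M s a v"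
  using Pv_mono[of "\<lambda>_. c" v s a] by (simp add: Pv_const)

lemma Pv_abs_le:
  "s \<in> states M \<Longrightarrow> a \<in> actions M \<Longrightarrow> (\<And>y. y \<in> next_states M \<Longrightarrow> \<bar>v y\<bar> \<le> c) \<Longrightarrow> \<bar>Pv M s a v\<bar> \<le> c"
  using Pv_le_const[of s a v c] Pv_ge_const[of s a "-c" v] by (force simp: abs_le_iff)

lemma tendsto_Pv:
  assumes "\<And>y. y \<in> next_states M \<Longrightarrow> (\<lambda>n. v n y) \<longlonglongrightarrow> u y"
  shows "(\<lambda>n. Pv M s a (v n)) \<longlonglongrightarrow> Pv M s a u"
  unfolding Pv_def expect_def by (intro tendsto_sum tendsto_mult tendsto_const assms)

lemma Pv_jensen_square:
  assumes "s \<in> states M" "a \<in> actions M"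
  shows "(Pv M s a v)\<^sup>2 \<le> Pv M s a (\<lambda>y. (v y)\<^sup>2)"
proof -
  let ?m = "Pv M s a v"
  have "0 \<le> Pv M s a (\<lambda>y. (v y - ?m)\<^sup>2)"
    by (rule Pv_ge_const) (use assms in auto)
  also have "\<dots> = Pv M s a (\<lambda>y. ((v y)\<^sup>2 - 2 * ?m * v y) + ?m\<^sup>2)"
    by (intro Pv_cong) (simp add: power2_eq_square algebra_simps)
  also have "\<dots> = Pv M s a (\<lambda>y. (v y)\<^sup>2) - ?m\<^sup>2"
    using assms unfolding Pv_add Pv_diff Pv_cmult by (simp add: Pv_const power2_eq_square)
  finally show ?thesis by simp
qed

end

locale sp_agent = sp M for M :: "('s::countable, 'a::countable) sp" +
  fixes s0 :: 's and f :: "('s, 'a) agent"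
  assumes start_in_states [simp]: "s0 \<in> states M"
    and agent_actions: "\<And>h s. good_hist M h \<Longrightarrow> s \<in> states M \<Longrightarrow> f h s \<in> actions M"
begin

abbreviation cur :: "('s, 'a) transition list \<Rightarrow> 's" where "cur h \<equiv> cur_state s0 h"
abbreviation act :: "('s, 'a) transition list \<Rightarrow> 'a" where "act h \<equiv> f h (cur h)"

lemma cur_in_states [simp]: "good_hist M h \<Longrightarrow> cur h \<in> states M"
  by (cases h rule: rev_cases) (auto simp: good_tr_def split: option.splits)

lemma act_in_actions [simp]: "good_hist M h \<Longrightarrow> act h \<in> actions M"
  by (simp add: agent_actions)

lemma step_law_eq: "step_law M s0 f h = map_pmf (\<lambda>y. (cur h, act h, y)) (trans M (cur h) (act h))"
  by (simp add: step_law_def Let_def)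

sublocale rand_seq "step_law M s0 f" "good_hist M"
proof
  fix h x assume h: "good_hist M h"
  note set_trans' = set_trans[OF cur_in_states[OF h] act_in_actions[OF h]]
  show "finite (set_pmf (step_law M s0 f h))"
    using finite_subset[OF set_trans'] by (simp add: step_law_eq)
  assume "x \<in> set_pmf (step_law M s0 f h)"
  then show "good_hist M (h @ [x])"
    using h set_trans' by (auto simp: step_law_eq good_tr_def)
qed auto

text \<open>Successors outside the support have probability zero and may be added to the sum. Every
  supermartingale condition thereby becomes an inequality between one-step backups
  \<open>Pv\<close>.\<close>

lemma stepE_eq:
  assumes "good_hist M h"
  shows "stepE W h = Pv M (cur h) (act h) (\<lambda>y. W (h @ [(cur h, act h, y)]))"
proof -
  note sub = set_trans[OF cur_in_states[OF assms] act_in_actions[OF assms]]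
  let ?p = "trans M (cur h) (act h)" and ?g = "\<lambda>y. (cur h, act h, y)"
  have inj: "inj ?g" by (auto simp: inj_def)
  have "stepE W h = (\<Sum>x\<in>?g ` set_pmf ?p. pmf (map_pmf ?g ?p) x * W (h @ [x]))"
    by (simp add: stepE_def step_law_eq)
  also have "\<dots> = (\<Sum>y\<in>set_pmf ?p. pmf ?p y * W (h @ [?g y]))"
    by (subst sum.reindex) (auto simp: inj_on_def pmf_map_inj'[OF inj])
  also have "\<dots> = (\<Sum>y\<in>next_states M. pmf ?p y * W (h @ [?g y]))"
    by (intro sum.mono_neutral_left) (use sub in \<open>auto simp: set_pmf_iff\<close>)
  finally show ?thesis by (simp add: Pv_def expect_def)
qed

text \<open>Isolates what holds almost surely, so that later arguments can be carried out on a
  single trajectory.\<close>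

definition consistent :: "(nat \<Rightarrow> ('s, 'a) transition) \<Rightarrow> bool" where
  "consistent \<omega> \<longleftrightarrow> (\<forall>n. good_hist M (prefix_of \<omega> n) \<and> good_tr M (\<omega> n) \<and>
     st (\<omega> n) = cur (prefix_of \<omega> n) \<and> ac (\<omega> n) = act (prefix_of \<omega> n))"

lemma AE_consistent: "AE \<omega> in interaction M s0 f. consistent \<omega>"
  unfolding interaction_def using AE_good
proof eventually_elim
  case (elim \<omega>)
  show ?case unfolding consistent_def
  proof
    fix n
    have "good_hist M (prefix_of \<omega> (Suc n))" using elim by blast
    moreover have "st (\<omega> n) = cur (prefix_of \<omega> n) \<and> ac (\<omega> n) = act (prefix_of \<omega> n)"
      using elim[rule_format, of n] by (auto simp: step_law_eq)
    ultimately show "good_hist M (prefix_of \<omega> n) \<and> good_tr M (\<omega> n) \<and>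
      st (\<omega> n) = cur (prefix_of \<omega> n) \<and> ac (\<omega> n) = act (prefix_of \<omega> n)"
      using elim by simp
  qed
qed

end


section \<open>Episodes\<close>

fun stopsum :: "(('s, 'a) transition \<Rightarrow> real) \<Rightarrow> ('s, 'a) transition list \<Rightarrow> real" where
  "stopsum w [] = 0"
| "stopsum w (x # h) = w x + (if nxt x = None then 0 else stopsum w h)"

definition alive :: "('s, 'a) transition list \<Rightarrow> bool" where
  "alive h \<longleftrightarrow> (\<forall>x\<in>set h. nxt x \<noteq> None)"

text \<open>The interaction restarts after termination, so \<open>cur_state\<close> never shows the
  terminal state. Here it is made absorbing, which suits statements about a single episode.\<close>

definition pos :: "'s \<Rightarrow> ('s, 'a) transition list \<Rightarrow> 's option" where
  "pos s0 h = (if alive h then Some (cur_state s0 h) else None)"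

lemma alive_simps [simp]: "alive []" "alive (h @ [x]) \<longleftrightarrow> alive h \<and> nxt x \<noteq> None"
  by (auto simp: alive_def)

lemma stopsum_snoc [simp]: "stopsum w (h @ [x]) = (if alive h then stopsum w h + w x else stopsum w h)"
  by (induction h) (auto simp: alive_def)

lemma pos_Nil [simp]: "pos s0 [] = Some s0"
  and pos_snoc [simp]: "pos s0 (h @ [x]) = (if alive h then nxt x else None)"
  by (auto simp: pos_def split: option.splits)

lemma pos_alive: "alive h \<Longrightarrow> pos s0 h = Some (cur_state s0 h)"
  and pos_dead: "\<not> alive h \<Longrightarrow> pos s0 h = None"
  by (simp_all add: pos_def)

lemma alive_prefix_of: "alive (prefix_of \<omega> n) \<longleftrightarrow> (\<forall>i<n. nxt (\<omega> i) \<noteq> None)"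
  by (auto simp: alive_def)

lemma alive_prefix_of_iff_tau:
  assumes "\<exists>i. nxt (\<omega> i) = None"
  shows "alive (prefix_of \<omega> n) \<longleftrightarrow> n < tau \<omega>"
proof -
  let ?L = "LEAST i. nxt (\<omega> i) = None"
  have "nxt (\<omega> ?L) = None" using assms by (rule LeastI_ex)
  moreover have "i < ?L \<Longrightarrow> nxt (\<omega> i) \<noteq> None" for i by (rule not_less_Least)
  ultimately show ?thesis
    unfolding alive_prefix_of tau_def by (meson less_Suc_eq_le linorder_not_less order_less_le_trans)
qed

lemma stopsum_prefix_of:
  assumes "\<exists>i. nxt (\<omega> i) = None"
  shows "stopsum w (prefix_of \<omega> n) = (\<Sum>i<min n (tau \<omega>). w (\<omega> i))"
proof (induction n)
  case (Suc n)
  have "prefix_of \<omega> (Suc n) = prefix_of \<omega> n @ [\<omega> n]" by simp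
  then show ?case
    using Suc alive_prefix_of_iff_tau[OF assms, of n] by (auto simp: min_def less_Suc_eq_le not_le)
qed simp

lemma measurable_coord [measurable]:
  fixes K :: "('o::countable) list \<Rightarrow> 'o pmf"
  shows "(\<lambda>\<omega>. \<omega> i) \<in> measurable (seq_measure K) (count_space UNIV)"
  unfolding measurable_cong_sets[OF sets_seq_measure[of K] refl] by measurable

lemma measurable_tau [measurable]:
  fixes K :: "(('s::countable, 'a::countable) transition) list \<Rightarrow> ('s, 'a) transition pmf"
  shows "tau \<in> measurable (seq_measure K) (count_space UNIV)"
  unfolding tau_def by measurable

lemma measurable_sum_tau [measurable]:
  fixes K :: "(('s::countable, 'a::countable) transition) list \<Rightarrow> ('s, 'a) transition pmf"
    and w :: "('s, 'a) transition \<Rightarrow> real"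
  shows "(\<lambda>\<omega>. \<Sum>i<tau \<omega>. w (\<omega> i)) \<in> borel_measurable (seq_measure K)"
proof (rule measurable_compose_countable[OF _ measurable_tau])
  fix n
  have "(\<lambda>\<omega>. w (\<omega> i)) \<in> borel_measurable (seq_measure K)" for i
    by (rule measurable_compose[OF measurable_coord]) simp
  then show "(\<lambda>\<omega>. \<Sum>i<n. w (\<omega> i)) \<in> borel_measurable (seq_measure K)" by (rule borel_measurable_sum)
qed

definition agent_of :: "('s, 'a) policy \<Rightarrow> ('s, 'a) agent" where
  "agent_of \<pi> = (\<lambda>h. \<pi> (map (\<lambda>x. (st x, ac x)) h))"

lemma episode_eq: "episode M \<pi> s = seq_measure (step_law M s (agent_of \<pi>))"
  by (simp add: episode_def interaction_def agent_of_def)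

section \<open>Optimality operators\<close>

context sp
begin

lemma sp_agent_HD:
  assumes "\<pi> \<in> HD_policies M" "s \<in> states M"
  shows "sp_agent M s (agent_of \<pi>)"
  using assms by unfold_locales (auto simp: agent_of_def HD_policies_def)

text \<open>The optimality operator for the reward \<open>w\<close>. It serves three times: with
  zero reward for survival probabilities, with \<open>rew M\<close> for optimal values, and with the
  negated reward for least values.\<close>

definition bell :: "('s \<Rightarrow> 'a \<Rightarrow> real) \<Rightarrow> ('s option \<Rightarrow> real) \<Rightarrow> 's option \<Rightarrow> real" where
  "bell w v y = (case y of None \<Rightarrow> 0 | Some s \<Rightarrow> Max ((\<lambda>a. w s a + Pv M s a v) ` actions M))"

lemma bell_None [simp]: "bell w v None = 0"
  by (simp add: bell_def)

lemma bell_ge: "a \<in> actions M \<Longrightarrow> w s a + Pv M s a v \<le> bell w v (Some s)"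
  by (simp add: bell_def)

lemma bell_attained: "\<exists>a\<in>actions M. bell w v (Some s) = w s a + Pv M s a v"
  using Max_in[of "(\<lambda>a. w s a + Pv M s a v) ` actions M"] by (simp add: bell_def image_iff)

lemma bell_le: "(\<And>a. a \<in> actions M \<Longrightarrow> w s a + Pv M s a v \<le> c) \<Longrightarrow> bell w v (Some s) \<le> c"
  using bell_attained[of w v s] by auto

lemma bell_mono:
  assumes "\<And>y. y \<in> next_states M \<Longrightarrow> v y \<le> v' y"
  shows "bell w v y \<le> bell w v' y"
proof (cases y)
  case (Some s)
  have "w s a + Pv M s a v \<le> bell w v' (Some s)" if "a \<in> actions M" for a
  proof -
    have "Pv M s a v \<le> Pv M s a v'" by (rule Pv_mono) (rule assms)
    then show ?thesis using bell_ge[OF that, of w s v'] by linarith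
  qed
  then show ?thesis unfolding Some by (rule bell_le)
qed simp

lemma tendsto_Max_image:
  fixes g :: "nat \<Rightarrow> 'i \<Rightarrow> real"
  assumes "finite A" "A \<noteq> {}" "\<And>a. a \<in> A \<Longrightarrow> (\<lambda>n. g n a) \<longlonglongrightarrow> l a"
  shows "(\<lambda>n. Max (g n ` A)) \<longlonglongrightarrow> Max (l ` A)"
  using assms by (induction A rule: finite_ne_induct) (auto intro!: tendsto_max)

lemma tendsto_bell:
  assumes "\<And>y. y \<in> next_states M \<Longrightarrow> (\<lambda>n. v n y) \<longlonglongrightarrow> u y"
  shows "(\<lambda>n. bell w (v n) y) \<longlonglongrightarrow> bell w u y"
  by (cases y) (auto simp: bell_def intro!: tendsto_Max_image tendsto_add tendsto_Pv assms)

text \<open>A maximum of finitely many finite sums is continuous, and the shifted iterates have the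
  same limit. There is no discounting, and no contraction estimate is used.\<close>

lemma bell_limit_fixpoint:
  assumes "\<And>y. y \<in> next_states M \<Longrightarrow> (\<lambda>n. (bell w ^^ n) v y) \<longlonglongrightarrow> u y" "y \<in> next_states M"
  shows "bell w u y = u y"
proof -
  have "(\<lambda>n. bell w ((bell w ^^ n) v) y) \<longlonglongrightarrow> bell w u y" by (rule tendsto_bell) (rule assms)
  moreover have "(\<lambda>n. (bell w ^^ Suc n) v y) \<longlonglongrightarrow> u y" by (rule LIMSEQ_Suc) (intro assms)
  ultimately show ?thesis by (simp add: LIMSEQ_unique)
qed

end

section \<open>A termination bound uniform in the policy\<close>

locale proper_sp = sp M for M :: "('s::countable, 'a::countable) sp" +
  assumes all_proper: "\<And>\<pi>. \<pi> \<in> HD_policies M \<Longrightarrow> proper M \<pi>"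
begin

lemma AE_terminates:
  assumes "\<pi> \<in> HD_policies M" "s \<in> states M"
  shows "AE \<omega> in episode M \<pi> s. \<exists>i. nxt (\<omega> i) = None"
  using all_proper[OF assms(1)] assms(2) by (auto simp: proper_def)

lemma prob_alive_tendsto_0:
  assumes "\<pi> \<in> HD_policies M" "s \<in> states M"
  shows "(\<lambda>n. measure_pmf.expectation (hist (step_law M s (agent_of \<pi>)) n) (\<lambda>h. indicat_real {h. alive h} h)) \<longlonglongrightarrow> 0"
proof -
  let ?S = "seq_measure (step_law M s (agent_of \<pi>))"
  interpret P: prob_space ?S by (rule prob_space_seq_measure)
  have "(\<lambda>n. LINT \<omega>|?S. indicat_real {h. alive h} (prefix_of \<omega> n)) \<longlonglongrightarrow> (LINT \<omega>|?S. 0)"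
  proof (rule integral_dominated_convergence[where w="\<lambda>_. 1"])
    show "AE \<omega> in ?S. (\<lambda>n. indicat_real {h. alive h} (prefix_of \<omega> n)) \<longlonglongrightarrow> 0"
      using AE_terminates[OF assms] unfolding episode_eq
    proof eventually_elim
      case (elim \<omega>)
      have "eventually (\<lambda>n. indicat_real {h. alive h} (prefix_of \<omega> n) = 0) sequentially"
        using eventually_ge_at_top[of "tau \<omega>"]
        by eventually_elim (simp add: alive_prefix_of_iff_tau[OF elim])
      then show ?case by (rule tendsto_eventually)
    qed
    show "(\<lambda>\<omega>. indicat_real {h. alive h} (prefix_of \<omega> n)) \<in> borel_measurable ?S" for n
      by (rule measurable_compose[OF measurable_prefix_of]) simp
  qed auto
  then show ?thesis by (simp add: integral_prefix_of)
qed

text \<open>The probability of not having terminated after \<open>n\<close> steps, maximised over the actions.\<close>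

definition survival :: "nat \<Rightarrow> 's option \<Rightarrow> real" where
  "survival n = (bell (\<lambda>_ _. 0) ^^ n) (\<lambda>y. if y = None then 0 else 1)"

lemma survival_Suc: "survival (Suc n) = bell (\<lambda>_ _. 0) (survival n)"
  by (simp add: survival_def)

lemma survival_None [simp]: "survival n None = 0"
  by (cases n) (auto simp: survival_def)

lemma survival_nonneg: "y \<in> next_states M \<Longrightarrow> 0 \<le> survival n y"
proof (induction n arbitrary: y)
  case (Suc n)
  show ?case
  proof (cases y)
    case (Some s)
    obtain a where a: "a \<in> actions M" using actions_ne by blast
    have "0 \<le> Pv M s a (survival n)"
      by (rule Pv_ge_const) (use Suc a Some in auto)
    also have "\<dots> \<le> survival (Suc n) (Some s)"
      using bell_ge[OF a, of "\<lambda>_ _. 0" s "survival n"] by (simp add: survival_Suc)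
    finally show ?thesis by (simp add: Some)
  qed simp
qed (auto simp: survival_def)

lemma survival_decreasing: "y \<in> next_states M \<Longrightarrow> survival (Suc n) y \<le> survival n y"
proof (induction n arbitrary: y)
  case 0
  show ?case
  proof (cases y)
    case (Some s)
    have "Pv M s a (\<lambda>y. if y = None then 0 else 1) \<le> 1" if "a \<in> actions M" for a
      by (rule Pv_le_const) (use that 0 Some in auto)
    then show ?thesis using Some by (auto simp: survival_def intro!: bell_le)
  qed simp
next
  case (Suc n)
  show ?case unfolding survival_Suc[of "Suc n"] by (subst survival_Suc, rule bell_mono) (rule Suc)
qed

text \<open>Each single policy is proper, but the maximum is taken afresh for every horizon. The
  decreasing limit \<open>u\<close> solves the optimality equation with zero reward, so one greedy
  stationary policy attains it for all horizons. Along that policy \<open>u\<close> is a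
  submartingale below the indicator of being alive, whose expectation tends to zero.\<close>

lemma survival_tendsto_0:
  assumes "y \<in> next_states M"
  shows "(\<lambda>n. survival n y) \<longlonglongrightarrow> 0"
proof -
  define u where "u y = lim (\<lambda>n. survival n y)" for y
  have lim: "(\<lambda>n. survival n y) \<longlonglongrightarrow> u y" if "y \<in> next_states M" for y
  proof -
    have "decseq (\<lambda>n. survival n y)" by (rule decseq_SucI) (rule survival_decreasing[OF that])
    moreover have "bdd_below (range (\<lambda>n. survival n y))"
      using survival_nonneg[OF that] by (auto simp: bdd_below_def)
    ultimately have "convergent (\<lambda>n. survival n y)"
      by (metis LIMSEQ_decseq_INF convergentI)
    then show ?thesis unfolding u_def by (simp add: convergent_LIMSEQ_iff)
  qed
  have fp: "bell (\<lambda>_ _. 0) u y = u y" if "y \<in> next_states M" for y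
    by (rule bell_limit_fixpoint[OF _ that]) (use lim in \<open>simp add: survival_def\<close>)
  have u_None: "u None = 0" by (simp add: u_def)
  have u_le: "u y \<le> 1" if "y \<in> next_states M" for y
  proof (rule LIMSEQ_le_const2[OF lim[OF that]], intro exI allI impI)
    fix n
    show "survival n y \<le> 1"
      using lift_Suc_antimono_le[of "\<lambda>n. survival n y" 0 n] survival_decreasing[OF that]
      by (auto simp: survival_def split: if_splits)
  qed
  have u_nonneg: "0 \<le> u y" if "y \<in> next_states M" for y
    by (rule LIMSEQ_le_const[OF lim[OF that]]) (use survival_nonneg[OF that] in auto)
  obtain \<mu> where \<mu>: "\<And>s. \<mu> s \<in> actions M" "\<And>s. bell (\<lambda>_ _. 0) u (Some s) = Pv M s (\<mu> s) u"
    using bell_attained[of "\<lambda>_ _. 0" u] by simp metis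
  have HD: "stationary \<mu> \<in> HD_policies M" using \<mu> by (auto simp: HD_policies_def stationary_def)
  have "u (Some s) \<le> 0" if s: "s \<in> states M" for s
  proof -
    interpret A: sp_agent M s "agent_of (stationary \<mu>)" by (rule sp_agent_HD[OF HD s])
    have act: "A.act h = \<mu> (A.cur h)" for h by (simp add: agent_of_def stationary_def)
    have step: "u (pos s h) \<le> A.stepE (\<lambda>h. u (pos s h)) h" if "good_hist M h" for h
    proof (cases "alive h")
      case True
      have "u (pos s h) = bell (\<lambda>_ _. 0) u (pos s h)"
        using that by (intro fp[symmetric]) (auto simp: pos_def)
      also have "\<dots> = Pv M (A.cur h) (A.act h) u"
        unfolding act using True by (simp add: pos_def \<mu>)
      finally show ?thesis unfolding A.stepE_eq[OF that] using True by simp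
    next
      case False
      then show ?thesis unfolding A.stepE_eq[OF that] using that
        by (simp add: pos_def Pv_const)
    qed
    have "u (Some s) \<le> measure_pmf.expectation (hist (step_law M s (agent_of (stationary \<mu>))) n) (\<lambda>h. indicat_real {h. alive h} h)" for n
    proof -
      have "u (Some s) \<le> measure_pmf.expectation (hist (step_law M s (agent_of (stationary \<mu>))) n) (\<lambda>h. u (pos s h))"
        using A.expectation_submart[of "\<lambda>h. u (pos s h)" n] step by simp
      also have "\<dots> \<le> measure_pmf.expectation (hist (step_law M s (agent_of (stationary \<mu>))) n) (\<lambda>h. indicat_real {h. alive h} h)"
        by (rule A.expectation_hist_mono) (auto simp: pos_def u_None intro!: u_le)
      finally show ?thesis .
    qed
    then show ?thesis
      by (intro LIMSEQ_le_const[OF prob_alive_tendsto_0[OF HD s]]) auto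
  qed
  then have "u y = 0"
    using assms u_nonneg[OF assms] u_None by (cases y) (auto intro: antisym)
  then show ?thesis using lim[OF assms] by simp
qed

text \<open>A backup raises the index of \<open>survival\<close> by at most one, so backing up the
  sum over \<open>n < N\<close> loses \<open>survival 0\<close>, which is 1, and gains
  \<open>survival N\<close>, which is below one half. The factor 2 turns this net loss of one half
  into the required 1.\<close>

lemma ex_hitting_bound:
  "\<exists>t. t None = 0 \<and> (\<forall>y\<in>next_states M. 0 \<le> t y) \<and>
     (\<forall>s\<in>states M. \<forall>a\<in>actions M. 1 + Pv M s a t \<le> t (Some s))"
proof -
  have "\<forall>y\<in>next_states M. eventually (\<lambda>n. survival n y < 1/2) sequentially"
    using order_tendstoD(2)[OF survival_tendsto_0, of _ "1/2"] by auto
  then have "eventually (\<lambda>n. \<forall>y\<in>next_states M. survival n y < 1/2) sequentially"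
    by (simp add: eventually_ball_finite_distrib)
  then obtain N where N: "\<And>y. y \<in> next_states M \<Longrightarrow> survival N y < 1/2"
    by (auto simp: eventually_sequentially)
  define t where "t = (\<lambda>y. 2 * (\<Sum>n<N. survival n y))"
  have "1 + Pv M s a t \<le> t (Some s)" if "s \<in> states M" "a \<in> actions M" for s a
  proof -
    have "Pv M s a t = 2 * (\<Sum>n<N. Pv M s a (survival n))"
      unfolding t_def by (simp only: Pv_cmult Pv_sum)
    also have "\<dots> \<le> 2 * (\<Sum>n<N. survival (Suc n) (Some s))"
      using bell_ge[OF that(2), of "\<lambda>_ _. 0" s] by (auto simp: survival_Suc intro!: sum_mono)
    also have "(\<Sum>n<N. survival (Suc n) (Some s)) = (\<Sum>n<N. survival n (Some s)) + survival N (Some s) - survival 0 (Some s)"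
      using sum_lessThan_telescope[of "\<lambda>n. survival n (Some s)" N] by (simp add: sum_subtractf)
    finally show ?thesis using N[of "Some s"] that by (simp add: t_def survival_def)
  qed
  moreover have "0 \<le> t y" if "y \<in> next_states M" for y
    using survival_nonneg[OF that] by (auto simp: t_def intro!: sum_nonneg)
  ultimately show ?thesis by (intro exI[of _ t]) (auto simp: t_def)
qed

text \<open>Dominates the expected remaining time under any choice of actions, however it depends on
  the past, because \<open>ht_step\<close> holds for every action.\<close>

definition ht :: "'s option \<Rightarrow> real" where
  "ht = (SOME t. t None = 0 \<and> (\<forall>y\<in>next_states M. 0 \<le> t y) \<and>
     (\<forall>s\<in>states M. \<forall>a\<in>actions M. 1 + Pv M s a t \<le> t (Some s)))"

lemma ht_None [simp]: "ht None = 0"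
  and ht_nonneg: "y \<in> next_states M \<Longrightarrow> 0 \<le> ht y"
  and ht_step: "s \<in> states M \<Longrightarrow> a \<in> actions M \<Longrightarrow> 1 + Pv M s a ht \<le> ht (Some s)"
  using someI_ex[OF ex_hitting_bound] unfolding ht_def[symmetric] by auto

definition htmax :: real where "htmax = Max (ht ` next_states M)"

lemma ht_le: "y \<in> next_states M \<Longrightarrow> ht y \<le> htmax"
  by (simp add: htmax_def)

lemma htmax_nonneg: "0 \<le> htmax"
  using ht_le[of None] by simp

text \<open>Bounds the second moment of \<open>c\<close> plus the number of remaining steps.\<close>

definition ht2 :: "'s option \<Rightarrow> real \<Rightarrow> real" where
  "ht2 y c = c\<^sup>2 + 2 * c * ht y + (1 + 2 * htmax) * ht y"

lemma ht2_mono: "0 \<le> c \<Longrightarrow> c \<le> c' \<Longrightarrow> y \<in> next_states M \<Longrightarrow> ht2 y c \<le> ht2 y c'"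
  unfolding ht2_def using ht_nonneg[of y] htmax_nonneg by (intro add_mono mult_mono power_mono) auto

text \<open>This fixes the coefficient \<open>1 + 2 * htmax\<close> in \<open>ht2\<close>: replacing
  \<open>Pv M s a ht\<close> by \<open>ht (Some s) - 1\<close> leaves the excess
  \<open>2 * ht (Some s) - 2 - 2 * htmax\<close>, which is negative.\<close>

lemma ht2_step:
  assumes "s \<in> states M" "a \<in> actions M" "0 \<le> c"
  shows "Pv M s a (\<lambda>y. ht2 y (c + 1)) \<le> ht2 (Some s) c"
proof -
  have "Pv M s a (\<lambda>y. ht2 y (c + 1)) = (c + 1)\<^sup>2 + (2 * (c + 1) + (1 + 2 * htmax)) * Pv M s a ht"
    unfolding ht2_def by (simp add: assms Pv_add_const Pv_cmult add.assoc flip: distrib_right)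
  also have "\<dots> \<le> (c + 1)\<^sup>2 + (2 * (c + 1) + (1 + 2 * htmax)) * (ht (Some s) - 1)"
    using ht_step[OF assms(1,2)] htmax_nonneg assms by (intro add_left_mono mult_left_mono) auto
  also have "\<dots> \<le> ht2 (Some s) c"
    using ht_le[of "Some s"] assms by (simp add: ht2_def power2_eq_square algebra_simps)
  finally show ?thesis .
qed

lemma ht2_le_square: "y \<in> next_states M \<Longrightarrow> 0 \<le> c \<Longrightarrow> ht2 y c \<le> (c + (1 + 2 * htmax))\<^sup>2"
proof -
  assume y: "y \<in> next_states M" and c: "0 \<le> c"
  have "ht2 y c \<le> c\<^sup>2 + 2 * c * htmax + (1 + 2 * htmax) * htmax"
    unfolding ht2_def using ht_le[OF y] htmax_nonneg c by (intro add_mono mult_left_mono) auto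
  also have "\<dots> \<le> (c + (1 + 2 * htmax))\<^sup>2"
    using htmax_nonneg c by (simp add: power2_eq_square algebra_simps)
  finally show ?thesis .
qed

section \<open>Second moment of the episode length\<close>

context
  fixes \<pi> s
  assumes HD: "\<pi> \<in> HD_policies M" and s: "s \<in> states M"
begin

interpretation A: sp_agent M s "agent_of \<pi>" by (rule sp_agent_HD[OF HD s])
interpretation P: prob_space "episode M \<pi> s" unfolding episode_eq by (rule prob_space_seq_measure)

text \<open>Evaluated at the position and the number of steps, \<open>ht2\<close> is a
  supermartingale that dominates the square of this number. Fatou's lemma carries the bound to
  \<open>tau\<close>, whose integrability is not yet known at this point.\<close>

lemma tau_square_integrable: "integrable (episode M \<pi> s) (\<lambda>\<omega>. (real (tau \<omega>))\<^sup>2)"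
  and tau_square_bound: "(LINT \<omega>|episode M \<pi> s. (real (tau \<omega>))\<^sup>2) \<le> ht2 (Some s) 0"
proof -
  let ?S = "seq_measure (step_law M s (agent_of \<pi>))"
  define N where "N = stopsum (\<lambda>_::('s, 'a) transition. 1)"
  have N_nonneg: "0 \<le> N h" for h unfolding N_def by (induction h) auto
  have step: "A.stepE (\<lambda>h. ht2 (pos s h) (N h)) h \<le> ht2 (pos s h) (N h)" if "good_hist M h" for h
    unfolding A.stepE_eq[OF that] using ht2_step[of "A.cur h" "A.act h" "N h"] that N_nonneg[of h]
    by (cases "alive h") (auto simp: N_def pos_alive pos_dead Pv_const)
  have "measure_pmf.expectation (hist (step_law M s (agent_of \<pi>)) n) (\<lambda>h. (N h)\<^sup>2) \<le> ht2 (Some s) 0" for n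
  proof -
    have "measure_pmf.expectation (hist (step_law M s (agent_of \<pi>)) n) (\<lambda>h. (N h)\<^sup>2)
        \<le> measure_pmf.expectation (hist (step_law M s (agent_of \<pi>)) n) (\<lambda>h. ht2 (pos s h) (N h))"
    proof (rule A.expectation_hist_mono)
      fix h :: "('s, 'a) transition list" assume "good_hist M h"
      then have "pos s h \<in> next_states M" by (auto simp: pos_def)
      from ht_nonneg[OF this] show "(N h)\<^sup>2 \<le> ht2 (pos s h) (N h)"
        using N_nonneg htmax_nonneg by (simp add: ht2_def)
    qed
    also have "\<dots> \<le> ht2 (Some s) 0"
      using A.expectation_supermart[of "\<lambda>h. ht2 (pos s h) (N h)" n] step by (simp add: N_def)
    finally show ?thesis .
  qed
  then have le: "(\<integral>\<^sup>+\<omega>. ennreal ((N (prefix_of \<omega> n))\<^sup>2) \<partial>?S) \<le> ennreal (ht2 (Some s) 0)" for n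
    by (subst nn_integral_prefix_of[where g="\<lambda>h. ennreal ((N h)\<^sup>2)"], subst nn_integral_eq_integral)
       (auto intro!: ennreal_leI)
  have "(\<integral>\<^sup>+\<omega>. ennreal ((real (tau \<omega>))\<^sup>2) \<partial>?S) = (\<integral>\<^sup>+\<omega>. liminf (\<lambda>n. ennreal ((N (prefix_of \<omega> n))\<^sup>2)) \<partial>?S)"
  proof (rule nn_integral_cong_AE)
    show "AE \<omega> in ?S. ennreal ((real (tau \<omega>))\<^sup>2) = liminf (\<lambda>n. ennreal ((N (prefix_of \<omega> n))\<^sup>2))"
      using AE_terminates[OF HD s] unfolding episode_eq
    proof eventually_elim
      case (elim \<omega>)
      have "eventually (\<lambda>n. ennreal ((N (prefix_of \<omega> n))\<^sup>2) = ennreal ((real (tau \<omega>))\<^sup>2)) sequentially"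
        using eventually_ge_at_top[of "tau \<omega>"]
        by eventually_elim (simp add: N_def stopsum_prefix_of[OF elim] min_def)
      then have "(\<lambda>n. ennreal ((N (prefix_of \<omega> n))\<^sup>2)) \<longlonglongrightarrow> ennreal ((real (tau \<omega>))\<^sup>2)"
        by (rule tendsto_eventually)
      then show ?case by (intro lim_imp_Liminf[symmetric]) auto
    qed
  qed
  also have "\<dots> \<le> liminf (\<lambda>n. \<integral>\<^sup>+\<omega>. ennreal ((N (prefix_of \<omega> n))\<^sup>2) \<partial>?S)"
    by (rule nn_integral_liminf) (rule measurable_compose[OF measurable_prefix_of], simp)
  also have "\<dots> \<le> ennreal (ht2 (Some s) 0)"
    by (rule order_trans[OF Liminf_mono[of _ "\<lambda>_. ennreal (ht2 (Some s) 0)"]]) (use le in \<open>auto simp: Liminf_const\<close>)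
  finally have *: "(\<integral>\<^sup>+\<omega>. ennreal ((real (tau \<omega>))\<^sup>2) \<partial>?S) \<le> ennreal (ht2 (Some s) 0)" .
  have meas: "(\<lambda>\<omega>. (real (tau \<omega>))\<^sup>2) \<in> borel_measurable ?S"
    by (rule measurable_compose[OF measurable_tau]) simp
  show int: "integrable (episode M \<pi> s) (\<lambda>\<omega>. (real (tau \<omega>))\<^sup>2)"
    unfolding episode_eq
    by (rule integrableI_bounded) (use meas * in \<open>auto simp: less_top[symmetric] top_unique\<close>)
  have "0 \<le> ht2 (Some s) 0" using ht_nonneg[of "Some s"] s htmax_nonneg by (simp add: ht2_def)
  with * show "(LINT \<omega>|episode M \<pi> s. (real (tau \<omega>))\<^sup>2) \<le> ht2 (Some s) 0"
    unfolding episode_eq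
    by (subst integral_eq_nn_integral) (use meas in \<open>auto simp: enn2real_leI\<close>)
qed

lemma tau_plus_square_integrable: "integrable (episode M \<pi> s) (\<lambda>\<omega>. (real (tau \<omega>) + b)\<^sup>2)"
proof (rule Bochner_Integration.integrable_bound)
  show "integrable (episode M \<pi> s) (\<lambda>\<omega>. 2 * (real (tau \<omega>))\<^sup>2 + 2 * b\<^sup>2)"
    using tau_square_integrable by simp
  show "(\<lambda>\<omega>. (real (tau \<omega>) + b)\<^sup>2) \<in> borel_measurable (episode M \<pi> s)"
    unfolding episode_eq by (rule measurable_compose[OF measurable_tau]) simp
  show "AE \<omega> in episode M \<pi> s. norm ((real (tau \<omega>) + b)\<^sup>2) \<le> norm (2 * (real (tau \<omega>))\<^sup>2 + 2 * b\<^sup>2)"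
  proof (rule AE_I2)
    fix \<omega> :: "nat \<Rightarrow> ('s, 'a) transition"
    have "(real (tau \<omega>) + b)\<^sup>2 \<le> 2 * (real (tau \<omega>))\<^sup>2 + 2 * b\<^sup>2"
      using sum_squares_bound[of "real (tau \<omega>)" b] by (simp add: power2_sum)
    then show "norm ((real (tau \<omega>) + b)\<^sup>2) \<le> norm (2 * (real (tau \<omega>))\<^sup>2 + 2 * b\<^sup>2)"
      by (simp add: abs_of_nonneg)
  qed
qed

text \<open>The bridge from integrals over trajectories to expectations over finite histories.
  Almost surely \<open>g\<close> is eventually equal to \<open>F\<close>, and the square of
  \<open>tau\<close>, now integrable, provides the dominating function.\<close>

lemma episode_expectation_limit:
  fixes g :: "('s, 'a) transition list \<Rightarrow> real"
  assumes meas: "F \<in> borel_measurable (episode M \<pi> s)"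
    and lim: "\<And>\<omega> n. \<exists>i. nxt (\<omega> i) = None \<Longrightarrow> tau \<omega> \<le> n \<Longrightarrow> g (prefix_of \<omega> n) = F \<omega>"
    and bound: "\<And>\<omega> n. \<exists>i. nxt (\<omega> i) = None \<Longrightarrow> A.consistent \<omega> \<Longrightarrow> \<bar>g (prefix_of \<omega> n)\<bar> \<le> (real (tau \<omega>) + b)\<^sup>2"
  shows "(\<lambda>n. measure_pmf.expectation (hist (step_law M s (agent_of \<pi>)) n) g) \<longlonglongrightarrow> (LINT \<omega>|episode M \<pi> s. F \<omega>)"
    and "integrable (episode M \<pi> s) F"
proof -
  let ?S = "episode M \<pi> s"
  have AE: "AE \<omega> in ?S. (\<exists>i. nxt (\<omega> i) = None) \<and> A.consistent \<omega>"
    using AE_terminates[OF HD s] A.AE_consistent[unfolded interaction_def, folded episode_eq]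
    by eventually_elim simp
  have m: "(\<lambda>\<omega>. g (prefix_of \<omega> n)) \<in> borel_measurable ?S" for n
    unfolding episode_eq by (rule measurable_compose[OF measurable_prefix_of]) simp
  have l: "AE \<omega> in ?S. (\<lambda>n. g (prefix_of \<omega> n)) \<longlonglongrightarrow> F \<omega>"
    using AE
  proof eventually_elim
    case (elim \<omega>)
    then have "eventually (\<lambda>n. g (prefix_of \<omega> n) = F \<omega>) sequentially"
      using lim by (auto simp: eventually_sequentially)
    then show ?case by (rule tendsto_eventually)
  qed
  have d: "AE \<omega> in ?S. norm (g (prefix_of \<omega> n)) \<le> (real (tau \<omega>) + b)\<^sup>2" for n
    using AE by eventually_elim (use bound in simp)
  show "integrable ?S F"
    by (rule integrable_dominated_convergence[OF meas m tau_plus_square_integrable l d])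
  show "(\<lambda>n. measure_pmf.expectation (hist (step_law M s (agent_of \<pi>)) n) g) \<longlonglongrightarrow> (LINT \<omega>|?S. F \<omega>)"
    using integral_dominated_convergence[OF meas m tau_plus_square_integrable l d]
    unfolding episode_eq by (simp add: integral_prefix_of)
qed

end

end

section \<open>Optimal values\<close>

context proper_sp
begin

text \<open>Value iteration started at \<open>- ht\<close>. As rewards lie between -1 and 1,
  \<open>- ht\<close> is a subsolution and \<open>ht\<close> a supersolution, so the iterates
  increase and stay below \<open>ht\<close>; their limit is a fixed point by continuity.\<close>

lemma ex_bell_fixpoint:
  assumes w: "\<And>s a. s \<in> states M \<Longrightarrow> a \<in> actions M \<Longrightarrow> \<bar>w s a\<bar> \<le> 1"
  shows "\<exists>V. V None = 0 \<and> (\<forall>y\<in>next_states M. \<bar>V y\<bar> \<le> ht y \<and> bell w V y = V y)"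
proof -
  define v where "v n = (bell w ^^ n) (\<lambda>y. - ht y)" for n
  have v_Suc: "v (Suc n) = bell w (v n)" and v_0: "v 0 = (\<lambda>y. - ht y)" for n
    by (auto simp: v_def)
  have v_None: "v n None = 0" for n by (cases n) (auto simp: v_Suc v_0)
  have inc: "v n y \<le> v (Suc n) y" if "y \<in> next_states M" for n y
    using that
  proof (induction n arbitrary: y)
    case 0
    show ?case
    proof (cases y)
      case (Some s)
      with 0 have s: "s \<in> states M" by simp
      obtain a where a: "a \<in> actions M" using actions_ne by blast
      have "- ht (Some s) \<le> w s a + Pv M s a (\<lambda>y. - ht y)"
        using ht_step[OF s a] w[OF s a] by (simp add: Pv_uminus)
      also have "\<dots> \<le> v (Suc 0) y"
        unfolding Some v_Suc v_0 by (rule bell_ge) (rule a)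
      finally show ?thesis by (simp add: v_0 Some)
    qed (simp add: v_None)
  next
    case (Suc n)
    show ?case unfolding v_Suc[of "Suc n"] by (subst v_Suc, rule bell_mono) (rule Suc)
  qed
  have inc': "v m y \<le> v n y" if "m \<le> n" "y \<in> next_states M" for m n y
    using lift_Suc_mono_le[of "\<lambda>n. v n y" m n] inc[OF that(2)] that(1) by simp
  have upper: "v n y \<le> ht y" if "y \<in> next_states M" for n y
    using that
  proof (induction n arbitrary: y)
    case (Suc n)
    show ?case
    proof (cases y)
      case (Some s)
      have "w s a + Pv M s a (v n) \<le> ht (Some s)" if a: "a \<in> actions M" for a
      proof -
        have "Pv M s a (v n) \<le> Pv M s a ht" by (rule Pv_mono) (rule Suc.IH)
        then show ?thesis using ht_step[of s a] w[of s a] a Suc.prems Some by simp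
      qed
      then show ?thesis unfolding Some v_Suc by (rule bell_le)
    qed (simp add: v_None)
  qed (use ht_nonneg in \<open>force simp: v_0\<close>)
  have bdd: "bdd_above (range (\<lambda>n. v n y))" if "y \<in> next_states M" for y
    using upper[OF that] by (auto simp: bdd_above_def)
  define V where "V y = (SUP n. v n y)" for y
  have lim: "(\<lambda>n. v n y) \<longlonglongrightarrow> V y" if "y \<in> next_states M" for y
    unfolding V_def by (rule LIMSEQ_incseq_SUP[OF bdd[OF that]]) (auto simp: incseq_def inc' that)
  have "bell w V y = V y" if "y \<in> next_states M" for y
    by (rule bell_limit_fixpoint[OF _ that]) (use lim in \<open>simp add: v_def\<close>)
  moreover have "V None = 0" by (simp add: V_def v_None)
  moreover have "\<bar>V y\<bar> \<le> ht y" if "y \<in> next_states M" for y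
  proof -
    have "V y \<le> ht y"
      by (rule LIMSEQ_le_const2[OF lim[OF that]]) (use upper[OF that] in auto)
    moreover have "- ht y \<le> V y"
      by (rule LIMSEQ_le_const[OF lim[OF that]]) (use inc'[OF _ that, of 0] in \<open>auto simp: v_0\<close>)
    ultimately show ?thesis by linarith
  qed
  ultimately show ?thesis by (intro exI[of _ V]) simp
qed

section \<open>Values and second moments as limits over histories\<close>

definition rsum :: "('s, 'a) transition list \<Rightarrow> real" where
  "rsum = stopsum (\<lambda>x. rew M (st x) (ac x))"

lemma rsum_Nil [simp]: "rsum [] = 0"
  and rsum_snoc [simp]: "rsum (h @ [x]) = (if alive h then rsum h + rew M (st x) (ac x) else rsum h)"
  by (simp_all add: rsum_def)

lemma rsum_eq_return:
  assumes "\<exists>i. nxt (\<omega> i) = None" "tau \<omega> \<le> n"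
  shows "rsum (prefix_of \<omega> n) = episode_return M \<omega>"
  using assms by (simp add: rsum_def stopsum_prefix_of episode_return_def min_def)

lemma pos_eq_None:
  assumes "\<exists>i. nxt (\<omega> i) = None" "tau \<omega> \<le> n"
  shows "pos s (prefix_of \<omega> n) = None"
  using assms by (simp add: pos_dead alive_prefix_of_iff_tau)

context
  fixes \<pi> s
  assumes HD: "\<pi> \<in> HD_policies M" and s: "s \<in> states M"
begin

interpretation A: sp_agent M s "agent_of \<pi>" by (rule sp_agent_HD[OF HD s])
interpretation P: prob_space "episode M \<pi> s" unfolding episode_eq by (rule prob_space_seq_measure)

lemma abs_rsum_le:
  assumes "\<exists>i. nxt (\<omega> i) = None" "A.consistent \<omega>"
  shows "\<bar>rsum (prefix_of \<omega> n)\<bar> \<le> real (tau \<omega>)"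
proof -
  have "\<bar>rsum (prefix_of \<omega> n)\<bar> \<le> (\<Sum>i<min n (tau \<omega>). \<bar>rew M (st (\<omega> i)) (ac (\<omega> i))\<bar>)"
    unfolding rsum_def stopsum_prefix_of[OF assms(1)] by (rule sum_abs)
  also have "\<dots> \<le> (\<Sum>i<min n (tau \<omega>). 1)"
  proof (rule sum_mono)
    fix i
    have "good_tr M (\<omega> i)" using assms(2) unfolding A.consistent_def by blast
    then show "\<bar>rew M (st (\<omega> i)) (ac (\<omega> i))\<bar> \<le> 1" unfolding good_tr_def by (intro rew_le) auto
  qed
  finally show ?thesis by simp
qed

lemma pos_in_next_states: "A.consistent \<omega> \<Longrightarrow> pos s (prefix_of \<omega> n) \<in> next_states M"
proof -
  assume "A.consistent \<omega>"
  then have "good_hist M (prefix_of \<omega> n)" unfolding A.consistent_def by blast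
  then have "A.cur (prefix_of \<omega> n) \<in> states M" by (rule A.cur_in_states)
  then show ?thesis unfolding pos_def by simp
qed

lemma measurable_return: "episode_return M \<in> borel_measurable (episode M \<pi> s)"
  unfolding episode_eq episode_return_def[abs_def] by (rule measurable_sum_tau[where w="\<lambda>x. rew M (st x) (ac x)"])

text \<open>The added \<open>V\<close> disappears at termination, where it is zero. Before
  termination it is what makes the sum a martingale, a supermartingale or a submartingale in the
  applications.\<close>

lemma val_limit:
  assumes "V None = 0" "\<And>y. y \<in> next_states M \<Longrightarrow> \<bar>V y\<bar> \<le> ht y"
  shows "(\<lambda>n. measure_pmf.expectation (hist (step_law M s (agent_of \<pi>)) n) (\<lambda>h. rsum h + V (pos s h))) \<longlonglongrightarrow> val M \<pi> s"
    and "integrable (episode M \<pi> s) (episode_return M)"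
proof -
  let ?g = "\<lambda>h. rsum h + V (pos s h)"
  have lim: "?g (prefix_of \<omega> n) = episode_return M \<omega>" if "\<exists>i. nxt (\<omega> i) = None" "tau \<omega> \<le> n" for \<omega> n
    using that by (simp add: rsum_eq_return pos_eq_None assms)
  have bd: "\<bar>?g (prefix_of \<omega> n)\<bar> \<le> (real (tau \<omega>) + (1 + 2 * htmax))\<^sup>2"
    if "\<exists>i. nxt (\<omega> i) = None" "A.consistent \<omega>" for \<omega> n
  proof -
    have "\<bar>?g (prefix_of \<omega> n)\<bar> \<le> real (tau \<omega>) + (1 + 2 * htmax)"
      using abs_rsum_le[OF that, of n] assms(2)[OF pos_in_next_states[OF that(2), of n]]
        ht_le[OF pos_in_next_states[OF that(2), of n]] htmax_nonneg by linarith
    also have "\<dots> \<le> (real (tau \<omega>) + (1 + 2 * htmax))\<^sup>2"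
      using htmax_nonneg by (intro self_le_power) auto
    finally show ?thesis .
  qed
  note * = episode_expectation_limit[OF HD s, where g="?g", OF measurable_return lim bd]
  show "(\<lambda>n. measure_pmf.expectation (hist (step_law M s (agent_of \<pi>)) n) ?g) \<longlonglongrightarrow> val M \<pi> s"
    unfolding val_def by (rule *(1))
  show "integrable (episode M \<pi> s) (episode_return M)" by (rule *(2))
qed

lemma return_square_limit:
  assumes "\<And>\<omega> n. \<exists>i. nxt (\<omega> i) = None \<Longrightarrow> tau \<omega> \<le> n \<Longrightarrow> g (prefix_of \<omega> n) = (episode_return M \<omega>)\<^sup>2"
    and "\<And>h. pos s h \<in> next_states M \<Longrightarrow> \<bar>g h\<bar> \<le> ht2 (pos s h) \<bar>rsum h\<bar>"
  shows "(\<lambda>n. measure_pmf.expectation (hist (step_law M s (agent_of \<pi>)) n) g) \<longlonglongrightarrow> (LINT \<omega>|episode M \<pi> s. (episode_return M \<omega>)\<^sup>2)"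
    and "integrable (episode M \<pi> s) (\<lambda>\<omega>. (episode_return M \<omega>)\<^sup>2)"
proof -
  have bd: "\<bar>g (prefix_of \<omega> n)\<bar> \<le> (real (tau \<omega>) + (1 + 2 * htmax))\<^sup>2"
    if "\<exists>i. nxt (\<omega> i) = None" "A.consistent \<omega>" for \<omega> n
  proof -
    note ns = pos_in_next_states[OF that(2), of n]
    have "\<bar>g (prefix_of \<omega> n)\<bar> \<le> ht2 (pos s (prefix_of \<omega> n)) \<bar>rsum (prefix_of \<omega> n)\<bar>"
      by (rule assms(2)[OF ns])
    also have "\<dots> \<le> ht2 (pos s (prefix_of \<omega> n)) (real (tau \<omega>))"
      using abs_rsum_le[OF that, of n] by (intro ht2_mono ns) auto
    also have "\<dots> \<le> (real (tau \<omega>) + (1 + 2 * htmax))\<^sup>2"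
      by (intro ht2_le_square ns) auto
    finally show ?thesis .
  qed
  have m: "(\<lambda>\<omega>. (episode_return M \<omega>)\<^sup>2) \<in> borel_measurable (episode M \<pi> s)"
    by (intro borel_measurable_power measurable_return)
  note * = episode_expectation_limit[OF HD s, where g=g and F="\<lambda>\<omega>. (episode_return M \<omega>)\<^sup>2" and b="1 + 2 * htmax", OF m assms(1) bd]
  show "(\<lambda>n. measure_pmf.expectation (hist (step_law M s (agent_of \<pi>)) n) g) \<longlonglongrightarrow> (LINT \<omega>|episode M \<pi> s. (episode_return M \<omega>)\<^sup>2)"
    by (rule *(1))
  show "integrable (episode M \<pi> s) (\<lambda>\<omega>. (episode_return M \<omega>)\<^sup>2)"
    by (rule *(2))
qed

lemma return_square_integrable: "integrable (episode M \<pi> s) (\<lambda>\<omega>. (episode_return M \<omega>)\<^sup>2)"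
proof (rule return_square_limit(2)[of "\<lambda>h. (rsum h)\<^sup>2"])
  fix h :: "('s, 'a) transition list" assume "pos s h \<in> next_states M"
  then show "\<bar>(rsum h)\<^sup>2\<bar> \<le> ht2 (pos s h) \<bar>rsum h\<bar>"
    using ht_nonneg[of "pos s h"] htmax_nonneg by (simp add: ht2_def)
qed (simp add: rsum_eq_return)

lemma return_square_bound: "(LINT \<omega>|episode M \<pi> s. (episode_return M \<omega>)\<^sup>2) \<le> ht2 (Some s) 0"
proof -
  have "(LINT \<omega>|episode M \<pi> s. (episode_return M \<omega>)\<^sup>2) \<le> (LINT \<omega>|episode M \<pi> s. (real (tau \<omega>))\<^sup>2)"
  proof (rule integral_mono_AE[OF return_square_integrable tau_square_integrable[OF HD s]])
    show "AE \<omega> in episode M \<pi> s. (episode_return M \<omega>)\<^sup>2 \<le> (real (tau \<omega>))\<^sup>2"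
      using AE_terminates[OF HD s] A.AE_consistent[unfolded interaction_def, folded episode_eq]
    proof eventually_elim
      case (elim \<omega>)
      then have "\<bar>episode_return M \<omega>\<bar> \<le> real (tau \<omega>)"
        using abs_rsum_le[of \<omega> "tau \<omega>"] by (simp add: rsum_eq_return)
      then have "\<bar>episode_return M \<omega>\<bar>\<^sup>2 \<le> (real (tau \<omega>))\<^sup>2" by (rule power_mono) simp
      then show ?case by simp
    qed
  qed
  also note tau_square_bound[OF HD s]
  finally show ?thesis .
qed

lemma val_square_le: "(val M \<pi> s)\<^sup>2 \<le> (LINT \<omega>|episode M \<pi> s. (episode_return M \<omega>)\<^sup>2)"
proof -
  have "integrable (episode M \<pi> s) (episode_return M)"
    by (rule val_limit(2)[of "\<lambda>_. 0"]) (use ht_nonneg in auto)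
  then have "0 \<le> (LINT \<omega>|episode M \<pi> s. (episode_return M \<omega>)\<^sup>2) - (val M \<pi> s)\<^sup>2"
    using P.variance_positive[of "episode_return M"] return_square_integrable
    by (simp add: P.variance_eq val_def)
  then show ?thesis by simp
qed

end

text \<open>The supremum in \<open>R_from\<close> bounds its members only because the second moments
  are bounded uniformly over policies, which \<open>return_square_bound\<close> provides.\<close>

lemma
  assumes HD: "\<pi> \<in> HD_policies M" and s: "s \<in> states M"
  shows return_square_le_R_from: "(LINT \<omega>|episode M \<pi> s. (episode_return M \<omega>)\<^sup>2) \<le> (R_from M s)\<^sup>2"
    and R_from_nonneg: "0 \<le> R_from M s"
proof -
  let ?E = "\<lambda>\<pi>. LINT \<omega>|episode M \<pi> s. (episode_return M \<omega>)\<^sup>2"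
  have "bdd_above ((\<lambda>\<pi>. sqrt (?E \<pi>)) ` HD_policies M)"
    unfolding bdd_above_def
  proof (intro exI ballI)
    fix r assume "r \<in> (\<lambda>\<pi>. sqrt (?E \<pi>)) ` HD_policies M"
    then obtain \<rho> where \<rho>: "\<rho> \<in> HD_policies M" "r = sqrt (?E \<rho>)" by blast
    show "r \<le> sqrt (ht2 (Some s) 0)"
      unfolding \<rho>(2) by (rule real_sqrt_le_mono) (rule return_square_bound[OF \<rho>(1) s])
  qed
  then have le: "sqrt (?E \<pi>) \<le> R_from M s"
    unfolding R_from_def by (rule cSUP_upper[OF HD])
  have E: "0 \<le> ?E \<pi>" by (rule Bochner_Integration.integral_nonneg) (rule zero_le_power2)
  then have sq: "0 \<le> sqrt (?E \<pi>)" by (rule real_sqrt_ge_zero)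
  show "0 \<le> R_from M s" by (rule order_trans[OF sq le])
  have "(sqrt (?E \<pi>))\<^sup>2 \<le> (R_from M s)\<^sup>2" by (rule power_mono[OF le sq])
  then show "?E \<pi> \<le> (R_from M s)\<^sup>2" unfolding real_sqrt_pow2[OF E] .
qed

lemma val_le_R_from:
  assumes HD: "\<pi> \<in> HD_policies M" and s: "s \<in> states M"
  shows "\<bar>val M \<pi> s\<bar> \<le> R_from M s"
proof (rule power2_le_imp_le)
  show "\<bar>val M \<pi> s\<bar>\<^sup>2 \<le> (R_from M s)\<^sup>2"
    unfolding power2_abs by (rule order_trans[OF val_square_le[OF HD s] return_square_le_R_from[OF HD s]])
qed (rule R_from_nonneg[OF HD s])

context
  fixes \<pi> s
  assumes HD: "\<pi> \<in> HD_policies M" and s: "s \<in> states M"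
begin

interpretation A: sp_agent M s "agent_of \<pi>" by (rule sp_agent_HD[OF HD s])

text \<open>Verification: the hypothesis makes \<open>rsum h + V (pos s h)\<close> a
  supermartingale, and its expectations tend to the value of \<open>\<pi>\<close>. It concerns only
  the action actually taken, so the policy may depend on the history in any way.\<close>

lemma val_le:
  assumes V: "V None = 0" "\<And>y. y \<in> next_states M \<Longrightarrow> \<bar>V y\<bar> \<le> ht y"
    and step: "\<And>h. good_hist M h \<Longrightarrow> rew M (A.cur h) (A.act h) + Pv M (A.cur h) (A.act h) V \<le> V (Some (A.cur h))"
  shows "val M \<pi> s \<le> V (Some s)"
proof (rule LIMSEQ_le_const2[OF val_limit(1)[OF HD s, of V]])
  have "A.stepE (\<lambda>h. rsum h + V (pos s h)) h \<le> rsum h + V (pos s h)" if "good_hist M h" for h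
    unfolding A.stepE_eq[OF that] using step[OF that] that V(1)
    by (cases "alive h") (simp_all add: pos_alive pos_dead Pv_add_const Pv_const)
  from A.expectation_supermart[of "\<lambda>h. rsum h + V (pos s h)", OF this]
  show "\<exists>N. \<forall>n\<ge>N. measure_pmf.expectation (hist (step_law M s (agent_of \<pi>)) n) (\<lambda>h. rsum h + V (pos s h)) \<le> V (Some s)"
    by simp
qed (use V in auto)

lemma val_ge:
  assumes V: "V None = 0" "\<And>y. y \<in> next_states M \<Longrightarrow> \<bar>V y\<bar> \<le> ht y"
    and step: "\<And>h. good_hist M h \<Longrightarrow> V (Some (A.cur h)) \<le> rew M (A.cur h) (A.act h) + Pv M (A.cur h) (A.act h) V"
  shows "V (Some s) \<le> val M \<pi> s"
proof (rule LIMSEQ_le_const[OF val_limit(1)[OF HD s, of V]])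
  have "rsum h + V (pos s h) \<le> A.stepE (\<lambda>h. rsum h + V (pos s h)) h" if "good_hist M h" for h
    unfolding A.stepE_eq[OF that] using step[OF that] that V(1)
    by (cases "alive h") (simp_all add: pos_alive pos_dead Pv_add_const Pv_const)
  from A.expectation_submart[of "\<lambda>h. rsum h + V (pos s h)", OF this]
  show "\<exists>N. \<forall>n\<ge>N. V (Some s) \<le> measure_pmf.expectation (hist (step_law M s (agent_of \<pi>)) n) (\<lambda>h. rsum h + V (pos s h))"
    by simp
qed (use V in auto)

end

lemma stationary_HD: "(\<And>s. \<mu> s \<in> actions M) \<Longrightarrow> stationary \<mu> \<in> HD_policies M"
  by (auto simp: stationary_def HD_policies_def)

lemma agent_of_stationary [simp]: "agent_of (stationary \<mu>) h = \<mu>"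
  by (simp add: agent_of_def stationary_def)

lemma val_stationary:
  assumes \<mu>: "\<And>s. \<mu> s \<in> actions M" and s: "s \<in> states M"
    and V: "V None = 0" "\<And>y. y \<in> next_states M \<Longrightarrow> \<bar>V y\<bar> \<le> ht y"
    and step: "\<And>s. s \<in> states M \<Longrightarrow> V (Some s) = rew M s (\<mu> s) + Pv M s (\<mu> s) V"
  shows "val M (stationary \<mu>) s = V (Some s)"
proof -
  note HD = stationary_HD[of \<mu>, OF \<mu>]
  interpret A: sp_agent M s "agent_of (stationary \<mu>)" by (rule sp_agent_HD[OF HD s])
  show ?thesis
    using step A.cur_in_states by (intro antisym val_le[OF HD s V] val_ge[OF HD s V]) force+
qed

section \<open>The optimality equation\<close>

definition Vs :: "'s option \<Rightarrow> real" where
  "Vs y = (case y of None \<Rightarrow> 0 | Some s \<Rightarrow> Vstar M s)"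

lemma Vs_None [simp]: "Vs None = 0"
  by (simp add: Vs_def)

text \<open>A fixed point of the optimality operator dominates the value of every policy and is
  attained by its greedy policy. Hence an optimal policy exists, and the one selected in
  \<open>Vstar\<close> has the values of the fixed point.\<close>

lemma Vs_optimality:
  "(\<forall>y\<in>next_states M. \<bar>Vs y\<bar> \<le> ht y) \<and>
   (\<forall>s\<in>states M. \<forall>a\<in>actions M. rew M s a + Pv M s a Vs \<le> Vs (Some s)) \<and>
   (\<exists>\<mu>. (\<forall>s. \<mu> s \<in> actions M) \<and>
      (\<forall>s\<in>states M. Vs (Some s) = rew M s (\<mu> s) + Pv M s (\<mu> s) Vs \<and> Vs (Some s) = val M (stationary \<mu>) s))"
proof -
  obtain V where V: "V None = 0" "\<And>y. y \<in> next_states M \<Longrightarrow> \<bar>V y\<bar> \<le> ht y"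
    "\<And>y. y \<in> next_states M \<Longrightarrow> bell (rew M) V y = V y"
    using ex_bell_fixpoint[of "rew M"] rew_le by blast
  have ge: "rew M s a + Pv M s a V \<le> V (Some s)" if "s \<in> states M" "a \<in> actions M" for s a
    using bell_ge[OF that(2), of "rew M" s V] V(3)[of "Some s"] that by simp
  obtain \<mu> where \<mu>: "\<And>s. \<mu> s \<in> actions M" "\<And>s. bell (rew M) V (Some s) = rew M s (\<mu> s) + Pv M s (\<mu> s) V"
    using bell_attained[of "rew M" V] by metis
  have \<mu>': "V (Some s) = rew M s (\<mu> s) + Pv M s (\<mu> s) V" if "s \<in> states M" for s
    using \<mu>(2)[of s] V(3)[of "Some s"] that by simp
  have val\<mu>: "val M (stationary \<mu>) s = V (Some s)" if "s \<in> states M" for s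
    by (rule val_stationary[OF \<mu>(1) that V(1,2) \<mu>'])
  have le: "val M \<pi> s \<le> V (Some s)" if "\<pi> \<in> HD_policies M" "s \<in> states M" for \<pi> s
  proof -
    interpret A: sp_agent M s "agent_of \<pi>" by (rule sp_agent_HD[OF that])
    show ?thesis by (rule val_le[OF that V(1,2)]) (auto intro!: ge)
  qed
  have "optimal M \<mu>"
    unfolding optimal_def using val\<mu> le stationary_HD[of \<mu>, OF \<mu>(1)] by auto
  then have opt: "optimal M (SOME \<mu>. optimal M \<mu>)" by (rule someI[where P="optimal M"])
  have Vs: "Vs (Some s) = V (Some s)" if "s \<in> states M" for s
  proof (rule antisym)
    show "Vs (Some s) \<le> V (Some s)"
      using opt le[OF _ that] by (simp add: Vs_def Vstar_def optimal_def[of M "SOME \<mu>. optimal M \<mu>"])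
    have "val M (stationary \<mu>) s \<le> val M (stationary (SOME \<mu>. optimal M \<mu>)) s"
      using opt stationary_HD[of \<mu>, OF \<mu>(1)] that unfolding optimal_def[of M "SOME \<mu>. optimal M \<mu>"] by blast
    then show "V (Some s) \<le> Vs (Some s)"
      using val\<mu>[OF that] by (simp add: Vs_def Vstar_def)
  qed
  then have Vs': "Vs y = V y" if "y \<in> next_states M" for y
    using that V(1) by (cases y) auto
  have Pv: "Pv M s a Vs = Pv M s a V" for s a by (rule Pv_cong) (rule Vs')
  show ?thesis
  proof (intro conjI exI[of _ \<mu>] ballI allI)
    fix y assume "y \<in> next_states M" then show "\<bar>Vs y\<bar> \<le> ht y" using Vs' V(2) by simp
  qed (use Vs ge \<mu>(1) \<mu>' val\<mu> in \<open>auto simp: Pv\<close>)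
qed

lemma Vs_abs_le_ht: "y \<in> next_states M \<Longrightarrow> \<bar>Vs y\<bar> \<le> ht y"
  and Vs_ge: "s \<in> states M \<Longrightarrow> a \<in> actions M \<Longrightarrow> rew M s a + Pv M s a Vs \<le> Vs (Some s)"
  using Vs_optimality by blast+

definition mu_star :: "'s \<Rightarrow> 'a" where
  "mu_star = (SOME \<mu>. (\<forall>s. \<mu> s \<in> actions M) \<and>
      (\<forall>s\<in>states M. Vs (Some s) = rew M s (\<mu> s) + Pv M s (\<mu> s) Vs \<and> Vs (Some s) = val M (stationary \<mu>) s))"

lemma mu_star: "mu_star s \<in> actions M"
  "s \<in> states M \<Longrightarrow> Vs (Some s) = rew M s (mu_star s) + Pv M s (mu_star s) Vs"
  "s \<in> states M \<Longrightarrow> Vs (Some s) = val M (stationary mu_star) s"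
  using someI_ex[OF Vs_optimality[THEN conjunct2, THEN conjunct2]] unfolding mu_star_def[symmetric]
  by auto

lemma R_from_le_Rmax: "s \<in> states M \<Longrightarrow> R_from M s \<le> Rmax M"
  by (simp add: Rmax_def)

lemma val_le_Rmax: "\<pi> \<in> HD_policies M \<Longrightarrow> s \<in> states M \<Longrightarrow> \<bar>val M \<pi> s\<bar> \<le> Rmax M"
  by (rule order_trans[OF val_le_R_from R_from_le_Rmax])

lemma Rmax_nonneg: "0 \<le> Rmax M"
  using val_le_Rmax[OF stationary_HD[of mu_star, OF mu_star(1)], of "s_init M"] by simp

lemma Vs_abs_le_Rmax: "y \<in> next_states M \<Longrightarrow> \<bar>Vs y\<bar> \<le> Rmax M"
  using mu_star(3) val_le_Rmax[OF stationary_HD[of mu_star, OF mu_star(1)]] Rmax_nonneg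
  by (cases y) auto

section \<open>Gaps and their total over an episode\<close>

definition adv :: "'s \<Rightarrow> 'a \<Rightarrow> real" where
  "adv s a = Vs (Some s) - (rew M s a + Pv M s a Vs)"

lemma adv_nonneg: "s \<in> states M \<Longrightarrow> a \<in> actions M \<Longrightarrow> 0 \<le> adv s a"
  using Vs_ge by (simp add: adv_def)

text \<open>Here \<open>u y\<close> is the largest possible expected sum of the gaps \<open>adv\<close> over the rest of an episode.\<close>

lemma ex_gap_potential:
  "\<exists>u. u None = 0 \<and> (\<forall>y\<in>next_states M. 0 \<le> u y \<and> u y \<le> 2 * Rmax M) \<and>
     (\<forall>s\<in>states M. \<forall>a\<in>actions M. Pv M s a u \<le> u (Some s) - adv s a)"
proof -
  \<comment> \<open>In expectation the gaps of a policy add up to its loss against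
    \<open>Vs\<close>, so the extreme policy is one of least value. Negating the rewards yields that
    least value as \<open>- V\<close>; both \<open>Vs\<close> and \<open>V\<close> are bounded by
    \<open>Rmax M\<close>, hence the factor 2.\<close>
  obtain V where V: "V None = 0" "\<And>y. y \<in> next_states M \<Longrightarrow> \<bar>V y\<bar> \<le> ht y"
    "\<And>y. y \<in> next_states M \<Longrightarrow> bell (\<lambda>s a. - rew M s a) V y = V y"
    using ex_bell_fixpoint[of "\<lambda>s a. - rew M s a"] rew_le by auto
  have ge: "- rew M s a + Pv M s a V \<le> V (Some s)" if "s \<in> states M" "a \<in> actions M" for s a
    using bell_ge[OF that(2), of "\<lambda>s a. - rew M s a" s V] V(3)[of "Some s"] that by simp
  obtain \<mu> where \<mu>: "\<And>s. \<mu> s \<in> actions M" "\<And>s. bell (\<lambda>s a. - rew M s a) V (Some s) = - rew M s (\<mu> s) + Pv M s (\<mu> s) V"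
    using bell_attained[of "\<lambda>s a. - rew M s a" V] by metis
  have val: "val M (stationary \<mu>) s = - V (Some s)" if "s \<in> states M" for s
  proof (rule val_stationary[of \<mu> s "\<lambda>y. - V y"])
    fix s assume "s \<in> states M"
    then show "- V (Some s) = rew M s (\<mu> s) + Pv M s (\<mu> s) (\<lambda>y. - V y)"
      using \<mu>(2)[of s] V(3)[of "Some s"] by (simp add: Pv_uminus)
  qed (use \<mu> V that in auto)
  have HD: "stationary \<mu> \<in> HD_policies M" by (rule stationary_HD) (rule \<mu>)
  show ?thesis
  proof (intro exI[of _ "\<lambda>y. Vs y + V y"] conjI ballI)
    fix y assume y: "y \<in> next_states M"
    have "\<bar>V y\<bar> \<le> Rmax M"
      using y V(1) Rmax_nonneg val val_le_Rmax[OF HD] by (cases y) fastforce+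
    then show "Vs y + V y \<le> 2 * Rmax M" using Vs_abs_le_Rmax[OF y] by linarith
    show "0 \<le> Vs y + V y"
    proof (cases y)
      case (Some s)
      have "val M (stationary \<mu>) s \<le> Vs (Some s)"
      proof -
        have s: "s \<in> states M" using y Some by simp
        interpret A: sp_agent M s "agent_of (stationary \<mu>)" by (rule sp_agent_HD[OF HD s])
        show ?thesis by (rule val_le[OF HD s]) (auto intro!: Vs_ge Vs_abs_le_ht \<mu>)
      qed
      then show ?thesis using val[of s] y Some by simp
    qed (simp add: V)
  next
    fix s a assume "s \<in> states M" "a \<in> actions M"
    from ge[OF this] show "Pv M s a (\<lambda>y. Vs y + V y) \<le> Vs (Some s) + V (Some s) - adv s a"
      by (simp add: Pv_add adv_def)
  qed (simp add: V)
qed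

definition gappot :: "'s option \<Rightarrow> real" where
  "gappot = (SOME u. u None = 0 \<and> (\<forall>y\<in>next_states M. 0 \<le> u y \<and> u y \<le> 2 * Rmax M) \<and>
     (\<forall>s\<in>states M. \<forall>a\<in>actions M. Pv M s a u \<le> u (Some s) - adv s a))"

lemma gappot_None [simp]: "gappot None = 0"
  and gappot_nonneg: "y \<in> next_states M \<Longrightarrow> 0 \<le> gappot y"
  and gappot_le: "y \<in> next_states M \<Longrightarrow> gappot y \<le> 2 * Rmax M"
  and gappot_step: "s \<in> states M \<Longrightarrow> a \<in> actions M \<Longrightarrow> Pv M s a gappot \<le> gappot (Some s) - adv s a"
  using someI_ex[OF ex_gap_potential] unfolding gappot_def[symmetric] by blast+

lemma adv_le: "s \<in> states M \<Longrightarrow> a \<in> actions M \<Longrightarrow> adv s a \<le> 2 * Rmax M"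
  using gappot_step[of s a] gappot_le[of "Some s"] Pv_ge_const[of s a 0 gappot] gappot_nonneg by force


section \<open>Variance potentials\<close>

text \<open>\<open>psi n y c\<close> is the largest second moment of \<open>c\<close> plus the remaining return
  when the optimal policy is followed after at most \<open>n\<close> further steps.\<close>

primrec psi :: "nat \<Rightarrow> 's option \<Rightarrow> real \<Rightarrow> real" where
  "psi 0 y c = (c + Vs y)\<^sup>2"
| "psi (Suc n) y c = (case y of None \<Rightarrow> c\<^sup>2
     | Some s \<Rightarrow> Max ((\<lambda>a. Pv M s a (\<lambda>y'. psi n y' (c + rew M s a))) ` actions M))"

lemma psi_None [simp]: "psi n None c = c\<^sup>2"
  by (cases n) auto

lemma psi_Suc_ge: "a \<in> actions M \<Longrightarrow> Pv M s a (\<lambda>y'. psi n y' (c + rew M s a)) \<le> psi (Suc n) (Some s) c"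
  by simp

lemma psi_Suc_attained: "\<exists>a\<in>actions M. psi (Suc n) (Some s) c = Pv M s a (\<lambda>y'. psi n y' (c + rew M s a))"
  using Max_in[of "(\<lambda>a. Pv M s a (\<lambda>y'. psi n y' (c + rew M s a))) ` actions M"]
  by (simp add: image_iff)

text \<open>By the optimality equation, \<open>c + Vs\<close> is preserved in mean along
  \<open>mu_star\<close>, so Jensen's inequality applies to its square. This starts the induction
  for \<open>psi_mono\<close>.\<close>

lemma psi_0_le_step:
  assumes "s \<in> states M"
  shows "(c + Vs (Some s))\<^sup>2 \<le> Pv M s (mu_star s) (\<lambda>y'. (c + rew M s (mu_star s) + Vs y')\<^sup>2)"
proof -
  have "(c + Vs (Some s))\<^sup>2 = (Pv M s (mu_star s) (\<lambda>y'. c + rew M s (mu_star s) + Vs y'))\<^sup>2"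
    using assms mu_star(1) mu_star(2)[OF assms] by (simp add: Pv_add_const add.assoc)
  also have "\<dots> \<le> Pv M s (mu_star s) (\<lambda>y'. (c + rew M s (mu_star s) + Vs y')\<^sup>2)"
    by (rule Pv_jensen_square) (use assms mu_star in auto)
  finally show ?thesis .
qed

lemma psi_mono: "y \<in> next_states M \<Longrightarrow> psi n y c \<le> psi (Suc n) y c"
proof (induction n arbitrary: y c)
  case 0
  show ?case
  proof (cases y)
    case (Some s)
    have "psi 0 y c \<le> Pv M s (mu_star s) (\<lambda>y'. psi 0 y' (c + rew M s (mu_star s)))"
      using psi_0_le_step[of s c] 0 Some by simp
    also have "\<dots> \<le> psi (Suc 0) y c" unfolding Some by (rule psi_Suc_ge) (rule mu_star)
    finally show ?thesis .
  qed simp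
next
  case (Suc n)
  show ?case
  proof (cases y)
    case (Some s)
    obtain a where a: "a \<in> actions M" "psi (Suc n) (Some s) c = Pv M s a (\<lambda>y'. psi n y' (c + rew M s a))"
      using psi_Suc_attained by blast
    have "psi (Suc n) (Some s) c \<le> Pv M s a (\<lambda>y'. psi (Suc n) y' (c + rew M s a))"
      unfolding a(2) by (rule Pv_mono) (rule Suc.IH)
    also have "\<dots> \<le> psi (Suc (Suc n)) (Some s) c" by (rule psi_Suc_ge) (rule a)
    finally show ?thesis by (simp only: Some)
  qed simp
qed

lemma psi_nonneg: "y \<in> next_states M \<Longrightarrow> 0 \<le> psi n y c"
proof (induction n)
  case (Suc n) then show ?case using psi_mono[of y n c] by linarith
qed simp

lemma psi_le_ht2: "y \<in> next_states M \<Longrightarrow> psi n y c \<le> ht2 y \<bar>c\<bar>"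
proof (induction n arbitrary: y c)
  case 0
  have "(c + Vs y)\<^sup>2 = \<bar>c + Vs y\<bar>\<^sup>2" by simp
  also have "\<dots> \<le> (\<bar>c\<bar> + ht y)\<^sup>2"
    using Vs_abs_le_ht[OF 0] by (intro power_mono) auto
  also have "\<dots> \<le> ht2 y \<bar>c\<bar>"
    using mult_right_mono[of "ht y" "1 + 2 * htmax" "ht y"] ht_le[OF 0] ht_nonneg[OF 0]
    by (simp add: ht2_def power2_eq_square algebra_simps)
  finally show ?case by simp
next
  case (Suc n)
  show ?case
  proof (cases y)
    case (Some s)
    obtain a where a: "a \<in> actions M" "psi (Suc n) (Some s) c = Pv M s a (\<lambda>y'. psi n y' (c + rew M s a))"
      using psi_Suc_attained by blast
    have s: "s \<in> states M" using Suc.prems Some by simp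
    have "psi (Suc n) (Some s) c \<le> Pv M s a (\<lambda>y'. ht2 y' (\<bar>c\<bar> + 1))"
      unfolding a(2)
    proof (rule Pv_mono)
      fix y' assume y': "y' \<in> next_states M"
      have "psi n y' (c + rew M s a) \<le> ht2 y' \<bar>c + rew M s a\<bar>" by (rule Suc.IH[OF y'])
      also have "\<dots> \<le> ht2 y' (\<bar>c\<bar> + 1)"
        using rew_le[OF s a(1)] by (intro ht2_mono y') auto
      finally show "psi n y' (c + rew M s a) \<le> ht2 y' (\<bar>c\<bar> + 1)" .
    qed
    also have "\<dots> \<le> ht2 (Some s) \<bar>c\<bar>" by (rule ht2_step) (use s a in auto)
    finally show ?thesis by (simp only: Some)
  qed (simp add: ht2_def)
qed

text \<open>A single history-dependent policy realises \<open>psi\<close>. The maximising action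
  depends on the state, the number of steps left and the reward collected so far, and a policy can
  recompute the latter from its state-action history; this is why the supremum in
  \<open>R_from\<close> ranges over \<open>HD_policies\<close>.\<close>

lemma psi_init_le:
  assumes s: "s \<in> states M"
  shows "psi n (Some s) 0 \<le> (R_from M s)\<^sup>2"
proof -
  define rp where "rp h = sum_list (map (\<lambda>(s, a). rew M s a) h)" for h
  define best where "best k s c = (SOME a. a \<in> actions M \<and>
     psi (Suc k) (Some s) c = Pv M s a (\<lambda>y'. psi k y' (c + rew M s a)))" for k s c
  have best: "best k s c \<in> actions M"
    "psi (Suc k) (Some s) c = Pv M s (best k s c) (\<lambda>y'. psi k y' (c + rew M s (best k s c)))" for k s c
    using someI_ex[of "\<lambda>a. a \<in> actions M \<and> psi (Suc k) (Some s) c = Pv M s a (\<lambda>y'. psi k y' (c + rew M s a))"]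
      psi_Suc_attained[of k s c] unfolding best_def by blast+
  define \<pi> where "\<pi> h s = (if length h < n then best (n - 1 - length h) s (rp h) else mu_star s)" for h s
  have HD: "\<pi> \<in> HD_policies M" by (auto simp: HD_policies_def \<pi>_def best mu_star)
  interpret A: sp_agent M s "agent_of \<pi>" by (rule sp_agent_HD[OF HD s])
  define W where "W h = psi (n - length h) (pos s h) (rsum h)" for h
  \<comment> \<open>Valid only before termination: \<open>rsum\<close> stops there, while the
    recorded history goes on.\<close>
  have rp: "rp (map (\<lambda>x. (st x, ac x)) h) = rsum h" if "alive h" for h
    using that by (induction h rule: rev_induct) (auto simp: rp_def)
  have step: "W h \<le> A.stepE W h" if h: "good_hist M h" for h
  proof (cases "alive h")
    case False
    then show ?thesis unfolding A.stepE_eq[OF h] W_def using h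
      by (simp add: pos_dead Pv_const)
  next
    case alive: True
    have eq: "A.stepE W h = Pv M (A.cur h) (A.act h) (\<lambda>y. psi (n - Suc (length h)) y (rsum h + rew M (A.cur h) (A.act h)))"
      unfolding A.stepE_eq[OF h] W_def using alive by simp
    show ?thesis
    proof (cases "length h < n")
      case True
      then have k: "n - length h = Suc (n - 1 - length h)" by simp
      have act: "A.act h = best (n - 1 - length h) (A.cur h) (rsum h)"
        using True alive by (simp add: agent_of_def \<pi>_def rp)
      show ?thesis unfolding eq
        unfolding W_def k pos_alive[OF alive] by (subst best(2)) (simp add: act)
    next
      case False
      then have act: "A.act h = mu_star (A.cur h)"
        by (simp add: agent_of_def \<pi>_def)
      show ?thesis unfolding eq act
        using False psi_0_le_step[OF A.cur_in_states[OF h], of "rsum h"] by (simp add: W_def pos_alive[OF alive])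
    qed
  qed
  have "W [] \<le> (LINT \<omega>|episode M \<pi> s. (episode_return M \<omega>)\<^sup>2)"
  proof (rule LIMSEQ_le_const[OF return_square_limit(1)[OF HD s, of W]])
    show "\<exists>N. \<forall>m\<ge>N. W [] \<le> measure_pmf.expectation (hist (step_law M s (agent_of \<pi>)) m) W"
      using A.expectation_submart[of W, OF step] by simp
  next
    fix h :: "('s, 'a) transition list" assume "pos s h \<in> next_states M"
    then show "\<bar>W h\<bar> \<le> ht2 (pos s h) \<bar>rsum h\<bar>"
      unfolding W_def using psi_nonneg psi_le_ht2 by (simp add: abs_of_nonneg)
  qed (simp add: W_def pos_eq_None rsum_eq_return)
  also have "\<dots> \<le> (R_from M s)\<^sup>2" by (rule return_square_le_R_from[OF HD s])
  finally show ?thesis by (simp add: W_def)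
qed

text \<open>In the limit the horizon disappears, so that \<open>Psi_step\<close> compares
  \<open>Psi\<close> with itself instead of with a shifted index.\<close>

definition Psi :: "'s option \<Rightarrow> real \<Rightarrow> real" where "Psi y c = (SUP n. psi n y c)"

lemma psi_tendsto:
  assumes "y \<in> next_states M"
  shows "(\<lambda>n. psi n y c) \<longlonglongrightarrow> Psi y c"
  unfolding Psi_def
proof (rule LIMSEQ_incseq_SUP)
  show "bdd_above (range (\<lambda>n. psi n y c))"
    using psi_le_ht2[OF assms] by (auto simp: bdd_above_def)
  show "incseq (\<lambda>n. psi n y c)" by (rule incseq_SucI) (rule psi_mono[OF assms])
qed

lemma Psi_None [simp]: "Psi None c = c\<^sup>2"
  by (simp add: Psi_def)

lemma Psi_ge: "y \<in> next_states M \<Longrightarrow> (c + Vs y)\<^sup>2 \<le> Psi y c"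
  by (rule incseq_le[OF incseq_SucI psi_tendsto, of y c 0, simplified psi.simps(1)]) (use psi_mono in auto)

lemma Psi_init_le: "s \<in> states M \<Longrightarrow> Psi (Some s) 0 \<le> (R_from M s)\<^sup>2"
  by (rule LIMSEQ_le_const2[OF psi_tendsto]) (use psi_init_le in auto)

lemma Psi_step:
  assumes "s \<in> states M" "a \<in> actions M"
  shows "Pv M s a (\<lambda>y. Psi y (c + rew M s a)) \<le> Psi (Some s) c"
proof (rule LIMSEQ_le)
  show "(\<lambda>n. Pv M s a (\<lambda>y. psi n y (c + rew M s a))) \<longlonglongrightarrow> Pv M s a (\<lambda>y. Psi y (c + rew M s a))"
    by (rule tendsto_Pv) (rule psi_tendsto)
  show "(\<lambda>n. psi (Suc n) (Some s) c) \<longlonglongrightarrow> Psi (Some s) c"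
    by (rule LIMSEQ_Suc) (use assms in \<open>intro psi_tendsto, simp\<close>)
qed (use assms psi_Suc_ge in blast)

section \<open>Potentials for the sum of variances\<close>

definition Vr :: "'s \<Rightarrow> 'a \<Rightarrow> ('s option \<Rightarrow> real) \<Rightarrow> real" where
  "Vr s a v = Pv M s a (\<lambda>y. (v y)\<^sup>2) - (Pv M s a v)\<^sup>2"

lemma Vr_nonneg: "s \<in> states M \<Longrightarrow> a \<in> actions M \<Longrightarrow> 0 \<le> Vr s a v"
  using Pv_jensen_square by (simp add: Vr_def)

text \<open>The bias-variance decomposition about \<open>- k\<close>. Variance identities below are
  obtained by choosing \<open>k\<close>.\<close>

lemma Pv_square_shift:
  assumes "s \<in> states M" "a \<in> actions M"
  shows "Pv M s a (\<lambda>y. (k + v y)\<^sup>2) = (k + Pv M s a v)\<^sup>2 + Vr s a v"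
proof -
  have "Pv M s a (\<lambda>y. (k + v y)\<^sup>2) = Pv M s a (\<lambda>y. k\<^sup>2 + (2 * k * v y + (v y)\<^sup>2))"
    by (intro Pv_cong) (simp add: power2_eq_square algebra_simps)
  also have "\<dots> = k\<^sup>2 + (2 * k * Pv M s a v + Pv M s a (\<lambda>y. (v y)\<^sup>2))"
    using assms by (simp add: Pv_add_const) (simp add: Pv_add Pv_cmult)
  finally show ?thesis by (simp add: Vr_def power2_eq_square algebra_simps)
qed

text \<open>With \<open>c\<close> and \<open>A\<close> the sums of rewards and gaps so far, \<open>c + Vs y + A\<close> is a martingale with
  conditional variances \<open>Vr _ _ Vs\<close> whose final value is \<open>c + A\<close>.\<close>

definition Hp :: "'s option \<Rightarrow> real \<Rightarrow> real \<Rightarrow> real" where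
  "Hp y c A = 2 * Psi y c + 2 * A\<^sup>2 - (c + Vs y + A)\<^sup>2"

lemma Hp_nonneg: "y \<in> next_states M \<Longrightarrow> 0 \<le> Hp y c A"
  using Psi_ge[of y c] sum_squares_bound[of "c + Vs y" A]
  by (simp add: Hp_def power2_eq_square algebra_simps)

text \<open>Three changes add up: the \<open>Psi\<close> part does not increase, the square of the
  martingale grows by its conditional variance, and \<open>2 * A\<^sup>2\<close> grows by at most
  \<open>4 * adv s a * (A + adv s a)\<close>.\<close>

lemma Hp_step:
  assumes "s \<in> states M" "a \<in> actions M"
  shows "Pv M s a (\<lambda>y. Hp y (c + rew M s a) (A + adv s a))
    \<le> Hp (Some s) c A + 4 * adv s a * (A + adv s a) - Vr s a Vs"
proof -
  define k where "k = c + rew M s a + (A + adv s a)"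
  have "Pv M s a (\<lambda>y. Hp y (c + rew M s a) (A + adv s a)) =
      Pv M s a (\<lambda>y. 2 * (A + adv s a)\<^sup>2 + (2 * Psi y (c + rew M s a) - (k + Vs y)\<^sup>2))"
    by (intro Pv_cong) (simp add: Hp_def k_def algebra_simps)
  also have "\<dots> = 2 * (A + adv s a)\<^sup>2 + (2 * Pv M s a (\<lambda>y. Psi y (c + rew M s a)) - ((k + Pv M s a Vs)\<^sup>2 + Vr s a Vs))"
    using assms by (simp add: Pv_add_const) (simp add: Pv_diff Pv_cmult Pv_square_shift)
  also have "k + Pv M s a Vs = c + Vs (Some s) + A" by (simp add: k_def adv_def)
  finally have eq: "Pv M s a (\<lambda>y. Hp y (c + rew M s a) (A + adv s a)) =
    2 * (A + adv s a)\<^sup>2 + (2 * Pv M s a (\<lambda>y. Psi y (c + rew M s a)) - ((c + Vs (Some s) + A)\<^sup>2 + Vr s a Vs))" .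
  have "2 * (A + adv s a)\<^sup>2 - 2 * A\<^sup>2 \<le> 4 * adv s a * (A + adv s a)"
    by (simp add: power2_eq_square algebra_simps)
  then show ?thesis
    unfolding eq using Psi_step[OF assms, of c] unfolding Hp_def by linarith
qed

text \<open>The second summand pays for the error in \<open>Hp_step\<close>. A step with gap
  \<open>g\<close> lowers \<open>gappot\<close> by at least \<open>g\<close> on average, which is
  worth \<open>4 * g * (A + g + 2 * Rmax M)\<close>; the larger factor costs
  \<open>4 * g * gappot (Some s)\<close>, at most \<open>8 * g * Rmax M\<close>. What remains covers
  \<open>4 * g * (A + g)\<close>.\<close>

definition Phi :: "'s option \<Rightarrow> real \<Rightarrow> real \<Rightarrow> real" where
  "Phi y c A = Hp y c A + 4 * (A + 2 * Rmax M) * gappot y"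

lemma Phi_nonneg: "y \<in> next_states M \<Longrightarrow> 0 \<le> A \<Longrightarrow> 0 \<le> Phi y c A"
  using Hp_nonneg[of y c A] gappot_nonneg[of y] Rmax_nonneg by (simp add: Phi_def)

lemma Phi_step:
  assumes "s \<in> states M" "a \<in> actions M" "0 \<le> A"
  shows "Pv M s a (\<lambda>y. Phi y (c + rew M s a) (A + adv s a)) \<le> Phi (Some s) c A - Vr s a Vs"
proof -
  let ?g = "adv s a" and ?R = "Rmax M"
  have "Pv M s a (\<lambda>y. Phi y (c + rew M s a) (A + ?g)) =
      Pv M s a (\<lambda>y. Hp y (c + rew M s a) (A + ?g)) + 4 * (A + ?g + 2 * ?R) * Pv M s a gappot"
    unfolding Phi_def by (simp add: Pv_add Pv_cmult)
  also have "\<dots> \<le> (Hp (Some s) c A + 4 * ?g * (A + ?g) - Vr s a Vs) + 4 * (A + ?g + 2 * ?R) * (gappot (Some s) - ?g)"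
    using Hp_step[OF assms(1,2), of c A] gappot_step[OF assms(1,2)] assms adv_nonneg[OF assms(1,2)] Rmax_nonneg
    by (intro add_mono mult_left_mono) auto
  also have "\<dots> = Phi (Some s) c A - Vr s a Vs + 4 * ?g * (gappot (Some s) - 2 * ?R)"
    by (simp add: Phi_def algebra_simps)
  also have "\<dots> \<le> Phi (Some s) c A - Vr s a Vs"
    using gappot_le[of "Some s"] assms adv_nonneg[OF assms(1,2)] by (simp add: mult_nonneg_nonpos)
  finally show ?thesis .
qed

text \<open>The infimum over the accumulated quantities turns \<open>Phi\<close> into a function of
  the state alone. The step inequality survives, and the choice \<open>c = 0\<close>,
  \<open>A = 0\<close> gives a bound that holds for all histories.\<close>

definition varpot :: "'s option \<Rightarrow> real" where
  "varpot y = (INF p\<in>UNIV \<times> {0..}. Phi y (fst p) (snd p))"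

lemma varpot_le:
  assumes "y \<in> next_states M" "0 \<le> A"
  shows "varpot y \<le> Phi y c A"
proof -
  have "bdd_below ((\<lambda>p. Phi y (fst p) (snd p)) ` (UNIV \<times> {0..}))"
    using Phi_nonneg[OF assms(1)] by (auto simp: bdd_below_def intro!: exI[of _ 0])
  then have "varpot y \<le> Phi y (fst (c, A)) (snd (c, A))"
    unfolding varpot_def by (rule cINF_lower) (use assms in auto)
  then show ?thesis by simp
qed

lemma varpot_ge: "(\<And>c A. 0 \<le> A \<Longrightarrow> m \<le> Phi y c A) \<Longrightarrow> m \<le> varpot y"
  unfolding varpot_def by (rule cINF_greatest) auto

lemma varpot_nonneg: "y \<in> next_states M \<Longrightarrow> 0 \<le> varpot y"
  by (rule varpot_ge) (rule Phi_nonneg)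

lemma varpot_None [simp]: "varpot None = 0"
  using varpot_nonneg[of None] varpot_le[of None 0 0] by (simp add: Phi_def Hp_def)

text \<open>Of the 18, two come from \<open>2 * Psi y 0\<close> and sixteen from
  \<open>8 * Rmax M * gappot y\<close>.\<close>

lemma varpot_bound: "y \<in> next_states M \<Longrightarrow> varpot y \<le> 18 * (Rmax M)\<^sup>2"
proof (cases y)
  case (Some s)
  assume "y \<in> next_states M"
  with Some have s: "s \<in> states M" by simp
  have "(R_from M s)\<^sup>2 \<le> (Rmax M)\<^sup>2"
    using R_from_le_Rmax[OF s] R_from_nonneg[OF stationary_HD[of mu_star, OF mu_star(1)] s] by (intro power_mono)
  then have "Psi y 0 \<le> (Rmax M)\<^sup>2" using Psi_init_le[OF s] Some by simp
  moreover have "8 * Rmax M * gappot y \<le> 16 * (Rmax M)\<^sup>2"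
    using mult_left_mono[OF gappot_le, of y "8 * Rmax M"] s Some Rmax_nonneg by (simp add: power2_eq_square)
  moreover have "Phi y 0 0 = 2 * Psi y 0 - (Vs y)\<^sup>2 + 8 * Rmax M * gappot y"
    by (simp add: Phi_def Hp_def)
  moreover have "varpot y \<le> Phi y 0 0" using varpot_le s Some by simp
  ultimately show ?thesis
    using zero_le_power2[of "Vs y"] by linarith
qed simp

lemma varpot_step:
  assumes "s \<in> states M" "a \<in> actions M"
  shows "Pv M s a varpot \<le> varpot (Some s) - Vr s a Vs"
proof -
  have "Pv M s a varpot + Vr s a Vs \<le> varpot (Some s)"
  proof (rule varpot_ge)
    fix c A :: real assume A: "0 \<le> A"
    have "Pv M s a varpot \<le> Pv M s a (\<lambda>y. Phi y (c + rew M s a) (A + adv s a))"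
      by (intro Pv_mono varpot_le) (use A adv_nonneg[OF assms] in auto)
    then show "Pv M s a varpot + Vr s a Vs \<le> Phi (Some s) c A"
      using Phi_step[OF assms A, of c] by linarith
  qed
  then show ?thesis by simp
qed

definition Hm :: "'s option \<Rightarrow> real \<Rightarrow> real \<Rightarrow> real" where
  "Hm y c A = min (Hp y c A) (varpot y)"

lemma Hm_nonneg: "y \<in> next_states M \<Longrightarrow> 0 \<le> Hm y c A"
  by (simp add: Hm_def Hp_nonneg varpot_nonneg)

lemma Hm_bound: "y \<in> next_states M \<Longrightarrow> Hm y c A \<le> 18 * (Rmax M)\<^sup>2"
  using varpot_bound by (simp add: Hm_def min.coboundedI2)

lemma Hm_None [simp]: "Hm None c A = 0"
  using Hp_nonneg[of None c A] by (simp add: Hm_def min_def)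

lemma Hm_init_le: "Hm (Some (s_init M)) 0 0 \<le> 2 * (R_bound M)\<^sup>2"
proof -
  have "Hm (Some (s_init M)) 0 0 \<le> Hp (Some (s_init M)) 0 0" by (simp add: Hm_def)
  also have "\<dots> = 2 * Psi (Some (s_init M)) 0 - (Vs (Some (s_init M)))\<^sup>2" by (simp add: Hp_def)
  also have "\<dots> \<le> 2 * (R_bound M)\<^sup>2"
    using Psi_init_le[OF init_in_states] zero_le_power2[of "Vs (Some (s_init M))"]
    unfolding R_bound_def by linarith
  finally show ?thesis .
qed

text \<open>The minimum inherits the step inequality, since \<open>varpot\<close> satisfies it even
  without the nonnegative error term.\<close>

lemma Hm_step:
  assumes "s \<in> states M" "a \<in> actions M" "0 \<le> A"
  shows "Pv M s a (\<lambda>y. Hm y (c + rew M s a) (A + adv s a))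
    \<le> Hm (Some s) c A + 4 * adv s a * (A + adv s a) - Vr s a Vs"
proof -
  have "Pv M s a (\<lambda>y. Hm y (c + rew M s a) (A + adv s a)) \<le> Pv M s a varpot"
    by (rule Pv_mono) (simp add: Hm_def)
  moreover have "Pv M s a (\<lambda>y. Hm y (c + rew M s a) (A + adv s a)) \<le> Pv M s a (\<lambda>y. Hp y (c + rew M s a) (A + adv s a))"
    by (rule Pv_mono) (simp add: Hm_def)
  moreover have "0 \<le> 4 * adv s a * (A + adv s a)"
    using assms adv_nonneg[OF assms(1,2)] by simp
  ultimately show ?thesis
    using Hp_step[OF assms(1,2), of c A] varpot_step[OF assms(1,2)] by (simp add: Hm_def min_def)
qed

end

section \<open>Concentration inequalities\<close>

lemma exp_le_1_plus_square: "\<bar>z\<bar> \<le> 1 \<Longrightarrow> exp (z::real) \<le> 1 + z + z\<^sup>2"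
proof (cases "0 \<le> z")
  case False
  assume "\<bar>z\<bar> \<le> 1"
  let ?x = "- z"
  have x: "0 \<le> ?x" using False by simp
  have "1 \<le> (1 - ?x + ?x\<^sup>2) * (1 + ?x)"
  proof -
    have "(1 - ?x + ?x\<^sup>2) * (1 + ?x) = 1 + ?x ^ 3" by (simp add: power2_eq_square power3_eq_cube algebra_simps)
    then show ?thesis using zero_le_power[OF x, of 3] by linarith
  qed
  also have "\<dots> \<le> (1 - ?x + ?x\<^sup>2) * exp ?x"
  proof (rule mult_left_mono)
    show "0 \<le> 1 - ?x + ?x\<^sup>2"
      using sum_squares_bound[of ?x "1/2"] by (simp add: power2_eq_square algebra_simps)
  qed (rule exp_ge_add_one_self_aux[OF x])
  finally show ?thesis by (simp add: exp_minus field_simps)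
qed (use exp_bound in auto)

text \<open>Here the square of the increment itself replaces its conditional variance, so that the
  resulting supermartingale involves an empirical second moment.\<close>

lemma exp_minus_two_squares_le: "\<bar>z\<bar> \<le> 1/2 \<Longrightarrow> exp (z - 2 * z\<^sup>2) \<le> 1 + (z::real)"
proof -
  assume z: "\<bar>z\<bar> \<le> 1/2"
  have "z - 2 * z\<^sup>2 \<le> ln (1 + z)"
  proof (cases "0 \<le> z")
    case True
    then have "z - z\<^sup>2 \<le> ln (1 + z)" using ln_one_plus_pos_lower_bound[of z] z by simp
    then show ?thesis using zero_le_power2[of z] by linarith
  next
    case False
    then show ?thesis using ln_one_minus_pos_lower_bound[of "- z"] z by simp
  qed
  then have "exp (z - 2 * z\<^sup>2) \<le> exp (ln (1 + z))" by simp
  also have "\<dots> = 1 + z" using z by simp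
  finally show ?thesis .
qed

lemma ln1_ge_1: "1 \<le> ln1 x" and ln_le_ln1: "ln x \<le> ln1 x"
  by (simp_all add: ln1_def)

lemma ln1_mono: "0 < x \<Longrightarrow> x \<le> y \<Longrightarrow> ln1 x \<le> ln1 y"
  unfolding ln1_def by (rule max.mono) auto

lemma lnln1_nonneg: "0 \<le> ln (ln1 x)"
  using ln1_ge_1[of x] by simp

lemma lnln1_mono: "0 < x \<Longrightarrow> x \<le> y \<Longrightarrow> ln (ln1 x) \<le> ln (ln1 y)"
  using ln1_mono[of x y] ln1_ge_1[of x] by simp

text \<open>A bound holding for all scales \<open>\<beta> = 2 ^ -j / b\<close> may be optimised over \<open>\<beta>\<close>; the scales that
  matter have \<open>j = O(ln N)\<close>, which costs only \<open>ln (ln N)\<close>.\<close>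

lemma dyadic_optimisation:
  fixes D Q N b d \<kappa> :: real
  assumes b: "0 < b" and Q: "0 \<le> Q" "Q \<le> b\<^sup>2 * N" and N: "1 \<le> N" and d: "0 < d" "d \<le> 1" and \<kappa>: "0 \<le> \<kappa>"
    and L: "L = ln (1 / d) + ln (ln1 N)" "1 \<le> L"
    and all: "\<And>j::nat. (D / (2 ^ j * b)) \<le> \<kappa> * Q / (2 ^ j * b)\<^sup>2 + ln (real (j + 1) * real (j + 2) / d)"
  shows "D \<le> (\<kappa> + 10) * (sqrt (Q * L) + b * L)"
proof -
  obtain j0 :: nat where "Q / (b\<^sup>2 * L) < 4 ^ j0"
    using real_arch_pow[of 4 "Q / (b\<^sup>2 * L)"] by auto
  moreover have "0 < b\<^sup>2 * L" using b L(2) by (intro mult_pos_pos) auto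
  ultimately have "Q < 4 ^ j0 * (b\<^sup>2 * L)" by (simp only: pos_divide_less_eq)
  then have ex: "\<exists>j. Q \<le> 4 ^ j * (b\<^sup>2 * L)" by (intro exI[of _ j0]) simp
  \<comment> \<open>The least such \<open>j\<close> balances both terms. With
    \<open>?\<beta>\<close> below, the reciprocal of the scale, \<open>Q / ?\<beta>\<close> is at
    most \<open>sqrt (Q * L)\<close>; unless \<open>j = 0\<close>, minimality bounds
    \<open>?\<beta> * L\<close> by twice this root.\<close>
  define j where "j = (LEAST j. Q \<le> 4 ^ j * (b\<^sup>2 * L))"
  have j: "Q \<le> 4 ^ j * (b\<^sup>2 * L)" unfolding j_def by (rule LeastI_ex[OF ex])
  have pow: "(4::real) ^ j = (2 ^ j)\<^sup>2" by (simp add: power_mult[symmetric] mult.commute[of j] power_mult)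
  have lnln: "0 \<le> ln (ln1 N)" by (rule lnln1_nonneg)
  have ld: "ln (1 / d) \<le> L" using L lnln by simp
  have sq: "sqrt (Q * L) * sqrt (Q * L) = Q * L" using Q L by simp
  let ?\<beta> = "2 ^ j * b"
  have \<beta>: "0 < ?\<beta>" using b by simp
  have "D \<le> \<kappa> * (Q / ?\<beta>) + ?\<beta> * ln (real (j + 1) * real (j + 2) / d)"
    using all[of j] \<beta> b by (simp add: field_simps power2_eq_square)
  moreover have Q\<beta>: "Q / ?\<beta> \<le> sqrt (Q * L)"
  proof -
    have "Q * Q \<le> Q * (4 ^ j * (b\<^sup>2 * L))" by (rule mult_left_mono[OF j Q(1)])
    also have "\<dots> = (sqrt (Q * L) * ?\<beta>)\<^sup>2"
      using Q L by (simp add: power_mult_distrib pow)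
    finally have "Q\<^sup>2 \<le> (sqrt (Q * L) * ?\<beta>)\<^sup>2" by (simp add: power2_eq_square)
    then have "Q \<le> sqrt (Q * L) * ?\<beta>"
      by (rule power2_le_imp_le) (use Q L \<beta> in auto)
    then show ?thesis using \<beta> by (simp add: field_simps)
  qed
  moreover have "?\<beta> * ln (real (j + 1) * real (j + 2) / d) \<le> 10 * (sqrt (Q * L) + b * L)"
  proof (cases "j = 0")
    case True
    have "ln (2 / d) = ln 2 + ln (1 / d)" using d by (simp add: ln_div)
    also have "\<dots> \<le> 2 * L" using ld L ln_2_less_1 by linarith
    also have "\<dots> \<le> 10 * L" using L by simp
    finally have "b * ln (2 / d) \<le> b * (10 * L)" using b by (intro mult_left_mono) auto
    moreover have "0 \<le> sqrt (Q * L)" using Q L by simp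
    moreover have "?\<beta> * ln (real (j + 1) * real (j + 2) / d) = b * ln (2 / d)" using True by simp
    ultimately show ?thesis by (simp only: distrib_left)
  next
    case False
    then obtain i where i: "j = Suc i" by (cases j) auto
    have "\<not> Q \<le> 4 ^ i * (b\<^sup>2 * L)" using not_less_Least[of i "\<lambda>j. Q \<le> 4 ^ j * (b\<^sup>2 * L)"] i j_def by simp
    then have lt: "4 ^ i * (b\<^sup>2 * L) < Q" by simp
    have "4 ^ i * b\<^sup>2 \<le> 4 ^ i * (b\<^sup>2 * L)" using L b by (simp add: mult_left_mono)
    then have "4 ^ i * b\<^sup>2 < b\<^sup>2 * N" using lt Q by linarith
    then have "4 ^ i < N" using b by (simp add: field_simps)
    then have "ln (4 ^ i) < ln N" using N by (subst ln_less_cancel_iff) auto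
    then have "real i * ln 4 < ln N" by (simp add: ln_realpow)
    moreover have "1 \<le> ln (4::real)"
      using ln_ge_iff[of 4 1] exp_le by simp
    ultimately have "real i \<le> ln N" using mult_left_mono[of 1 "ln 4" "real i"] by simp
    then have ile: "real i \<le> ln1 N" using ln_le_ln1[of N] by simp
    let ?x = "ln1 N"
    have x: "1 \<le> ?x" by (rule ln1_ge_1)
    \<comment> \<open>Since \<open>j = Suc i\<close>, the product is
      \<open>(i + 2) * (i + 3)\<close>, and \<open>i\<close> is at most
      \<open>ln1 N\<close>.\<close>
    have "real (j + 1) * real (j + 2) \<le> (?x + 2) * (?x + 3)"
      using ile i x by (intro mult_mono) auto
    also have "\<dots> \<le> (3 * ?x) * (4 * ?x)" using x by (intro mult_mono) auto
    finally have le: "real (j + 1) * real (j + 2) / d \<le> 12 * ?x\<^sup>2 / d"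
      using d by (simp add: divide_right_mono power2_eq_square)
    have "ln (real (j + 1) * real (j + 2) / d) \<le> ln (12 * ?x\<^sup>2 / d)"
    proof (subst ln_le_cancel_iff)
      show pos: "0 < real (j + 1) * real (j + 2) / d" using d by (intro divide_pos_pos mult_pos_pos) auto
      show "0 < 12 * ?x\<^sup>2 / d" using pos le by linarith
    qed (rule le)
    also have "\<dots> = ln 12 + 2 * ln ?x + ln (1 / d)"
      using d x by (simp add: ln_div ln_mult ln_realpow)
    finally have *: "ln (real (j + 1) * real (j + 2) / d) \<le> ln 12 + 2 * ln ?x + ln (1 / d)" .
    have "ln (12::real) \<le> 3"
    proof -
      have "ln (12::real) = ln (2 ^ 3) + ln (3 / 2)" using ln_mult[of "2 ^ 3" "3 / 2 :: real"] by simp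
      also have "\<dots> = 3 * ln 2 + ln (3 / 2)" using ln_realpow[of "2::real" 3] by simp
      finally show ?thesis using ln2_le_25_over_36 ln_le_minus_one[of "3/2"] by simp
    qed
    moreover have "0 \<le> ln (1 / d)" using d by simp
    moreover have "X \<le> 5 * (a + b)" if "X \<le> l + 2 * b + a" "l \<le> 3" "0 \<le> a" "1 \<le> a + b" "0 \<le> b" for X a b l :: real
      using that by (simp add: algebra_simps)
    ultimately have "ln (real (j + 1) * real (j + 2) / d) \<le> 5 * L" using * L(2) lnln unfolding L(1) by blast
    then have "?\<beta> * ln (real (j + 1) * real (j + 2) / d) \<le> ?\<beta> * (5 * L)" using \<beta> by (intro mult_left_mono) auto
    moreover have "?\<beta> * L \<le> 2 * sqrt (Q * L)"
    proof (rule power2_le_imp_le)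
      have "(?\<beta> * L)\<^sup>2 = 4 * (4 ^ i * (b\<^sup>2 * L)) * L"
      proof -
        have "(?\<beta> * L)\<^sup>2 = 4 ^ j * (b\<^sup>2 * L\<^sup>2)" by (simp only: pow power_mult_distrib mult.assoc)
        then show ?thesis by (simp add: i power2_eq_square algebra_simps)
      qed
      also have "\<dots> \<le> 4 * Q * L" using lt L by (intro mult_right_mono) auto
      also have "\<dots> = (2 * sqrt (Q * L))\<^sup>2" using Q L by (simp add: power_mult_distrib)
      finally show "(?\<beta> * L)\<^sup>2 \<le> (2 * sqrt (Q * L))\<^sup>2" .
    qed (use Q L in auto)
    moreover have "?\<beta> * (5 * L) = 5 * (?\<beta> * L)" by simp
    moreover have "0 \<le> b * L" using b L by simp
    ultimately show ?thesis unfolding distrib_left[of 10] by linarith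
  qed
  moreover have "\<kappa> * (Q / ?\<beta>) \<le> \<kappa> * sqrt (Q * L)" by (rule mult_left_mono[OF Q\<beta> \<kappa>])
  moreover have "0 \<le> \<kappa> * (b * L)" using \<kappa> b L(2) by simp
  moreover have "(\<kappa> + 10) * (sqrt (Q * L) + b * L) = \<kappa> * sqrt (Q * L) + \<kappa> * (b * L) + 10 * (sqrt (Q * L) + b * L)"
    by (simp only: distrib_left distrib_right add.assoc)
  ultimately show ?thesis by linarith
qed

text \<open>The summand sees the history before the transition as well as the transition itself, so
  predictable compensators and increments are summed by the same operator.\<close>

definition sumh :: "('o list \<Rightarrow> 'o \<Rightarrow> real) \<Rightarrow> 'o list \<Rightarrow> real" where
  "sumh F h = (\<Sum>i<length h. F (take i h) (h ! i))"

lemma sumh_Nil [simp]: "sumh F [] = 0"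
  by (simp add: sumh_def)

lemma sumh_snoc [simp]: "sumh F (h @ [x]) = sumh F h + F h x"
  by (simp add: sumh_def nth_append)

lemma sumh_prefix_of: "sumh F (prefix_of \<omega> n) = (\<Sum>i<n. F (prefix_of \<omega> i) (\<omega> i))"
proof (induction n)
  case (Suc n)
  have "prefix_of \<omega> (Suc n) = prefix_of \<omega> n @ [\<omega> n]" by simp
  then show ?case using Suc by simp
qed simp

lemma sumh_diff: "sumh (\<lambda>h x. F h x - F' h x) h = sumh F h - sumh F' h"
  and sumh_cmult: "sumh (\<lambda>h x. c * F h x) h = c * sumh F h"
  by (simp_all add: sumh_def sum.distrib sum_subtractf sum_distrib_left)

section \<open>Exponential supermartingales\<close>

context sp_agent
begin

abbreviation space_meas :: "(nat \<Rightarrow> ('s, 'a) transition) measure" where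
  "space_meas \<equiv> interaction M s0 f"

abbreviation prob_ever :: "(('s, 'a) transition list \<Rightarrow> bool) \<Rightarrow> real" where
  "prob_ever Q \<equiv> measure space_meas {\<omega>. \<exists>n. Q (prefix_of \<omega> n)}"

abbreviation cur_tr :: "('s, 'a) transition list \<Rightarrow> 's option \<Rightarrow> ('s, 'a) transition" where
  "cur_tr h y \<equiv> (cur h, act h, y)"

abbreviation Pcur :: "('s, 'a) transition list \<Rightarrow> ('s option \<Rightarrow> real) \<Rightarrow> real" where
  "Pcur h v \<equiv> Pv M (cur h) (act h) v"

text \<open>For each \<open>j\<close> the exponential of the sum is a supermartingale started at 1,
  to which \<open>maximal_inequality_family\<close> applies; all scales are thus controlled
  simultaneously at total cost \<open>d\<close>.\<close>

lemma maximal_inequality_exp: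
  assumes step: "\<And>j h. good_hist M h \<Longrightarrow> Pcur h (\<lambda>y. exp (F j h (cur_tr h y))) \<le> 1" and d: "0 < d"
  shows "prob_ever (\<lambda>h. \<exists>j. ln (real (j + 1) * real (j + 2) / d) \<le> sumh (F j) h) \<le> d"
proof -
  define W where "W j h = exp (sumh (F j) h)" for j h
  have "measure space_meas {\<omega>. \<exists>j n. real (j + 1) * real (j + 2) / d \<le> W j (prefix_of \<omega> n)} \<le> d"
    unfolding interaction_def
  proof (rule maximal_inequality_family)
    fix j h assume h: "good_hist M h"
    have "stepE (W j) h = W j h * Pcur h (\<lambda>y. exp (F j h (cur_tr h y)))"
      unfolding stepE_eq[OF h] W_def by (simp add: exp_add Pv_cmult)
    also have "\<dots> \<le> W j h * 1"
      by (rule mult_left_mono) (use step[OF h] in \<open>auto simp: W_def\<close>)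
    finally show "stepE (W j) h \<le> W j h" by simp
  qed (auto simp: W_def d)
  also have "{\<omega>. \<exists>j n. real (j + 1) * real (j + 2) / d \<le> W j (prefix_of \<omega> n)} =
      {\<omega>. \<exists>n. \<exists>j. ln (real (j + 1) * real (j + 2) / d) \<le> sumh (F j) (prefix_of \<omega> n)}"
  proof -
    have "c \<le> exp x \<longleftrightarrow> ln c \<le> x" if "0 < c" for c x :: real
      using ln_le_cancel_iff[OF that, of "exp x"] by simp
    then have iff: "real (j + 1) * real (j + 2) / d \<le> W j h \<longleftrightarrow> ln (real (j + 1) * real (j + 2) / d) \<le> sumh (F j) h" for j h
      unfolding W_def using d by simp
    show ?thesis unfolding iff by (subst ex_comm) (rule refl)
  qed
  finally show ?thesis .
qed

lemma Pcur_exp_predictable: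
  assumes h: "good_hist M h" and bd: "\<And>y. y \<in> next_states M \<Longrightarrow> \<bar>\<xi> y\<bar> \<le> b" and b: "0 < b"
    and mean: "Pcur h \<xi> = 0" and v: "Pcur h (\<lambda>y. (\<xi> y)\<^sup>2) \<le> v" and \<beta>: "0 \<le> \<beta>" "\<beta> * b \<le> 1"
  shows "Pcur h (\<lambda>y. exp (\<beta> * \<xi> y - \<beta>\<^sup>2 * v)) \<le> 1"
proof -
  note sa = cur_in_states[OF h] act_in_actions[OF h]
  have "Pcur h (\<lambda>y. exp (\<beta> * \<xi> y)) \<le> Pcur h (\<lambda>y. 1 + (\<beta> * \<xi> y + \<beta>\<^sup>2 * (\<xi> y)\<^sup>2))"
  proof (rule Pv_mono)
    fix y assume y: "y \<in> next_states M"
    have "\<bar>\<beta> * \<xi> y\<bar> \<le> \<beta> * b" using bd[OF y] \<beta> by (simp add: abs_mult mult_left_mono)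
    then show "exp (\<beta> * \<xi> y) \<le> 1 + (\<beta> * \<xi> y + \<beta>\<^sup>2 * (\<xi> y)\<^sup>2)"
      using exp_le_1_plus_square[of "\<beta> * \<xi> y"] \<beta> by (simp add: power_mult_distrib)
  qed
  also have "\<dots> = 1 + \<beta>\<^sup>2 * Pcur h (\<lambda>y. (\<xi> y)\<^sup>2)"
    by (subst Pv_add_const[OF sa]) (simp add: Pv_add Pv_cmult mean)
  also have "\<dots> \<le> 1 + \<beta>\<^sup>2 * v" using v by (simp add: mult_left_mono)
  also have "\<dots> \<le> exp (\<beta>\<^sup>2 * v)" by (rule exp_ge_add_one_self)
  finally have "Pcur h (\<lambda>y. exp (\<beta> * \<xi> y)) \<le> exp (\<beta>\<^sup>2 * v)" .
  moreover have "Pcur h (\<lambda>y. exp (\<beta> * \<xi> y - \<beta>\<^sup>2 * v)) = Pcur h (\<lambda>y. exp (- (\<beta>\<^sup>2 * v)) * exp (\<beta> * \<xi> y))"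
    by (intro Pv_cong) (simp add: exp_diff exp_minus field_simps)
  moreover have "exp (- (\<beta>\<^sup>2 * v)) * exp (\<beta>\<^sup>2 * v) = 1" by (simp flip: exp_add)
  ultimately show ?thesis
    unfolding Pv_cmult using mult_left_mono[of "Pcur h (\<lambda>y. exp (\<beta> * \<xi> y))" "exp (\<beta>\<^sup>2 * v)" "exp (- (\<beta>\<^sup>2 * v))"]
    by simp
qed

lemma Pcur_exp_empirical:
  assumes h: "good_hist M h" and bd: "\<And>y. y \<in> next_states M \<Longrightarrow> \<bar>\<xi> y\<bar> \<le> b" and b: "0 < b"
    and mean: "Pcur h \<xi> = 0" and \<beta>: "0 \<le> \<beta>" "\<beta> * b \<le> 1/2"
  shows "Pcur h (\<lambda>y. exp (\<beta> * \<xi> y - 2 * \<beta>\<^sup>2 * (\<xi> y)\<^sup>2)) \<le> 1"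
proof -
  note sa = cur_in_states[OF h] act_in_actions[OF h]
  have "Pcur h (\<lambda>y. exp (\<beta> * \<xi> y - 2 * \<beta>\<^sup>2 * (\<xi> y)\<^sup>2)) \<le> Pcur h (\<lambda>y. 1 + \<beta> * \<xi> y)"
  proof (rule Pv_mono)
    fix y assume y: "y \<in> next_states M"
    have "\<bar>\<beta> * \<xi> y\<bar> \<le> \<beta> * b" using bd[OF y] \<beta> by (simp add: abs_mult mult_left_mono)
    then show "exp (\<beta> * \<xi> y - 2 * \<beta>\<^sup>2 * (\<xi> y)\<^sup>2) \<le> 1 + \<beta> * \<xi> y"
      using exp_minus_two_squares_le[of "\<beta> * \<xi> y"] \<beta> by (simp add: power_mult_distrib mult.assoc)
  qed
  also have "\<dots> = 1" by (subst Pv_add_const[OF sa]) (simp add: Pv_cmult mean)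
  finally show ?thesis .
qed

text \<open>The bad event is a parameter and \<open>N\<close> is chosen history by history, so that
  either the number of visits to a pair or the elapsed time can serve as the clock. The 11 is
  \<open>\<kappa> + 10\<close> of \<open>dyadic_optimisation\<close> with
  \<open>\<kappa> = 1\<close>.\<close>

lemma freedman:
  assumes bd: "\<And>h y. good_hist M h \<Longrightarrow> y \<in> next_states M \<Longrightarrow> \<bar>\<xi> h (cur_tr h y)\<bar> \<le> b" and b: "0 < b"
    and mean: "\<And>h. good_hist M h \<Longrightarrow> Pcur h (\<lambda>y. \<xi> h (cur_tr h y)) = 0"
    and var: "\<And>h y. good_hist M h \<Longrightarrow> Pcur h (\<lambda>y. (\<xi> h (cur_tr h y))\<^sup>2) \<le> v h (cur_tr h y)"
    and d: "0 < d" "d \<le> 1"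
    and conc: "\<And>h. good_hist M h \<Longrightarrow> bad h \<Longrightarrow> \<exists>N. 1 \<le> N \<and> 0 \<le> sumh v h \<and> sumh v h \<le> b\<^sup>2 * N \<and>
       1 \<le> ln (1 / d) + ln (ln1 N) \<and>
       11 * (sqrt (sumh v h * (ln (1 / d) + ln (ln1 N))) + b * (ln (1 / d) + ln (ln1 N))) < sumh \<xi> h"
  shows "prob_ever (\<lambda>h. good_hist M h \<and> bad h) \<le> d"
proof -
  interpret prob_space space_meas unfolding interaction_def by (rule prob_space_seq_measure)
  define \<beta> where "\<beta> j = 1 / (2 ^ j * b)" for j :: nat
  define F where "F = (\<lambda>j h x. \<beta> j * \<xi> h x - (\<beta> j)\<^sup>2 * v h x)"
  have \<beta>b: "0 \<le> \<beta> j" "\<beta> j * b \<le> 1" for j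
    using b by (auto simp: \<beta>_def)
  have "{\<omega>. \<exists>n. good_hist M (prefix_of \<omega> n) \<and> bad (prefix_of \<omega> n)} \<subseteq>
     {\<omega>. \<exists>n. \<exists>j. ln (real (j + 1) * real (j + 2) / d) \<le> sumh (F j) (prefix_of \<omega> n)}"
  proof safe
    fix \<omega> :: "nat \<Rightarrow> ('s, 'a) transition" and n
    let ?h = "prefix_of \<omega> n"
    assume h: "good_hist M ?h" and bad: "bad ?h"
    obtain N where N: "1 \<le> N" "0 \<le> sumh v ?h" "sumh v ?h \<le> b\<^sup>2 * N" "1 \<le> ln (1 / d) + ln (ln1 N)"
      and gt: "11 * (sqrt (sumh v ?h * (ln (1 / d) + ln (ln1 N))) + b * (ln (1 / d) + ln (ln1 N))) < sumh \<xi> ?h"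
      using conc[OF h bad] by blast
    show "\<exists>n j. ln (real (j + 1) * real (j + 2) / d) \<le> sumh (F j) (prefix_of \<omega> n)"
    proof (rule ccontr)
      assume "\<not> ?thesis"
      then have "sumh (F j) ?h \<le> ln (real (j + 1) * real (j + 2) / d)" for j
        by (simp add: not_le less_imp_le)
      then have "sumh \<xi> ?h / (2 ^ j * b) \<le> 1 * sumh v ?h / (2 ^ j * b)\<^sup>2 + ln (real (j + 1) * real (j + 2) / d)" for j
        unfolding F_def sumh_diff sumh_cmult \<beta>_def by (simp add: power_divide diff_le_eq add.commute)
      from dyadic_optimisation[OF b N(2,3,1) d _ refl N(4) this]
      show False using gt by simp
    qed
  qed
  then have "prob {\<omega>. \<exists>n. good_hist M (prefix_of \<omega> n) \<and> bad (prefix_of \<omega> n)} \<le>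
     prob {\<omega>. \<exists>n. \<exists>j. ln (real (j + 1) * real (j + 2) / d) \<le> sumh (F j) (prefix_of \<omega> n)}"
    by (rule finite_measure_mono) (unfold interaction_def, rule sets_ex_prefix)
  also have "\<dots> \<le> d"
  proof (rule maximal_inequality_exp[OF _ d(1)])
    fix j h assume h: "good_hist M h"
    have "Pcur h (\<lambda>y. exp (F j h (cur_tr h y))) \<le>
        Pcur h (\<lambda>y. exp (\<beta> j * \<xi> h (cur_tr h y) - (\<beta> j)\<^sup>2 * Pcur h (\<lambda>y. (\<xi> h (cur_tr h y))\<^sup>2)))"
    proof (rule Pv_mono)
      fix y
      have "(\<beta> j)\<^sup>2 * Pcur h (\<lambda>y. (\<xi> h (cur_tr h y))\<^sup>2) \<le> (\<beta> j)\<^sup>2 * v h (cur_tr h y)"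
        by (rule mult_left_mono[OF var[OF h]]) simp
      then show "exp (F j h (cur_tr h y)) \<le>
          exp (\<beta> j * \<xi> h (cur_tr h y) - (\<beta> j)\<^sup>2 * Pcur h (\<lambda>y. (\<xi> h (cur_tr h y))\<^sup>2))"
        unfolding F_def exp_le_cancel_iff by linarith
    qed
    also have "\<dots> \<le> 1"
      by (rule Pcur_exp_predictable[OF h bd[OF h] b mean[OF h] order_refl \<beta>b])
    finally show "Pcur h (\<lambda>y. exp (F j h (cur_tr h y))) \<le> 1" .
  qed
  finally show ?thesis .
qed

end


section \<open>The algorithm\<close>

text \<open>Raising \<open>v\<close> to \<open>w\<close> raises the mean but may lower the
  deviation. If the maximum for \<open>v\<close> is its second entry, nothing can be lost. Otherwise
  the deviation of \<open>v\<close> is at least \<open>2 * c1 * B * sqrt e\<close>, by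
  \<open>2 * c1\<^sup>2 \<le> c2\<close>. As the variance of \<open>v\<close> exceeds its covariance
  with \<open>w\<close> by at most \<open>2 * B\<close> times the rise of the mean, dividing by the
  deviation shows that the rise outweighs the loss.\<close>

lemma bonus_mono:
  fixes v w p :: "'x \<Rightarrow> real"
  assumes X: "finite X" and p: "\<And>x. x \<in> X \<Longrightarrow> 0 \<le> p x" "(\<Sum>x\<in>X. p x) = 1"
    and vw: "\<And>x. x \<in> X \<Longrightarrow> v x \<le> w x" and vB: "\<And>x. x \<in> X \<Longrightarrow> \<bar>v x\<bar> \<le> B"
    and B: "0 < B" and c: "0 \<le> c1" "2 * c1\<^sup>2 \<le> c2" and e: "0 \<le> e"
  shows "expect X p v + max (c1 * sqrt (varia X p v * e)) (c2 * B * e)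
    \<le> expect X p w + max (c1 * sqrt (varia X p w * e)) (c2 * B * e)"
proof -
  define Ev where "Ev = expect X p v"
  define Ew where "Ew = expect X p w"
  have centred: "varia X p u = (\<Sum>x\<in>X. p x * (u x - expect X p u)\<^sup>2)" for u :: "'x \<Rightarrow> real"
  proof -
    let ?m = "expect X p u"
    have "(\<Sum>x\<in>X. p x * (u x - ?m)\<^sup>2) = (\<Sum>x\<in>X. p x * (u x)\<^sup>2 - 2 * ?m * (p x * u x) + ?m\<^sup>2 * p x)"
      by (intro sum.cong refl) (simp add: power2_eq_square algebra_simps)
    also have "\<dots> = (\<Sum>x\<in>X. p x * (u x)\<^sup>2) - 2 * ?m * (\<Sum>x\<in>X. p x * u x) + ?m\<^sup>2 * (\<Sum>x\<in>X. p x)"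
      by (simp add: sum.distrib sum_subtractf sum_distrib_left)
    finally show ?thesis using p(2) by (simp add: varia_def expect_def power2_eq_square)
  qed
  have var_nonneg: "0 \<le> varia X p u" for u
    unfolding centred by (intro sum_nonneg mult_nonneg_nonneg p) auto
  have diff: "Ew - Ev = (\<Sum>x\<in>X. p x * (w x - v x))"
    by (simp add: Ew_def Ev_def expect_def sum_subtractf algebra_simps)
  have Ele: "0 \<le> Ew - Ev" unfolding diff using p vw by (intro sum_nonneg mult_nonneg_nonneg) auto
  let ?sv = "sqrt (varia X p v)" and ?sw = "sqrt (varia X p w)" and ?e = "sqrt e"
  show ?thesis
  proof (cases "c1 * sqrt (varia X p v * e) \<le> c2 * B * e")
    case True
    then show ?thesis using Ele unfolding Ew_def Ev_def by linarith
  next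
    case False
    then have gt: "c2 * B * e < c1 * ?sv * ?e" by (simp add: real_sqrt_mult)
    have c2: "0 \<le> c2" using c(2) zero_le_power2[of c1] by linarith
    then have "0 \<le> c2 * B * e" using B e by simp
    then have pos: "0 < c1 * ?sv * ?e" using gt by linarith
    then have "c1 \<noteq> 0" "?sv \<noteq> 0" "?e \<noteq> 0" by auto
    moreover have "0 \<le> ?sv" "0 \<le> ?e" using var_nonneg e by simp_all
    ultimately have c1: "0 < c1" and sv: "0 < ?sv" and epos: "0 < ?e"
      using c(1) by linarith+
    have gt': "c2 * B * ?e < c1 * ?sv"
    proof -
      have "(c2 * B * ?e) * ?e < (c1 * ?sv) * ?e" using gt e by (simp add: mult.assoc)
      then show ?thesis using epos by simp
    qed
    have cov: "(\<Sum>x\<in>X. p x * (v x - Ev) * (w x - Ew)) \<le> ?sv * ?sw"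
    proof -
      have "(\<Sum>x\<in>X. (sqrt (p x) * (v x - Ev)) * (sqrt (p x) * (w x - Ew)))\<^sup>2 \<le>
          (\<Sum>x\<in>X. (sqrt (p x) * (v x - Ev))\<^sup>2) * (\<Sum>x\<in>X. (sqrt (p x) * (w x - Ew))\<^sup>2)"
        by (rule Cauchy_Schwarz_ineq_sum)
      also have "(\<Sum>x\<in>X. (sqrt (p x) * (v x - Ev))\<^sup>2) = varia X p v"
        unfolding centred Ev_def by (intro sum.cong refl) (simp add: power_mult_distrib p)
      also have "(\<Sum>x\<in>X. (sqrt (p x) * (w x - Ew))\<^sup>2) = varia X p w"
        unfolding centred Ew_def by (intro sum.cong refl) (simp add: power_mult_distrib p)
      also have "(\<Sum>x\<in>X. (sqrt (p x) * (v x - Ev)) * (sqrt (p x) * (w x - Ew))) = (\<Sum>x\<in>X. p x * (v x - Ev) * (w x - Ew))"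
      proof (intro sum.cong refl)
        fix x assume "x \<in> X"
        then have "sqrt (p x) * sqrt (p x) = p x" using p by simp
        moreover have "sqrt (p x) * (v x - Ev) * (sqrt (p x) * (w x - Ew)) =
            (sqrt (p x) * sqrt (p x)) * (v x - Ev) * (w x - Ew)" by (simp only: mult_ac)
        ultimately show "sqrt (p x) * (v x - Ev) * (sqrt (p x) * (w x - Ew)) = p x * (v x - Ev) * (w x - Ew)"
          by simp
      qed
      finally have "(\<Sum>x\<in>X. p x * (v x - Ev) * (w x - Ew))\<^sup>2 \<le> (?sv * ?sw)\<^sup>2"
        using var_nonneg by (simp add: power_mult_distrib)
      then show ?thesis by (rule power2_le_imp_le) (use var_nonneg in simp)
    qed
    have EvB: "\<bar>Ev\<bar> \<le> B"
    proof -
      have "\<bar>Ev\<bar> \<le> (\<Sum>x\<in>X. \<bar>p x * v x\<bar>)" unfolding Ev_def expect_def by (rule sum_abs)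
      also have "\<dots> \<le> (\<Sum>x\<in>X. p x * B)"
        using p vB by (intro sum_mono) (simp add: abs_mult mult_left_mono)
      finally show ?thesis using p(2) by (simp flip: sum_distrib_right)
    qed
    have "?sv * ?sv = (\<Sum>x\<in>X. p x * (v x - Ev)\<^sup>2)"
      using var_nonneg by (simp add: centred Ev_def)
    \<comment> \<open>The variance is expanded into the covariance with \<open>w\<close> and a
      remainder; the constant \<open>Ev - Ew\<close> drops out because \<open>v - Ev\<close> has
      mean zero.\<close>
    also have "\<dots> = (\<Sum>x\<in>X. p x * (v x - Ev) * (w x - Ew)) + (\<Sum>x\<in>X. p x * (Ev - v x) * (w x - v x))"
    proof -
      have "(\<Sum>x\<in>X. p x * (v x - Ev)) = 0"
        using p(2) by (simp add: Ev_def expect_def right_diff_distrib sum_subtractf flip: sum_distrib_right)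
      then have z: "(\<Sum>x\<in>X. (p x * (v x - Ev)) * (Ev - Ew)) = 0" by (simp flip: sum_distrib_right)
      have "(\<Sum>x\<in>X. p x * (v x - Ev)\<^sup>2) = (\<Sum>x\<in>X. p x * (v x - Ev) * (w x - Ew) + p x * (Ev - v x) * (w x - v x) - (p x * (v x - Ev)) * (Ev - Ew))"
        by (intro sum.cong refl) (simp add: power2_eq_square algebra_simps)
      then show ?thesis using z by (simp add: sum.distrib sum_subtractf)
    qed
    also have "\<dots> \<le> ?sv * ?sw + 2 * B * (Ew - Ev)"
    proof (rule add_mono[OF cov])
      have "(\<Sum>x\<in>X. p x * (Ev - v x) * (w x - v x)) \<le> (\<Sum>x\<in>X. 2 * B * (p x * (w x - v x)))"
      proof (rule sum_mono)
        fix x assume x: "x \<in> X"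
        have "(Ev - v x) * (p x * (w x - v x)) \<le> 2 * B * (p x * (w x - v x))"
          using EvB vB[OF x] p(1)[OF x] vw[OF x] by (intro mult_right_mono mult_nonneg_nonneg) auto
        then show "p x * (Ev - v x) * (w x - v x) \<le> 2 * B * (p x * (w x - v x))" by (simp add: algebra_simps)
      qed
      then show "(\<Sum>x\<in>X. p x * (Ev - v x) * (w x - v x)) \<le> 2 * B * (Ew - Ev)"
        by (simp add: diff sum_distrib_left)
    qed
    finally have "?sv * (?sv - ?sw) \<le> 2 * B * (Ew - Ev)" by (simp add: algebra_simps)
    then have "(c1 * ?e) * (?sv * (?sv - ?sw)) \<le> (c1 * ?e) * (2 * B * (Ew - Ev))"
      using c1 epos by (intro mult_left_mono) auto
    also have "\<dots> \<le> ?sv * (Ew - Ev)"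
    proof -
      have "c1 * (2 * c1 * B * ?e) \<le> c2 * B * ?e"
        using mult_right_mono[OF c(2), of "B * ?e"] B epos by (simp add: power2_eq_square algebra_simps)
      also have "\<dots> \<le> c1 * ?sv" using gt' by simp
      finally have "2 * c1 * B * ?e \<le> ?sv" using c1 by simp
      then have "(2 * c1 * B * ?e) * (Ew - Ev) \<le> ?sv * (Ew - Ev)" using Ele by (rule mult_right_mono)
      then show ?thesis by (simp add: algebra_simps)
    qed
    finally have "?sv * (c1 * ?e * (?sv - ?sw)) \<le> ?sv * (Ew - Ev)" by (simp add: algebra_simps)
    then have "c1 * ?e * (?sv - ?sw) \<le> Ew - Ev" using sv by simp
    then have "Ev + c1 * sqrt (varia X p v * e) \<le> Ew + c1 * sqrt (varia X p w * e)"
      by (simp add: real_sqrt_mult algebra_simps)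
    then show ?thesis using False unfolding Ev_def Ew_def by linarith
  qed
qed

text \<open>The bound on \<open>\<delta>\<close> makes \<open>ln (1 / \<delta>)\<close> at least 4;
  larger \<open>\<delta>\<close> are covered by the constant in front of \<open>\<delta>\<close> in
  the final probability. The 400 leaves room for the constants in
  \<open>optimism_event\<close>.\<close>

locale vi_run = proper_sp M for M :: "('s::countable, 'a::countable) sp" +
  fixes c1 c2 B \<delta> :: real and f :: "('s, 'a) agent"
  assumes agent: "vi_sp_agent M c1 c2 B \<delta> f"
    and B1: "1 \<le> B" and Bstar_le: "Bstar M \<le> B" and \<delta>: "0 < \<delta>" "\<delta> \<le> 1 / 100"
    and c1: "400 \<le> c1" and c2: "400 \<le> c2" and c12: "2 * c1\<^sup>2 \<le> c2"
begin

lemma agent_max: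
  assumes "s \<in> states M"
  shows "f h s \<in> actions M" and "a \<in> actions M \<Longrightarrow> Qv (vi_after M c1 c2 B \<delta> h) s a \<le> Qv (vi_after M c1 c2 B \<delta> h) s (f h s)"
  using agent assms unfolding vi_sp_agent_def is_arg_max_def by (auto simp: not_less)

sublocale sp_agent M "s_init M" f
  by unfold_locales (auto intro: agent_max)

lemma Vs_abs_le_B: "y \<in> next_states M \<Longrightarrow> \<bar>Vs y\<bar> \<le> B"
proof (cases y)
  case (Some s)
  assume "y \<in> next_states M"
  then have "\<bar>Vstar M s\<bar> \<le> Bstar M" using Some by (simp add: Bstar_def)
  then show ?thesis using Some Bstar_le by (simp add: Vs_def)
qed (use B1 in simp)

definition N :: "('s, 'a) transition list \<Rightarrow> 's \<Rightarrow> 'a \<Rightarrow> nat" where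
  "N h = cnt2 (vi_after M c1 c2 B \<delta> h)"

definition N3 :: "('s, 'a) transition list \<Rightarrow> 's \<Rightarrow> 'a \<Rightarrow> 's option \<Rightarrow> nat" where
  "N3 h = cnt3 (vi_after M c1 c2 B \<delta> h)"

definition QQ :: "('s, 'a) transition list \<Rightarrow> 's \<Rightarrow> 'a \<Rightarrow> real" where
  "QQ h = Qv (vi_after M c1 c2 B \<delta> h)"

definition VV :: "('s, 'a) transition list \<Rightarrow> 's option \<Rightarrow> real" where
  "VV h = Vv (vi_after M c1 c2 B \<delta> h)"

definition io :: "nat \<Rightarrow> real" where "io n = iota M B \<delta> n"

definition Pb :: "('s, 'a) transition list \<Rightarrow> 's \<Rightarrow> 'a \<Rightarrow> 's option \<Rightarrow> real" where
  "Pb h s a y = real (N3 h s a y) / real (N h s a)"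

definition Eb :: "('s, 'a) transition list \<Rightarrow> 's \<Rightarrow> 'a \<Rightarrow> ('s option \<Rightarrow> real) \<Rightarrow> real" where
  "Eb h s a v = expect (next_states M) (Pb h s a) v"

definition Vb :: "('s, 'a) transition list \<Rightarrow> 's \<Rightarrow> 'a \<Rightarrow> ('s option \<Rightarrow> real) \<Rightarrow> real" where
  "Vb h s a v = varia (next_states M) (Pb h s a) v"

definition bonus :: "('s, 'a) transition list \<Rightarrow> 's \<Rightarrow> 'a \<Rightarrow> ('s option \<Rightarrow> real) \<Rightarrow> real" where
  "bonus h s a v = max (c1 * sqrt (Vb h s a v * (io (N h s a) / real (N h s a))))
     (c2 * B * (io (N h s a) / real (N h s a)))"

lemma vi_after_snoc: "vi_after M c1 c2 B \<delta> (h @ [x]) = vi_update M c1 c2 B \<delta> x (vi_after M c1 c2 B \<delta> h)"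
  by (simp add: vi_after_def)

lemma N_Nil [simp]: "N [] s a = 0" and N3_Nil [simp]: "N3 [] s a y = 0" and QQ_Nil [simp]: "QQ [] s a = B"
  and VV_Nil [simp]: "VV [] y = (if y = None then 0 else B)"
  by (auto simp: N_def N3_def QQ_def VV_def vi_after_def vi_init_def split: option.splits)

lemma N_snoc: "N (h @ [x]) s a = N h s a + (if s = st x \<and> a = ac x then 1 else 0)"
  and N3_snoc: "N3 (h @ [x]) s a y = N3 h s a y + (if s = st x \<and> a = ac x \<and> y = nxt x then 1 else 0)"
  by (auto simp: N_def N3_def vi_after_snoc vi_update_def Let_def)

text \<open>The timing matters: counts and empirical law are taken after the transition, the value
  function before it.\<close>

lemma QQ_snoc: "QQ (h @ [x]) s a = (if s = st x \<and> a = ac x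
    then min (rew M s a + Eb (h @ [x]) s a (VV h) + bonus (h @ [x]) s a (VV h)) (QQ h s a) else QQ h s a)"
proof (cases "s = st x \<and> a = ac x")
  case True
  have Pb: "Pb (h @ [x]) s a = (\<lambda>y. real (N3 (h @ [x]) s a y) / real (N (h @ [x]) s a))"
    by (rule ext) (simp add: Pb_def)
  show ?thesis using True
    unfolding bonus_def Eb_def Vb_def Pb
    by (simp add: QQ_def VV_def N_def N3_def io_def vi_after_snoc vi_update_def Let_def next_states_def)
next
  case False
  then show ?thesis by (auto simp: QQ_def vi_after_snoc vi_update_def Let_def)
qed

lemma VV_snoc: "VV (h @ [x]) y = (if y = Some (st x) then Max (QQ (h @ [x]) (st x) ` actions M) else VV h y)"
  by (simp add: VV_def QQ_def vi_after_snoc vi_update_def Let_def)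

lemma VV_None [simp]: "VV h None = 0"
  by (induction h rule: rev_induct) (auto simp: VV_snoc)

lemma VV_Some: "VV h (Some s) = Max (QQ h s ` actions M)"
proof (induction h arbitrary: s rule: rev_induct)
  case Nil
  have "QQ [] s ` actions M = {B}" using actions_ne by (simp add: image_constant_conv)
  then show ?case by simp
next
  case (snoc x h)
  have "QQ (h @ [x]) s ` actions M = QQ h s ` actions M" if "s \<noteq> st x"
    using that by (intro image_cong) (auto simp: QQ_snoc)
  then show ?case using snoc by (auto simp: VV_snoc)
qed

lemma QQ_snoc_le: "QQ (h @ [x]) s a \<le> QQ h s a"
  by (simp add: QQ_snoc)

lemma QQ_le_VV: "a \<in> actions M \<Longrightarrow> QQ h s a \<le> VV h (Some s)"
  by (simp add: VV_Some)

lemma VV_snoc_le: "VV (h @ [x]) y \<le> VV h y"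
proof (cases y)
  case (Some s)
  have "Max (QQ (h @ [x]) s ` actions M) \<le> Max (QQ h s ` actions M)"
    by (subst Max_le_iff) (auto intro!: order_trans[OF QQ_snoc_le] Max_ge)
  then show ?thesis by (simp add: Some VV_Some)
qed simp

lemma VV_le_B: "VV h y \<le> B"
proof (induction h rule: rev_induct)
  case (snoc x h) then show ?case using VV_snoc_le[of h x y] by linarith
qed (use B1 in auto)

lemma QQ_le_B: "QQ h s a \<le> B"
proof (induction h rule: rev_induct)
  case (snoc x h) then show ?case using QQ_snoc_le[of h x s a] by linarith
qed simp

lemma VV_cur: "good_hist M h \<Longrightarrow> VV h (Some (cur h)) = QQ h (cur h) (act h)"
  using agent_max(1)[OF cur_in_states] agent_max(2)[OF cur_in_states] unfolding VV_Some QQ_def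
  by (intro Max_eqI) auto

text \<open>Turns averages over counts into sums over the visits to \<open>(s, a)\<close> along the
  history, the form in which the martingale inequalities apply.\<close>

lemma sum_N3: "good_hist M h \<Longrightarrow> (\<Sum>y\<in>next_states M. real (N3 h s a y) * g y) =
    sumh (\<lambda>h x. if st x = s \<and> ac x = a then g (nxt x) else 0) h"
proof (induction h rule: rev_induct)
  case (snoc x h)
  have "(\<Sum>y\<in>next_states M. real (N3 (h @ [x]) s a y) * g y) =
     (\<Sum>y\<in>next_states M. real (N3 h s a y) * g y + (if y = nxt x then (if st x = s \<and> ac x = a then g (nxt x) else 0) else 0))"
    by (intro sum.cong refl) (auto simp: N3_snoc algebra_simps)
  also have "\<dots> = (\<Sum>y\<in>next_states M. real (N3 h s a y) * g y) + (if st x = s \<and> ac x = a then g (nxt x) else 0)"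
    using snoc.prems by (simp add: sum.distrib good_tr_def)
  finally show ?case using snoc by simp
qed simp

lemma N_eq_sumh: "real (N h s a) = sumh (\<lambda>h x. if st x = s \<and> ac x = a then 1 else 0) h"
  by (induction h rule: rev_induct) (auto simp: N_snoc)

lemma Eb_eq:
  assumes "good_hist M h" "0 < N h s a"
  shows "real (N h s a) * Eb h s a g = sumh (\<lambda>h x. if st x = s \<and> ac x = a then g (nxt x) else 0) h"
  using assms by (simp add: sum_N3[symmetric] Eb_def expect_def Pb_def sum_distrib_left)

lemma sum_Pb: "good_hist M h \<Longrightarrow> 0 < N h s a \<Longrightarrow> (\<Sum>y\<in>next_states M. Pb h s a y) = 1"
  using Eb_eq[of h s a "\<lambda>_. 1"] by (simp add: Eb_def expect_def flip: N_eq_sumh)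

lemma Pb_nonneg: "0 \<le> Pb h s a y"
  by (simp add: Pb_def)

lemma io_eq: "io n = ln (real (card (states M)) * real (card (actions M)) / \<delta>) + ln (ln1 (B * real n))"
  by (simp add: io_def iota_def)

lemma card_pos: "1 \<le> real (card (states M))" "1 \<le> real (card (actions M))"
proof -
  have "states M \<noteq> {}" using init_in_states by blast
  then show "1 \<le> real (card (states M))" "1 \<le> real (card (actions M))"
    by (simp_all add: Suc_le_eq card_gt_0_iff)
qed

lemma io_ge: "4 \<le> io n"
proof -
  have "exp (4::real) \<le> 100"
  proof -
    have "exp (4::real) = exp 1 ^ 4" by (simp flip: exp_of_nat_mult)
    also have "\<dots> \<le> (3::real) ^ 4" using exp_le by (intro power_mono) auto
    finally show ?thesis by simp
  qed
  also have "100 \<le> 1 * 1 / \<delta>" using \<delta> by (simp add: field_simps)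
  also have "\<dots> \<le> real (card (states M)) * real (card (actions M)) / \<delta>"
    using card_pos \<delta> by (intro divide_right_mono mult_mono) auto
  finally have "4 \<le> ln (real (card (states M)) * real (card (actions M)) / \<delta>)"
    using card_pos \<delta> by (subst ln_ge_iff) (auto intro!: divide_pos_pos mult_pos_pos)
  then show ?thesis using lnln1_nonneg[of "B * real n"] by (simp add: io_eq)
qed

lemma io_mono: "1 \<le> m \<Longrightarrow> m \<le> n \<Longrightarrow> io m \<le> io n"
  unfolding io_eq using B1 by (intro add_left_mono lnln1_mono) auto

text \<open>Only the fixed function \<open>Vs\<close> occurs, so this can be obtained from a
  martingale inequality; \<open>optimism\<close> transfers it to the data-dependent
  estimates.\<close>

definition optimistic_at :: "('s, 'a) transition list \<Rightarrow> bool" where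
  "optimistic_at h \<longleftrightarrow> (\<forall>s\<in>states M. \<forall>a\<in>actions M. 0 < N h s a \<longrightarrow>
     Pv M s a Vs \<le> Eb h s a Vs + bonus h s a Vs)"

text \<open>Induction on the history. An updated entry is the minimum of the old entry and a backup
  of an estimate above \<open>Vs\<close>; by \<open>bonus_mono\<close> this backup dominates the
  backup of \<open>Vs\<close> itself, to which \<open>optimistic_at\<close> applies.\<close>

lemma optimism:
  assumes "\<And>n. n \<le> length h \<Longrightarrow> optimistic_at (take n h)" "good_hist M h"
  shows "(\<forall>s\<in>states M. \<forall>a\<in>actions M. rew M s a + Pv M s a Vs \<le> QQ h s a) \<and> (\<forall>y\<in>next_states M. Vs y \<le> VV h y)"
  using assms
proof (induction h rule: rev_induct)
  case Nil
  have le: "Vs y \<le> B" if "y \<in> next_states M" for y using Vs_abs_le_B[OF that] by linarith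
  have "rew M s a + Pv M s a Vs \<le> B" if "s \<in> states M" "a \<in> actions M" for s a
    using Vs_ge[OF that] le[of "Some s"] that(1) by simp
  then show ?case using le by simp
next
  case (snoc x h)
  have opt: "optimistic_at (h @ [x])" using snoc.prems(1)[of "Suc (length h)"] by simp
  have "optimistic_at (take n h)" if "n \<le> length h" for n
    using snoc.prems(1)[of n] that by simp
  then have IH: "\<And>s a. s \<in> states M \<Longrightarrow> a \<in> actions M \<Longrightarrow> rew M s a + Pv M s a Vs \<le> QQ h s a"
      "\<And>y. y \<in> next_states M \<Longrightarrow> Vs y \<le> VV h y"
    using snoc.IH snoc.prems(2) by auto
  have Q: "rew M s a + Pv M s a Vs \<le> QQ (h @ [x]) s a" if sa: "s \<in> states M" "a \<in> actions M" for s a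
  proof (cases "s = st x \<and> a = ac x")
    case True
    then have Npos: "0 < N (h @ [x]) s a" by (simp add: N_snoc)
    have io_nn: "0 \<le> io (N (h @ [x]) s a)" using io_ge[of "N (h @ [x]) s a"] by linarith
    have "Pv M s a Vs \<le> Eb (h @ [x]) s a Vs + bonus (h @ [x]) s a Vs"
      using opt sa Npos by (auto simp: optimistic_at_def)
    also have "\<dots> \<le> Eb (h @ [x]) s a (VV h) + bonus (h @ [x]) s a (VV h)"
      unfolding Eb_def bonus_def Vb_def
    proof (rule bonus_mono)
      show "(\<Sum>y\<in>next_states M. Pb (h @ [x]) s a y) = 1" by (rule sum_Pb[OF snoc.prems(2) Npos])
      show "0 \<le> io (N (h @ [x]) s a) / real (N (h @ [x]) s a)" using io_nn by simp
    qed (use Pb_nonneg IH(2) Vs_abs_le_B B1 c1 c12 in simp_all)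
    finally show ?thesis using True IH(1)[OF sa] by (simp add: QQ_snoc)
  qed (use IH(1)[OF sa] in \<open>auto simp: QQ_snoc\<close>)
  have "Vs y \<le> VV (h @ [x]) y" if y: "y \<in> next_states M" for y
  proof (cases y)
    case (Some s)
    then have s: "s \<in> states M" using y by simp
    have "Vs (Some s) \<le> QQ (h @ [x]) s (mu_star s)"
      using Q[OF s mu_star(1)] mu_star(2)[OF s] by simp
    also have "\<dots> \<le> VV (h @ [x]) y" unfolding Some by (rule QQ_le_VV) (rule mu_star)
    finally show ?thesis by (simp add: Some)
  qed simp
  with Q show ?case by blast
qed

end

section \<open>The favourable event\<close>

text \<open>Unlike \<open>stopsum\<close>, this restarts with every episode; the transition that
  ends an episode is discarded too.\<close>

definition epsum :: "(('s, 'a) transition \<Rightarrow> real) \<Rightarrow> ('s, 'a) transition list \<Rightarrow> real" where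
  "epsum w h = foldl (\<lambda>acc x. if nxt x = None then 0 else acc + w x) 0 h"

lemma epsum_Nil [simp]: "epsum w [] = 0"
  and epsum_snoc [simp]: "epsum w (h @ [x]) = (if nxt x = None then 0 else epsum w h + w x)"
  by (simp_all add: epsum_def)

definition nep :: "('s, 'a) transition list \<Rightarrow> nat" where
  "nep h = length (filter (\<lambda>x. nxt x = None) h)"

lemma nep_Nil [simp]: "nep [] = 0"
  and nep_snoc [simp]: "nep (h @ [x]) = nep h + (if nxt x = None then 1 else 0)"
  by (simp_all add: nep_def)

context sp_agent
begin

lemma measure_bad_mono:
  assumes "\<And>h. Pr h \<Longrightarrow> Pr' h"
  shows "prob_ever (\<lambda>h. Pr h) \<le> prob_ever (\<lambda>h. Pr' h)"
proof -
  interpret prob_space space_meas unfolding interaction_def by (rule prob_space_seq_measure)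
  show ?thesis
    by (rule finite_measure_mono) (use assms in blast, unfold interaction_def, rule sets_ex_prefix)
qed

lemma measure_bad_UN:
  assumes "finite I" "\<And>i. i \<in> I \<Longrightarrow> prob_ever (\<lambda>h. bad i h) \<le> d"
  shows "prob_ever (\<lambda>h. \<exists>i\<in>I. bad i h) \<le> real (card I) * d"
proof -
  interpret prob_space space_meas unfolding interaction_def by (rule prob_space_seq_measure)
  have "{\<omega>. \<exists>n. \<exists>i\<in>I. bad i (prefix_of \<omega> n)} = (\<Union>i\<in>I. {\<omega>. \<exists>n. bad i (prefix_of \<omega> n)})" by blast
  then have "prob_ever (\<lambda>h. \<exists>i\<in>I. bad i h) \<le> (\<Sum>i\<in>I. prob_ever (\<lambda>h. bad i h))"
  proof (simp only:, intro finite_measure_subadditive_finite assms(1) subsetI)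
    fix A assume "A \<in> (\<lambda>i. {\<omega>. \<exists>n. bad i (prefix_of \<omega> n)}) ` I"
    then obtain i where A: "A = {\<omega>. \<exists>n. bad i (prefix_of \<omega> n)}" by blast
    show "A \<in> events" unfolding A interaction_def by (rule sets_ex_prefix)
  qed
  also have "\<dots> \<le> (\<Sum>i\<in>I. d)" by (rule sum_mono) (rule assms(2))
  finally show ?thesis by simp
qed

lemma measure_bad_disj:
  assumes "prob_ever (\<lambda>h. Pr h) \<le> d"
    and "prob_ever (\<lambda>h. Pr' h) \<le> d'"
  shows "prob_ever (\<lambda>h. Pr h \<or> Pr' h) \<le> d + d'"
proof -
  interpret prob_space space_meas unfolding interaction_def by (rule prob_space_seq_measure)
  have eq: "{\<omega>. \<exists>n. Pr (prefix_of \<omega> n) \<or> Pr' (prefix_of \<omega> n)} =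
      {\<omega>. \<exists>n. Pr (prefix_of \<omega> n)} \<union> {\<omega>. \<exists>n. Pr' (prefix_of \<omega> n)}" by blast
  have "{\<omega>. \<exists>n. Pr (prefix_of \<omega> n)} \<in> sets space_meas" "{\<omega>. \<exists>n. Pr' (prefix_of \<omega> n)} \<in> sets space_meas"
    unfolding interaction_def by (rule sets_ex_prefix)+
  from measure_Un_le[OF this] show ?thesis unfolding eq using assms by linarith
qed

lemma maximal_inequality_single:
  assumes "\<And>h. good_hist M h \<Longrightarrow> 0 \<le> W h" "\<And>h. good_hist M h \<Longrightarrow> stepE W h \<le> W h" "W [] \<le> 1" "0 < d"
  shows "prob_ever (\<lambda>h. 1 / d \<le> W h) \<le> d"
proof -
  have "prob_ever (\<lambda>h. 1 / d \<le> W h) \<le> W [] / (1 / d)"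
    unfolding interaction_def by (rule maximal_inequality) (use assms in auto)
  also have "\<dots> \<le> d" using assms by (simp add: mult_left_le_one_le)
  finally show ?thesis .
qed

end

context vi_run
begin

section \<open>Deviations of empirical averages at a fixed pair\<close>

definition SA :: real where "SA = real (card (states M)) * real (card (actions M))"

lemma SA_ge: "1 \<le> SA"
  using mult_mono[OF card_pos] by (simp add: SA_def)

lemma io_SA: "io n = ln (1 / (\<delta> / SA)) + ln (ln1 (B * real n))"
  by (simp add: io_eq SA_def)

lemma ln_delta: "4 \<le> ln (1 / \<delta>)" and ln_delta_le: "ln (1 / \<delta>) \<le> ln (1 / (\<delta> / SA))"
proof -
  have "exp (4::real) = exp 1 ^ 4" by (simp flip: exp_of_nat_mult)
  also have "\<dots> \<le> (3::real) ^ 4" using exp_le by (intro power_mono) auto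
  also have "\<dots> \<le> 1 / \<delta>" using \<delta> by (simp add: field_simps)
  finally show "4 \<le> ln (1 / \<delta>)" using \<delta> by (subst ln_ge_iff) auto
  show "ln (1 / \<delta>) \<le> ln (1 / (\<delta> / SA))"
    using SA_ge \<delta> by (intro ln_mono) (auto simp: field_simps)
qed

lemma dSA: "0 < \<delta> / SA" "\<delta> / SA \<le> 1"
  using SA_ge \<delta> by (auto simp: field_simps)

lemma L_le_io: "1 \<le> n \<Longrightarrow> ln (1 / (\<delta> / SA)) + ln (ln1 (real n)) \<le> io n"
  unfolding io_SA using B1 by (intro add_left_mono lnln1_mono) (auto simp: mult_left_mono)

lemma Eb_const: "good_hist M h \<Longrightarrow> 0 < N h s a \<Longrightarrow> Eb h s a (\<lambda>_. c) = c"
  using sum_Pb[of h s a] by (simp add: Eb_def expect_def flip: sum_distrib_right)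

lemma Eb_add: "Eb h s a (\<lambda>y. v y + w y) = Eb h s a v + Eb h s a w"
  and Eb_diff: "Eb h s a (\<lambda>y. v y - w y) = Eb h s a v - Eb h s a w"
  and Eb_cmult: "Eb h s a (\<lambda>y. c * v y) = c * Eb h s a v"
  by (simp_all add: Eb_def expect_def algebra_simps sum.distrib sum_subtractf sum_distrib_left)

lemma Eb_mono: "(\<And>y. y \<in> next_states M \<Longrightarrow> v y \<le> w y) \<Longrightarrow> Eb h s a v \<le> Eb h s a w"
  unfolding Eb_def expect_def by (intro sum_mono mult_left_mono Pb_nonneg)

lemma Vb_eq: "Vb h s a v = Eb h s a (\<lambda>y. (v y)\<^sup>2) - (Eb h s a v)\<^sup>2"
  by (simp add: Vb_def Eb_def varia_def)

lemma Eb_shift_square: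
  assumes "good_hist M h" "0 < N h s a"
  shows "Eb h s a (\<lambda>y. (\<mu> - v y)\<^sup>2) = Vb h s a v + (\<mu> - Eb h s a v)\<^sup>2"
proof -
  have "(\<lambda>y. (\<mu> - v y)\<^sup>2) = (\<lambda>y. \<mu>\<^sup>2 + ((v y)\<^sup>2 - (2 * \<mu>) * v y))"
    by (rule ext) (simp add: power2_eq_square algebra_simps)
  then have "Eb h s a (\<lambda>y. (\<mu> - v y)\<^sup>2) = \<mu>\<^sup>2 + (Eb h s a (\<lambda>y. (v y)\<^sup>2) - (2 * \<mu>) * Eb h s a v)"
    by (simp only: Eb_add Eb_diff Eb_cmult Eb_const[OF assms])
  then show ?thesis by (simp add: Vb_eq power2_eq_square algebra_simps)
qed

lemma Vb_nonneg:
  assumes "good_hist M h" "0 < N h s a"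
  shows "0 \<le> Vb h s a v"
proof -
  have "0 \<le> Eb h s a (\<lambda>y. (Eb h s a v - v y)\<^sup>2)"
    using Eb_mono[of "\<lambda>_. 0" "\<lambda>y. (Eb h s a v - v y)\<^sup>2" h s a] Eb_const[OF assms, of 0] by simp
  then show ?thesis unfolding Eb_shift_square[OF assms] by simp
qed

lemma Eb_abs_le:
  assumes "good_hist M h" "0 < N h s a" "\<And>y. y \<in> next_states M \<Longrightarrow> \<bar>v y\<bar> \<le> c"
  shows "\<bar>Eb h s a v\<bar> \<le> c"
proof -
  have "Eb h s a v \<le> Eb h s a (\<lambda>_. c)" by (rule Eb_mono) (use assms(3) in \<open>simp add: abs_le_iff\<close>)
  moreover have "Eb h s a (\<lambda>_. - c) \<le> Eb h s a v"
    by (rule Eb_mono) (use assms(3) in \<open>force simp: abs_le_iff\<close>)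
  ultimately show ?thesis unfolding Eb_const[OF assms(1,2)] by linarith
qed

lemma sqrt_div_n: "0 < n \<Longrightarrow> sqrt (n * V * L) / n = sqrt (V * L / (n::real))"
proof -
  assume n: "0 < n"
  have "sqrt (n * V * L) / n = sqrt (n * V * L) / sqrt (n * n)" using n by simp
  also have "\<dots> = sqrt ((n * V * L) / (n * n))" by (rule real_sqrt_divide[symmetric])
  also have "(n * V * L) / (n * n) = V * L / n" using n by simp
  finally show ?thesis .
qed

text \<open>The increments are centred at the true mean \<open>\<mu>\<close>, whereas the bonus
  contains the variance about the empirical mean. The second moments differ by
  \<open>(\<mu> - E)\<^sup>2\<close>, and for scales up to \<open>1 / (8 * B)\<close> this quadratic
  term is absorbed by half of the linear one.\<close>

lemma optimism_event:
  assumes s: "s \<in> states M" and a: "a \<in> actions M"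
  shows "prob_ever (\<lambda>h. good_hist M h \<and> 0 < N h s a \<and>
     \<not> Pv M s a Vs \<le> Eb h s a Vs + bonus h s a Vs) \<le> \<delta> / SA"
proof -
  define \<mu> where "\<mu> = Pv M s a Vs"
  define \<beta> where "\<beta> j = 1 / (2 ^ j * (8 * B))" for j :: nat
  define g where "g j y = \<beta> j * (\<mu> - Vs y) - 2 * (\<beta> j)\<^sup>2 * (\<mu> - Vs y)\<^sup>2" for j y
  define F where "F = (\<lambda>j (h :: ('s, 'a) transition list) x. if st x = s \<and> ac x = a then g j (nxt x) else 0)"
  have B: "0 < B" using B1 by simp
  have \<mu>: "\<bar>\<mu>\<bar> \<le> B" unfolding \<mu>_def by (rule Pv_abs_le[OF s a]) (rule Vs_abs_le_B)
  have \<beta>: "0 < \<beta> j" "\<beta> j * (2 * B) \<le> 1/2" "\<beta> j * (4 * B) \<le> 1/2" for j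
  proof -
    show "0 < \<beta> j" using B by (simp add: \<beta>_def)
    have "\<beta> j * (4 * B) = 1 / 2 / 2 ^ j" using B by (simp add: \<beta>_def)
    also have "\<dots> \<le> 1 / 2 / 1" by (intro divide_left_mono) auto
    finally show "\<beta> j * (4 * B) \<le> 1/2" by simp
    then show "\<beta> j * (2 * B) \<le> 1/2" using mult_nonneg_nonneg[of "\<beta> j" B] \<open>0 < \<beta> j\<close> B by linarith
  qed
  have "prob_ever (\<lambda>h. \<exists>j. ln (real (j + 1) * real (j + 2) / (\<delta> / SA)) \<le> sumh (F j) h) \<le> \<delta> / SA"
  proof (rule maximal_inequality_exp[OF _ dSA(1)])
    fix j and h :: "('s, 'a) transition list" assume h: "good_hist M h"
    show "Pcur h (\<lambda>y. exp (F j h (cur_tr h y))) \<le> 1"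
    proof (cases "cur h = s \<and> act h = a")
      case True
      have "Pcur h (\<lambda>y. exp (\<beta> j * (\<mu> - Vs y) - 2 * (\<beta> j)\<^sup>2 * (\<mu> - Vs y)\<^sup>2)) \<le> 1"
      proof (rule Pcur_exp_empirical[OF h, of "\<lambda>y. \<mu> - Vs y" "2 * B"])
        fix y assume "y \<in> next_states M"
        then show "\<bar>\<mu> - Vs y\<bar> \<le> 2 * B" using \<mu> Vs_abs_le_B[of y] by linarith
      next
        have "cur h = s" "f h s = a" using True by auto
        then show "Pcur h (\<lambda>y. \<mu> - Vs y) = 0" using s a by (simp add: Pv_diff Pv_const \<mu>_def)
      qed (use B \<beta>(1)[of j] \<beta>(2)[of j] in auto)
      moreover have "cur h = s" "f h s = a" using True by auto
      ultimately show ?thesis by (simp add: F_def g_def)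
    next
      case False
      then have "Pcur h (\<lambda>y. exp (F j h (cur_tr h y))) = Pcur h (\<lambda>_. 1)" by (intro Pv_cong) (auto simp: F_def)
      then show ?thesis using h by (simp add: Pv_const)
    qed
  qed
  moreover have "prob_ever (\<lambda>h. good_hist M h \<and> 0 < N h s a \<and>
     \<not> Pv M s a Vs \<le> Eb h s a Vs + bonus h s a Vs) \<le>
     prob_ever (\<lambda>h. \<exists>j. ln (real (j + 1) * real (j + 2) / (\<delta> / SA)) \<le> sumh (F j) h)"
  proof (rule measure_bad_mono, elim conjE)
    fix h assume h: "good_hist M h" and Np: "0 < N h s a" and bad: "\<not> Pv M s a Vs \<le> Eb h s a Vs + bonus h s a Vs"
    define n where "n = real (N h s a)"
    define E where "E = Eb h s a Vs"
    define V where "V = Vb h s a Vs"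
    define L where "L = ln (1 / (\<delta> / SA)) + ln (ln1 n)"
    have n: "1 \<le> n" using Np by (simp add: n_def)
    have V: "0 \<le> V" unfolding V_def by (rule Vb_nonneg[OF h Np])
    have E: "\<bar>E\<bar> \<le> B" unfolding E_def by (rule Eb_abs_le[OF h Np]) (rule Vs_abs_le_B)
    have "V \<le> Eb h s a (\<lambda>y. (Vs y)\<^sup>2)" by (simp add: V_def Vb_eq)
    also have "\<dots> \<le> Eb h s a (\<lambda>_. B\<^sup>2)"
    proof (rule Eb_mono)
      fix y assume "y \<in> next_states M"
      then show "(Vs y)\<^sup>2 \<le> B\<^sup>2" using power_mono[OF Vs_abs_le_B, of y 2] by simp
    qed
    also have "\<dots> = B\<^sup>2" by (rule Eb_const[OF h Np])
    finally have VB: "V \<le> B\<^sup>2" .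
    have L: "1 \<le> L" "L \<le> io (N h s a)"
      using ln_delta ln_delta_le lnln1_nonneg[of n] L_le_io[of "N h s a"] Np by (auto simp: L_def n_def)
    show "\<exists>j. ln (real (j + 1) * real (j + 2) / (\<delta> / SA)) \<le> sumh (F j) h"
    proof (rule ccontr)
      assume "\<not> ?thesis"
      then have no: "sumh (F j) h \<le> ln (real (j + 1) * real (j + 2) / (\<delta> / SA))" for j
        by (simp add: not_le less_imp_le)
      have gt: "bonus h s a Vs < \<mu> - E" using bad by (simp add: \<mu>_def E_def)
      have t_nn: "0 \<le> c2 * B * (io (N h s a) / n)" using c2 B io_ge[of "N h s a"] n by simp
      have "0 \<le> bonus h s a Vs" using t_nn by (simp add: bonus_def n_def le_max_iff_disj)
      then have pos: "0 < \<mu> - E" using gt by linarith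
      have le2B: "\<mu> - E \<le> 2 * B" using \<mu> E by linarith
      have eq: "sumh (F j) h = n * (\<beta> j * (\<mu> - E) - 2 * (\<beta> j)\<^sup>2 * (V + (\<mu> - E)\<^sup>2))" for j
      proof -
        have "sumh (F j) h = n * Eb h s a (g j)"
          unfolding F_def n_def Eb_eq[OF h Np] ..
        also have "Eb h s a (g j) = \<beta> j * (\<mu> - E) - 2 * (\<beta> j)\<^sup>2 * (V + (\<mu> - E)\<^sup>2)"
          unfolding g_def[abs_def] E_def V_def
          by (simp only: Eb_diff Eb_cmult Eb_shift_square[OF h Np] Eb_const[OF h Np])
        finally show ?thesis .
      qed
      have "(n * (\<mu> - E) / 2) / (2 ^ j * (8 * B)) \<le> 2 * (n * V) / (2 ^ j * (8 * B))\<^sup>2 + ln (real (j + 1) * real (j + 2) / (\<delta> / SA))" for j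
      proof -
        have "\<beta> j * (\<mu> - E) * (\<beta> j * (4 * B)) \<le> \<beta> j * (\<mu> - E) * (1 / 2)"
          using \<beta>[of j] pos by (intro mult_left_mono) auto
        moreover have "2 * (\<beta> j)\<^sup>2 * (\<mu> - E)\<^sup>2 \<le> \<beta> j * (\<mu> - E) * (\<beta> j * (4 * B))"
        proof -
          have "(2 * (\<beta> j)\<^sup>2 * (\<mu> - E)) * (\<mu> - E) \<le> (2 * (\<beta> j)\<^sup>2 * (\<mu> - E)) * (2 * B)"
            using pos le2B by (intro mult_left_mono) auto
          then show ?thesis by (simp add: power2_eq_square algebra_simps)
        qed
        ultimately have "2 * (\<beta> j)\<^sup>2 * (\<mu> - E)\<^sup>2 \<le> \<beta> j * (\<mu> - E) / 2" by linarith
        then have "n * (2 * (\<beta> j)\<^sup>2 * (\<mu> - E)\<^sup>2) \<le> n * (\<beta> j * (\<mu> - E) / 2)" using n by (intro mult_left_mono) auto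
        then have "n * (\<mu> - E) / 2 * \<beta> j \<le> 2 * (n * V) * (\<beta> j)\<^sup>2 + ln (real (j + 1) * real (j + 2) / (\<delta> / SA))"
          using no[of j] unfolding eq by (simp add: algebra_simps)
        then show ?thesis by (simp add: \<beta>_def power_divide)
      qed
      note scales = this
      have "n * (\<mu> - E) / 2 \<le> (2 + 10) * (sqrt (n * V * L) + 8 * B * L)"
      proof (rule dyadic_optimisation[OF _ _ _ n dSA _ L_def L(1) scales])
        have "n * V \<le> n * (64 * B\<^sup>2)" using n VB zero_le_power2[of B] by (intro mult_left_mono) linarith+
        then show "n * V \<le> (8 * B)\<^sup>2 * n" by (simp add: power_mult_distrib mult.commute)
      qed (use B n V in simp_all)
      \<comment> \<open>Twice \<open>2 + 10\<close> is 24, and the range \<open>8 * B\<close> turns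
        24 into 192.\<close>
      then have "n * (\<mu> - E) \<le> 24 * sqrt (n * V * L) + 192 * (B * L)"
        by (simp add: distrib_left)
      then have "n * (\<mu> - E) / n \<le> (24 * sqrt (n * V * L) + 192 * (B * L)) / n"
        using n by (intro divide_right_mono) auto
      then have "\<mu> - E \<le> 24 * (sqrt (n * V * L) / n) + 192 * (B * (L / n))"
        using n by (simp add: add_divide_distrib)
      also have "sqrt (n * V * L) / n = sqrt (V * L / n)" using n by (intro sqrt_div_n) simp
      also have "\<dots> \<le> sqrt (V * (io (N h s a) / n))"
        using n V L by (simp add: divide_right_mono mult_left_mono)
      also have "B * (L / n) \<le> B * (io (N h s a) / n)"
        using B n L by (intro mult_left_mono divide_right_mono) auto
      finally have "\<mu> - E \<le> 24 * sqrt (V * (io (N h s a) / n)) + 192 * (B * (io (N h s a) / n))" by simp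
      also have "\<dots> \<le> bonus h s a Vs"
      proof -
        have "400 * sqrt (V * (io (N h s a) / n)) \<le> c1 * sqrt (V * (io (N h s a) / n))"
          using c1 V n io_ge[of "N h s a"] by (intro mult_right_mono) auto
        moreover have "400 * (B * (io (N h s a) / n)) \<le> c2 * B * (io (N h s a) / n)"
          unfolding mult.assoc using c2 B n io_ge[of "N h s a"] by (intro mult_right_mono) auto
        moreover have "0 \<le> sqrt (V * (io (N h s a) / n))" "0 \<le> B * (io (N h s a) / n)"
          using V n B io_ge[of "N h s a"] by auto
        moreover have "24 * x + 192 * y \<le> max p q" if "400 * x \<le> p" "400 * y \<le> q" "0 \<le> x" "0 \<le> y" for x y p q :: real
          using that by (cases "x \<le> y") (auto simp: le_max_iff_disj)
        ultimately show ?thesis unfolding bonus_def V_def n_def by blast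
      qed
      finally show False using gt by simp
    qed
  qed
  ultimately show ?thesis by linarith
qed

text \<open>\<open>freedman\<close> with increments only at visits to \<open>(s, a)\<close> and the
  number of visits as clock. The true variance appears here, since this bounds the error of the
  estimates and does not have to be computable by the learner.\<close>

lemma deviation_event:
  assumes s: "s \<in> states M" and a: "a \<in> actions M" and b: "0 < b"
    and g: "\<And>y. y \<in> next_states M \<Longrightarrow> \<bar>g y - Pv M s a g\<bar> \<le> b"
    and d: "0 < d" "d \<le> 1" "1 \<le> ln (1 / d)"
  shows "prob_ever (\<lambda>h. good_hist M h \<and> (0 < N h s a \<and>
     \<not> Eb h s a g - Pv M s a g \<le>
      11 * (sqrt (Vr s a g * (ln (1 / d) + ln (ln1 (real (N h s a)))) / real (N h s a))
        + b * (ln (1 / d) + ln (ln1 (real (N h s a)))) / real (N h s a)))) \<le> d"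
proof (rule freedman[where b=b and \<xi>="\<lambda>h x. if st x = s \<and> ac x = a then g (nxt x) - Pv M s a g else 0"
      and v="\<lambda>h x. if st x = s \<and> ac x = a then Vr s a g else 0"])
  note var = Pv_square_shift[OF s a, of "- Pv M s a g" g]
  fix h :: "('s, 'a) transition list" assume h: "good_hist M h"
  {
    fix y assume "y \<in> next_states M"
    then show "\<bar>if st (cur_tr h y) = s \<and> ac (cur_tr h y) = a then g (nxt (cur_tr h y)) - Pv M s a g else 0\<bar> \<le> b"
      using g b by auto
  }
  show "Pcur h (\<lambda>y. if st (cur_tr h y) = s \<and> ac (cur_tr h y) = a then g (nxt (cur_tr h y)) - Pv M s a g else 0) = 0"
  proof (cases "cur h = s \<and> act h = a")
    case True
    then have "cur h = s" "f h s = a" by auto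
    then show ?thesis using s a by (simp add: Pv_diff Pv_const)
  next
    case False
    then have "Pcur h (\<lambda>y. if st (cur_tr h y) = s \<and> ac (cur_tr h y) = a then g (nxt (cur_tr h y)) - Pv M s a g else 0) = Pcur h (\<lambda>_. 0)"
      by (intro Pv_cong) auto
    then show ?thesis using h by (simp add: Pv_const)
  qed
  show "Pcur h (\<lambda>y. (if st (cur_tr h y) = s \<and> ac (cur_tr h y) = a then g (nxt (cur_tr h y)) - Pv M s a g else 0)\<^sup>2)
     \<le> (if st (cur_tr h y) = s \<and> ac (cur_tr h y) = a then Vr s a g else 0)" for y
  proof (cases "cur h = s \<and> act h = a")
    case True
    then have "cur h = s" "f h s = a" by auto
    then show ?thesis using var by simp
  next
    case False
    then have "Pcur h (\<lambda>y. (if st (cur_tr h y) = s \<and> ac (cur_tr h y) = a then g (nxt (cur_tr h y)) - Pv M s a g else 0)\<^sup>2) = Pcur h (\<lambda>_. 0)"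
      by (intro Pv_cong) auto
    then have eq: "Pcur h (\<lambda>y. (if st (cur_tr h y) = s \<and> ac (cur_tr h y) = a then g (nxt (cur_tr h y)) - Pv M s a g else 0)\<^sup>2) = 0"
      using h by (simp add: Pv_const)
    show ?thesis unfolding eq using Vr_nonneg[OF s a] by simp
  qed
  define n where "n = real (N h s a)"
  define L where "L = ln (1 / d) + ln (ln1 n)"
  assume bad: "0 < N h s a \<and>
     \<not> Eb h s a g - Pv M s a g \<le>
      11 * (sqrt (Vr s a g * (ln (1 / d) + ln (ln1 (real (N h s a)))) / real (N h s a))
        + b * (ln (1 / d) + ln (ln1 (real (N h s a)))) / real (N h s a))"
  then have Np: "0 < N h s a" and n: "1 \<le> n" by (auto simp: n_def)
  have gt: "11 * (sqrt (Vr s a g * L / n) + b * L / n) < Eb h s a g - Pv M s a g"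
    using bad by (simp add: n_def L_def not_le)
  have V: "0 \<le> Vr s a g" by (rule Vr_nonneg[OF s a])
  have "Vr s a g = Pv M s a (\<lambda>y. (- Pv M s a g + g y)\<^sup>2)" using var by simp
  also have "\<dots> \<le> b\<^sup>2"
  proof (rule Pv_le_const[OF s a])
    fix y assume "y \<in> next_states M"
    then show "(- Pv M s a g + g y)\<^sup>2 \<le> b\<^sup>2"
      using power_mono[OF g, of y 2] by (simp add: power2_commute)
  qed
  finally have Vb: "Vr s a g \<le> b\<^sup>2" .
  have sv: "sumh (\<lambda>h x. if st x = s \<and> ac x = a then Vr s a g else 0) h = n * Vr s a g"
    using Eb_eq[OF h Np, of "\<lambda>_. Vr s a g"] Eb_const[OF h Np] by (simp add: n_def)
  have sx: "sumh (\<lambda>h x. if st x = s \<and> ac x = a then g (nxt x) - Pv M s a g else 0) h = n * (Eb h s a g - Pv M s a g)"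
    using Eb_eq[OF h Np, of "\<lambda>y. g y - Pv M s a g"] Eb_const[OF h Np] by (simp add: n_def Eb_diff)
  have "n * (11 * (sqrt (Vr s a g * L / n) + b * L / n)) < n * (Eb h s a g - Pv M s a g)"
    using gt n by (intro mult_strict_left_mono) auto
  moreover have "n * (11 * (sqrt (Vr s a g * L / n) + b * L / n)) = 11 * (sqrt (n * Vr s a g * L) + b * L)"
  proof -
    have "n * sqrt (Vr s a g * L / n) = sqrt (n * Vr s a g * L)"
      using sqrt_div_n[of n "Vr s a g" L] n by (simp add: field_simps)
    then show ?thesis using n by (simp add: distrib_left mult.left_commute[of n])
  qed
  ultimately have lt: "11 * (sqrt (n * Vr s a g * L) + b * L) < n * (Eb h s a g - Pv M s a g)" by simp
  have nV: "n * Vr s a g \<le> b\<^sup>2 * n" using mult_left_mono[OF Vb, of n] n by (simp add: mult.commute)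
  have L1: "1 \<le> L" using d lnln1_nonneg[of n] by (simp add: L_def)
  show "\<exists>N. 1 \<le> N \<and> 0 \<le> sumh (\<lambda>h x. if st x = s \<and> ac x = a then Vr s a g else 0) h \<and>
      sumh (\<lambda>h x. if st x = s \<and> ac x = a then Vr s a g else 0) h \<le> b\<^sup>2 * N \<and>
      1 \<le> ln (1 / d) + ln (ln1 N) \<and>
      11 * (sqrt (sumh (\<lambda>h x. if st x = s \<and> ac x = a then Vr s a g else 0) h * (ln (1 / d) + ln (ln1 N)))
         + b * (ln (1 / d) + ln (ln1 N)))
      < sumh (\<lambda>h x. if st x = s \<and> ac x = a then g (nxt x) - Pv M s a g else 0) h"
    unfolding sv sx using n V nV L1 lt unfolding L_def by (intro exI[of _ n] conjI) simp_all
qed (use b d in auto)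

text \<open>The truncation makes \<open>Xc\<close> bounded on all histories; on the favourable event it is inactive.\<close>

definition Xc :: "('s, 'a) transition list \<Rightarrow> 's option \<Rightarrow> real" where
  "Xc h y = (if \<forall>y\<in>next_states M. Vs y \<le> VV h y then VV h y - Vs y else 0)"

lemma Xc_bounds: "y \<in> next_states M \<Longrightarrow> 0 \<le> Xc h y \<and> Xc h y \<le> 2 * B"
proof -
  assume y: "y \<in> next_states M"
  have "VV h y - Vs y \<le> 2 * B" using VV_le_B[of h y] Vs_abs_le_B[OF y] by linarith
  then show ?thesis using y B1 by (auto simp: Xc_def)
qed

section \<open>Martingales and potentials along the whole history\<close>

abbreviation trP :: "('s, 'a) transition \<Rightarrow> ('s option \<Rightarrow> real) \<Rightarrow> real" where
  "trP x v \<equiv> Pv M (st x) (ac x) v"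

abbreviation trV :: "('s, 'a) transition \<Rightarrow> ('s option \<Rightarrow> real) \<Rightarrow> real" where
  "trV x v \<equiv> Vr (st x) (ac x) v"

abbreviation gap :: "('s, 'a) transition \<Rightarrow> real" where
  "gap x \<equiv> adv (st x) (ac x)"

definition YY :: "('s, 'a) transition list \<Rightarrow> real" where
  "YY = sumh (\<lambda>h x. trV x Vs)"

definition ZZ :: "('s, 'a) transition list \<Rightarrow> real" where
  "ZZ = sumh (\<lambda>h x. trV x (Xc h))"

definition Acur :: "('s, 'a) transition list \<Rightarrow> real" where
  "Acur = epsum gap"

definition Ccur :: "('s, 'a) transition list \<Rightarrow> real" where
  "Ccur = epsum (\<lambda>x. rew M (st x) (ac x))"

text \<open>Collects the error terms of \<open>Hm_step\<close> over time.\<close>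

definition SG :: "('s, 'a) transition list \<Rightarrow> real" where
  "SG = sumh (\<lambda>h x. 4 * gap x * (Acur h + gap x))"

abbreviation len1 :: "('s, 'a) transition list \<Rightarrow> nat" where
  "len1 h \<equiv> max 1 (length h)"

lemma Acur_nonneg: "good_hist M h \<Longrightarrow> 0 \<le> Acur h"
  by (induction h rule: rev_induct) (auto simp: Acur_def good_tr_def intro!: add_nonneg_nonneg adv_nonneg)

lemma sumh_trV_bounds:
  assumes "good_hist M h" and v: "\<And>h y. y \<in> next_states M \<Longrightarrow> \<bar>v h y\<bar> \<le> 2 * B"
  shows "0 \<le> sumh (\<lambda>h x. trV x (v h)) h \<and> sumh (\<lambda>h x. trV x (v h)) h \<le> (2 * B)\<^sup>2 * real (length h)"
  using assms(1)
proof (induction h rule: rev_induct)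
  case (snoc x h)
  then have sa: "st x \<in> states M" "ac x \<in> actions M" by (auto simp: good_tr_def)
  have "trV x (v h) \<le> trP x (\<lambda>y. (v h y)\<^sup>2)" by (simp add: Vr_def)
  also have "\<dots> \<le> (2 * B)\<^sup>2"
  proof (rule Pv_le_const[OF sa])
    fix y assume "y \<in> next_states M"
    then show "(v h y)\<^sup>2 \<le> (2 * B)\<^sup>2" using power_mono[OF v, of y h 2] by simp
  qed
  finally have "trV x (v h) \<le> (2 * B)\<^sup>2" .
  then show ?case using snoc Vr_nonneg[OF sa, of "v h"] by (simp add: distrib_left)
qed simp

text \<open>As \<open>v\<close> may depend on the past, this covers both \<open>Vs\<close> and the
  excess \<open>Xc\<close>. The increments are bounded by the oscillation of \<open>v\<close>, and
  \<open>len1\<close> keeps the clock positive at the empty history.\<close>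

lemma martingale_event:
  assumes v: "\<And>h y. y \<in> next_states M \<Longrightarrow> \<bar>v h y\<bar> \<le> 2 * B"
    and vdiff: "\<And>h y y'. y \<in> next_states M \<Longrightarrow> y' \<in> next_states M \<Longrightarrow> v h y - v h y' \<le> 2 * B"
  shows "prob_ever (\<lambda>h. good_hist M h \<and>
     \<not> sumh (\<lambda>h x. trP x (v h) - v h (nxt x)) h \<le>
      11 * (sqrt (sumh (\<lambda>h x. trV x (v h)) h * io (len1 h)) + 2 * B * io (len1 h))) \<le> \<delta>"
proof (rule freedman[where b="2 * B" and v="\<lambda>h x. trV x (v h)"])
  fix h :: "('s, 'a) transition list" assume h: "good_hist M h"
  note sa = cur_in_states[OF h] act_in_actions[OF h]
  {
    fix y assume y: "y \<in> next_states M"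
    have "Pcur h (v h) \<le> v h y + 2 * B" by (rule Pv_le_const[OF sa]) (use vdiff[OF _ y, of _ h] in force)
    moreover have "v h y - 2 * B \<le> Pcur h (v h)" by (rule Pv_ge_const[OF sa]) (use vdiff[OF y, of _ h] in force)
    ultimately show "\<bar>trP (cur_tr h y) (v h) - v h (nxt (cur_tr h y))\<bar> \<le> 2 * B" by (simp add: abs_le_iff)
  }
  show "Pcur h (\<lambda>y. trP (cur_tr h y) (v h) - v h (nxt (cur_tr h y))) = 0"
    using sa by (simp add: Pv_diff Pv_const)
  show "Pcur h (\<lambda>y. (trP (cur_tr h y) (v h) - v h (nxt (cur_tr h y)))\<^sup>2) \<le> trV (cur_tr h y) (v h)" for y
  proof -
    have "Pcur h (\<lambda>y. (trP (cur_tr h y) (v h) - v h (nxt (cur_tr h y)))\<^sup>2) = Pcur h (\<lambda>y. (- Pcur h (v h) + v h y)\<^sup>2)"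
      by (intro Pv_cong) (simp add: power2_eq_square algebra_simps)
    then show ?thesis using Pv_square_shift[OF sa, of "- Pcur h (v h)" "v h"] by simp
  qed
  let ?V = "sumh (\<lambda>h x. trV x (v h)) h" and ?T = "real (len1 h)"
  assume bad: "\<not> sumh (\<lambda>h x. trP x (v h) - v h (nxt x)) h \<le> 11 * (sqrt (?V * io (len1 h)) + 2 * B * io (len1 h))"
  have V: "0 \<le> ?V" "?V \<le> (2 * B)\<^sup>2 * real (length h)" using sumh_trV_bounds[OF h v] by auto
  have VT: "?V \<le> (2 * B)\<^sup>2 * ?T"
    by (rule order_trans[OF V(2)]) (intro mult_left_mono, auto)
  have L: "ln (1 / \<delta>) + ln (ln1 ?T) \<le> io (len1 h)"
    using L_le_io[of "len1 h"] ln_delta_le by simp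
  have L1: "1 \<le> ln (1 / \<delta>) + ln (ln1 ?T)" using ln_delta lnln1_nonneg[of ?T] by linarith
  have "11 * (sqrt (?V * (ln (1 / \<delta>) + ln (ln1 ?T))) + 2 * B * (ln (1 / \<delta>) + ln (ln1 ?T)))
      \<le> 11 * (sqrt (?V * io (len1 h)) + 2 * B * io (len1 h))"
    using L V B1 by (intro mult_left_mono add_mono real_sqrt_le_mono) auto
  then show "\<exists>N. 1 \<le> N \<and> 0 \<le> ?V \<and> ?V \<le> (2 * B)\<^sup>2 * N \<and> 1 \<le> ln (1 / \<delta>) + ln (ln1 N) \<and>
      11 * (sqrt (?V * (ln (1 / \<delta>) + ln (ln1 N))) + 2 * B * (ln (1 / \<delta>) + ln (ln1 N)))
      < sumh (\<lambda>h x. trP x (v h) - v h (nxt x)) h"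
    using bad V VT L1 by (intro exI[of _ ?T]) auto
qed (use B1 \<delta> in auto)

text \<open>The variance of the square of \<open>v\<close> is at most its second moment about the
  squared mean of \<open>v\<close>. There the difference of squares factors, and the sum of the two
  terms is at most \<open>4 * B\<close>.\<close>

lemma Vr_square_le:
  assumes sa: "s \<in> states M" "a \<in> actions M" and v: "\<And>y. y \<in> next_states M \<Longrightarrow> 0 \<le> v y \<and> v y \<le> 2 * B"
  shows "Pv M s a (\<lambda>y. (Pv M s a (\<lambda>y. (v y)\<^sup>2) - (v y)\<^sup>2)\<^sup>2) \<le> 16 * B\<^sup>2 * Vr s a v"
proof -
  let ?m = "Pv M s a v" and ?w = "\<lambda>y. (v y)\<^sup>2"
  have m: "0 \<le> ?m" "?m \<le> 2 * B"
    using Pv_ge_const[OF sa, of 0 v] Pv_le_const[OF sa, of v "2 * B"] v by auto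
  have "Pv M s a (\<lambda>y. (Pv M s a ?w - ?w y)\<^sup>2) = Pv M s a (\<lambda>y. (- Pv M s a ?w + ?w y)\<^sup>2)"
    by (intro Pv_cong) (simp add: power2_eq_square algebra_simps)
  also have "\<dots> = Vr s a ?w" using Pv_square_shift[OF sa, of "- Pv M s a ?w" ?w] by simp
  also have "\<dots> \<le> (- ?m\<^sup>2 + Pv M s a ?w)\<^sup>2 + Vr s a ?w" by simp
  also have "\<dots> = Pv M s a (\<lambda>y. (- ?m\<^sup>2 + ?w y)\<^sup>2)" by (rule Pv_square_shift[OF sa, symmetric])
  also have "\<dots> \<le> Pv M s a (\<lambda>y. 16 * B\<^sup>2 * (- ?m + v y)\<^sup>2)"
  proof (rule Pv_mono)
    fix y assume y: "y \<in> next_states M"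
    have "(- ?m\<^sup>2 + ?w y)\<^sup>2 = (?m + v y)\<^sup>2 * (- ?m + v y)\<^sup>2"
      by (simp add: power2_eq_square algebra_simps)
    also have "\<dots> \<le> (4 * B)\<^sup>2 * (- ?m + v y)\<^sup>2"
      using m v[OF y] by (intro mult_right_mono power_mono) auto
    finally show "(- ?m\<^sup>2 + ?w y)\<^sup>2 \<le> 16 * B\<^sup>2 * (- ?m + v y)\<^sup>2" by (simp add: power_mult_distrib)
  qed
  also have "\<dots> = 16 * B\<^sup>2 * Vr s a v" unfolding Pv_cmult using Pv_square_shift[OF sa, of "- ?m" v] by simp
  finally show ?thesis .
qed

text \<open>A single scale is enough, because half of \<open>ZZ\<close> is allowed on the right: for
  \<open>\<beta> = 1 / (32 * B\<^sup>2)\<close> the compensator equals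
  \<open>\<beta> * (ZZ h / 2)\<close>.\<close>

lemma square_martingale_event:
  "prob_ever (\<lambda>h. good_hist M h \<and>
     \<not> sumh (\<lambda>h x. trP x (\<lambda>y. (Xc h y)\<^sup>2) - (Xc h (nxt x))\<^sup>2) h \<le>
       ZZ h / 2 + 32 * B\<^sup>2 * ln (1 / \<delta>)) \<le> \<delta>"
proof -
  define \<beta> where "\<beta> = 1 / (32 * B\<^sup>2)"
  have B2: "0 < B\<^sup>2" using B1 by simp
  define F where "F = (\<lambda>h x. \<beta> * (trP x (\<lambda>y. (Xc h y)\<^sup>2) - (Xc h (nxt x))\<^sup>2) - \<beta>\<^sup>2 * (16 * B\<^sup>2 * trV x (Xc h)))"
  have "prob_ever (\<lambda>h. 1 / \<delta> \<le> (if good_hist M h then exp (sumh F h) else 0)) \<le> \<delta>"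
  proof (rule maximal_inequality_single)
    fix h assume h: "good_hist M h"
    note sa = cur_in_states[OF h] act_in_actions[OF h]
    have "stepE (\<lambda>h. if good_hist M h then exp (sumh F h) else 0) h \<le> exp (sumh F h) * Pcur h (\<lambda>y. exp (F h (cur_tr h y)))"
      unfolding stepE_eq[OF h] Pv_cmult[symmetric] by (rule Pv_mono) (simp add: exp_add)
    also have "\<dots> \<le> exp (sumh F h) * 1"
    proof (rule mult_left_mono)
      have "Pcur h (\<lambda>y. exp (\<beta> * (Pcur h (\<lambda>y. (Xc h y)\<^sup>2) - (Xc h y)\<^sup>2) - \<beta>\<^sup>2 * (16 * B\<^sup>2 * Vr (cur h) (act h) (Xc h)))) \<le> 1"
      proof (rule Pcur_exp_predictable[OF h, of "\<lambda>y. Pcur h (\<lambda>y. (Xc h y)\<^sup>2) - (Xc h y)\<^sup>2" "4 * B\<^sup>2"])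
        have sq: "0 \<le> (Xc h y)\<^sup>2 \<and> (Xc h y)\<^sup>2 \<le> 4 * B\<^sup>2" if "y \<in> next_states M" for y
          using power_mono[of "Xc h y" "2 * B" 2] Xc_bounds[OF that, of h] by (simp add: power_mult_distrib)
        fix y assume y: "y \<in> next_states M"
        have "0 \<le> Pcur h (\<lambda>y. (Xc h y)\<^sup>2)" by (rule Pv_ge_const[OF sa]) simp
        moreover have "Pcur h (\<lambda>y. (Xc h y)\<^sup>2) \<le> 4 * B\<^sup>2" by (rule Pv_le_const[OF sa]) (use sq in simp)
        ultimately show "\<bar>Pcur h (\<lambda>y. (Xc h y)\<^sup>2) - (Xc h y)\<^sup>2\<bar> \<le> 4 * B\<^sup>2" using sq[OF y] by linarith
      next
        show "Pcur h (\<lambda>y. (Pcur h (\<lambda>y. (Xc h y)\<^sup>2) - (Xc h y)\<^sup>2)\<^sup>2) \<le> 16 * B\<^sup>2 * Vr (cur h) (act h) (Xc h)"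
          by (rule Vr_square_le[OF sa]) (rule Xc_bounds)
      qed (use B2 sa in \<open>auto simp: \<beta>_def Pv_diff Pv_const\<close>)
      then show "Pcur h (\<lambda>y. exp (F h (cur_tr h y))) \<le> 1" by (simp add: F_def)
    qed simp
    finally show "stepE (\<lambda>h. if good_hist M h then exp (sumh F h) else 0) h \<le> (if good_hist M h then exp (sumh F h) else 0)"
      using h by simp
  qed (use \<delta> in auto)
  moreover have "prob_ever (\<lambda>h. good_hist M h \<and>
     \<not> sumh (\<lambda>h x. trP x (\<lambda>y. (Xc h y)\<^sup>2) - (Xc h (nxt x))\<^sup>2) h \<le>
       ZZ h / 2 + 32 * B\<^sup>2 * ln (1 / \<delta>))
    \<le> prob_ever (\<lambda>h. 1 / \<delta> \<le> (if good_hist M h then exp (sumh F h) else 0))"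
  proof (rule measure_bad_mono, elim conjE)
    fix h assume h: "good_hist M h"
    let ?S = "sumh (\<lambda>h x. trP x (\<lambda>y. (Xc h y)\<^sup>2) - (Xc h (nxt x))\<^sup>2) h"
    assume "\<not> ?S \<le> ZZ h / 2 + 32 * B\<^sup>2 * ln (1 / \<delta>)"
    then have "\<beta> * (ZZ h / 2 + 32 * B\<^sup>2 * ln (1 / \<delta>)) \<le> \<beta> * ?S"
      using B2 by (intro mult_left_mono) (auto simp: \<beta>_def)
    moreover have "\<beta> * (32 * B\<^sup>2 * ln (1 / \<delta>)) = ln (1 / \<delta>)" using B2 by (simp add: \<beta>_def)
    moreover have "\<beta>\<^sup>2 * (16 * B\<^sup>2 * ZZ h) = \<beta> * (ZZ h / 2)" using B2 by (simp add: \<beta>_def power2_eq_square)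
    moreover have "sumh F h = \<beta> * ?S - \<beta>\<^sup>2 * (16 * B\<^sup>2 * ZZ h)"
      unfolding F_def ZZ_def sumh_diff[of "\<lambda>h x. \<beta> * (trP x (\<lambda>y. (Xc h y)\<^sup>2) - (Xc h (nxt x))\<^sup>2)"] sumh_cmult ..
    ultimately have "ln (1 / \<delta>) \<le> sumh F h" unfolding distrib_left[of \<beta>] by linarith
    then have "exp (ln (1 / \<delta>)) \<le> exp (sumh F h)" by (simp only: exp_le_cancel_iff)
    moreover have "exp (ln (1 / \<delta>)) = 1 / \<delta>" using \<delta> by (intro exp_ln) simp
    ultimately show "1 / \<delta> \<le> (if good_hist M h then exp (sumh F h) else 0)" using h by simp
  qed
  ultimately show ?thesis by linarith
qed

text \<open>With this \<open>\<theta>\<close> the factor \<open>1 + \<theta> * H h\<close> of the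
  supermartingale lies between 1 and 2. Hence its expected decrease by \<open>\<theta> * v\<close>,
  with \<open>v\<close> the current variance, is a relative decrease of at least
  \<open>\<theta> * v / 2\<close>, which compensates the growth of half of
  \<open>YY\<close>.\<close>

lemma variance_event:
  assumes R: "0 < Rmax M"
  shows "prob_ever (\<lambda>h. good_hist M h \<and>
     \<not> YY h / 2 \<le> SG h + 2 * (R_bound M)\<^sup>2 * real (nep h)
       + 18 * (Rmax M)\<^sup>2 * ln (2 / \<delta>)) \<le> \<delta>"
proof -
  define \<theta> where "\<theta> = 1 / (18 * (Rmax M)\<^sup>2)"
  have \<theta>: "0 < \<theta>" using R by (simp add: \<theta>_def)
  define E where "E h = \<theta> * (YY h / 2 - SG h - 2 * (R_bound M)\<^sup>2 * real (nep h))" for h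
  define H where "H h = Hm (Some (cur h)) (Ccur h) (Acur h)" for h
  define W where "W h = exp (E h) * (1 + \<theta> * H h) / 2" for h
  have Hb: "0 \<le> \<theta> * Hm y c A" "\<theta> * Hm y c A \<le> 1" if "y \<in> next_states M" for y c A
  proof -
    show "0 \<le> \<theta> * Hm y c A" using Hm_nonneg[OF that] \<theta> by simp
    have "\<theta> * Hm y c A \<le> \<theta> * (18 * (Rmax M)\<^sup>2)" using Hm_bound[OF that] \<theta> by (intro mult_left_mono) auto
    then show "\<theta> * Hm y c A \<le> 1" using R by (simp add: \<theta>_def)
  qed
  have "prob_ever (\<lambda>h. 1 / \<delta> \<le> W h) \<le> \<delta>"
  proof (rule maximal_inequality_single)
    fix h assume h: "good_hist M h"
    note sa = cur_in_states[OF h] act_in_actions[OF h]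
    have H: "0 \<le> \<theta> * H h" "\<theta> * H h \<le> 1" unfolding H_def by (rule Hb; use sa in simp)+
    show "0 \<le> W h" using H by (simp add: W_def)
    define g where "g = adv (cur h) (act h)"
    define v where "v = Vr (cur h) (act h) Vs"
    define x where "x = 4 * g * (Acur h + g)"
    have g: "0 \<le> g" unfolding g_def by (rule adv_nonneg[OF sa])
    have A: "0 \<le> Acur h" by (rule Acur_nonneg[OF h])
    have x: "0 \<le> x" using g A by (simp add: x_def)
    have v: "0 \<le> v" unfolding v_def by (rule Vr_nonneg[OF sa])
    define e where "e = E h + \<theta> * (v / 2 - x)"
    have step: "W (h @ [cur_tr h y]) \<le> exp e / 2 * (1 + \<theta> * Hm y (Ccur h + rew M (cur h) (act h)) (Acur h + g))"
      if y: "y \<in> next_states M" for y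
    proof (cases y)
      \<comment> \<open>A new episode lifts the potential from zero to at most twice the square of
        \<open>R_bound M\<close>; the term with \<open>nep\<close> pays for it.\<close>
      case None
      have E: "E (h @ [cur_tr h y]) = e - \<theta> * (2 * (R_bound M)\<^sup>2)"
        by (simp add: None E_def e_def YY_def SG_def x_def v_def g_def algebra_simps)
      have "H (h @ [cur_tr h y]) \<le> 2 * (R_bound M)\<^sup>2"
        using Hm_init_le by (simp add: None H_def Ccur_def Acur_def)
      then have "1 + \<theta> * H (h @ [cur_tr h y]) \<le> 1 + \<theta> * (2 * (R_bound M)\<^sup>2)"
        using \<theta> by (intro add_left_mono mult_left_mono) auto
      also have "\<dots> \<le> exp (\<theta> * (2 * (R_bound M)\<^sup>2))" by (rule exp_ge_add_one_self)
      finally have "W (h @ [cur_tr h y]) \<le> exp (e - \<theta> * (2 * (R_bound M)\<^sup>2)) * exp (\<theta> * (2 * (R_bound M)\<^sup>2)) / 2"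
        unfolding W_def E by (intro divide_right_mono mult_left_mono) auto
      also have "\<dots> = exp e / 2" by (simp flip: exp_add)
      finally show ?thesis by (simp add: None)
    next
      case (Some s)
      have "E (h @ [cur_tr h y]) = e"
        by (simp add: Some E_def e_def YY_def SG_def x_def v_def g_def algebra_simps)
      moreover have "H (h @ [cur_tr h y]) = Hm y (Ccur h + rew M (cur h) (act h)) (Acur h + g)"
        by (simp add: Some H_def Ccur_def Acur_def g_def)
      ultimately show ?thesis by (simp add: W_def)
    qed
    have "stepE W h \<le> Pcur h (\<lambda>y. exp e / 2 * (1 + \<theta> * Hm y (Ccur h + rew M (cur h) (act h)) (Acur h + g)))"
      unfolding stepE_eq[OF h] by (rule Pv_mono) (rule step)
    also have "\<dots> = exp e / 2 * (1 + \<theta> * Pcur h (\<lambda>y. Hm y (Ccur h + rew M (cur h) (act h)) (Acur h + g)))"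
      by (simp only: Pv_cmult Pv_add_const[OF sa])
    also have "\<dots> \<le> exp e / 2 * (1 + \<theta> * (H h + x - v))"
      using Hm_step[OF sa A, of "Ccur h"] \<theta>
      by (intro mult_left_mono add_left_mono) (auto simp: H_def x_def v_def g_def)
    also have "\<dots> \<le> exp e / 2 * ((1 + \<theta> * H h) * exp (\<theta> * (x - v / 2)))"
    proof (rule mult_left_mono)
      define u where "u = 1 + \<theta> * H h"
      have u: "1 \<le> u" "u \<le> 2" using H by (auto simp: u_def)
      have tv: "0 \<le> \<theta> * v" and tx: "0 \<le> \<theta> * x" using \<theta> v x by simp_all
      have "u * (1 + \<theta> * (x - v / 2)) = u + u * (\<theta> * x) - (u / 2) * (\<theta> * v)" by (simp add: algebra_simps)
      moreover have "1 * (\<theta> * x) \<le> u * (\<theta> * x)" using u tx by (intro mult_right_mono) auto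
      moreover have "(u / 2) * (\<theta> * v) \<le> 1 * (\<theta> * v)" using u tv by (intro mult_right_mono) auto
      ultimately have "u + \<theta> * x - \<theta> * v \<le> u * (1 + \<theta> * (x - v / 2))" by linarith
      also have "\<dots> \<le> u * exp (\<theta> * (x - v / 2))" using u by (intro mult_left_mono exp_ge_add_one_self) auto
      finally show "1 + \<theta> * (H h + x - v) \<le> (1 + \<theta> * H h) * exp (\<theta> * (x - v / 2))"
        by (simp add: u_def algebra_simps)
    qed simp
    also have "\<dots> = W h"
    proof -
      have "exp e * exp (\<theta> * (x - v / 2)) = exp (E h)" by (simp add: e_def algebra_simps flip: exp_add)
      then show ?thesis by (simp add: W_def)
    qed
    finally show "stepE W h \<le> W h" .
  next
    have "\<theta> * H [] \<le> 1" unfolding H_def by (rule Hb) simp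
    then show "W [] \<le> 1" by (simp add: W_def E_def YY_def SG_def)
  qed (use \<delta> in auto)
  moreover have "prob_ever (\<lambda>h. good_hist M h \<and>
     \<not> YY h / 2 \<le> SG h + 2 * (R_bound M)\<^sup>2 * real (nep h)
       + 18 * (Rmax M)\<^sup>2 * ln (2 / \<delta>)) \<le> prob_ever (\<lambda>h. 1 / \<delta> \<le> W h)"
  proof (rule measure_bad_mono, elim conjE)
    fix h assume h: "good_hist M h"
    assume "\<not> YY h / 2 \<le> SG h + 2 * (R_bound M)\<^sup>2 * real (nep h) + 18 * (Rmax M)\<^sup>2 * ln (2 / \<delta>)"
    then have "\<theta> * (18 * (Rmax M)\<^sup>2 * ln (2 / \<delta>)) \<le> E h"
      unfolding E_def using \<theta> by (intro mult_left_mono) auto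
    then have "ln (2 / \<delta>) \<le> E h" using R by (simp add: \<theta>_def)
    then have "exp (ln (2 / \<delta>)) \<le> exp (E h)" by (simp only: exp_le_cancel_iff)
    moreover have "exp (ln (2 / \<delta>)) = 2 / \<delta>" using \<delta> by (intro exp_ln) simp
    moreover have "exp (E h) * 1 \<le> exp (E h) * (1 + \<theta> * H h)"
      using Hb(1)[of "Some (cur h)"] cur_in_states[OF h] by (intro mult_left_mono) (auto simp: H_def)
    ultimately have "2 / \<delta> \<le> exp (E h) * (1 + \<theta> * H h)" by linarith
    then show "1 / \<delta> \<le> W h" by (simp add: W_def)
  qed
  ultimately show ?thesis by linarith
qed

text \<open>For episode \<open>k\<close>, counted from 0, \<open>W k\<close> is 1 before the
  episode, follows \<open>exp (\<theta> * Acur h)\<close> during it and is 0 afterwards. The factor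
  \<open>u\<close> lies between 1 and 2, so its expected decrease of \<open>2 * \<theta> * g\<close>
  is a relative decrease of at least \<open>\<theta> * g\<close> and balances the exponential. The
  thresholds handle all \<open>k\<close> at once.\<close>

lemma gap_event:
  assumes R: "0 < Rmax M"
  shows "prob_ever (\<lambda>h. good_hist M h \<and>
     \<not> Acur h \<le> 4 * Rmax M *
        ln (2 * (real (nep h + 1) * real (nep h + 2) / \<delta>))) \<le> \<delta>"
proof -
  define \<theta> where "\<theta> = 1 / (4 * Rmax M)"
  have \<theta>: "0 < \<theta>" using R by (simp add: \<theta>_def)
  define u where "u y = 1 + 2 * \<theta> * gappot y" for y
  have u: "1 \<le> u y" "u y \<le> 2" if "y \<in> next_states M" for y
  proof -
    show "1 \<le> u y" using gappot_nonneg[OF that] \<theta> by (simp add: u_def)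
    have "2 * \<theta> * gappot y \<le> 2 * \<theta> * (2 * Rmax M)" using gappot_le[OF that] \<theta> by (intro mult_left_mono) auto
    then show "u y \<le> 2" using R by (simp add: u_def \<theta>_def)
  qed
  define W where "W k h = (if nep h < k then 1 else if nep h = k then exp (\<theta> * Acur h) * u (Some (cur h)) / 2 else 0)" for k h
  have "measure space_meas {\<omega>. \<exists>k n. real (k + 1) * real (k + 2) / \<delta> \<le> W k (prefix_of \<omega> n)} \<le> \<delta>"
    unfolding interaction_def
  proof (rule maximal_inequality_family)
    fix k h assume h: "good_hist M h"
    note sa = cur_in_states[OF h] act_in_actions[OF h]
    have ucur: "1 \<le> u (Some (cur h))" using u(1) sa by simp
    then show "0 \<le> W k h" by (simp add: W_def)
    show "stepE (W k) h \<le> W k h"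
    proof (cases "nep h = k")
      case True
      define g where "g = adv (cur h) (act h)"
      have g: "0 \<le> g" unfolding g_def by (rule adv_nonneg[OF sa])
      have "stepE (W k) h \<le> Pcur h (\<lambda>y. exp (\<theta> * (Acur h + g)) / 2 * (1 + 2 * \<theta> * gappot y))"
        unfolding stepE_eq[OF h]
      proof (rule Pv_mono)
        fix y assume y: "y \<in> next_states M"
        show "W k (h @ [cur_tr h y]) \<le> exp (\<theta> * (Acur h + g)) / 2 * (1 + 2 * \<theta> * gappot y)"
          by (cases y) (auto simp: W_def True Acur_def g_def u_def)
      qed
      also have "\<dots> = exp (\<theta> * (Acur h + g)) / 2 * (1 + 2 * \<theta> * Pcur h gappot)"
        by (simp only: Pv_cmult Pv_add_const[OF sa])
      also have "\<dots> \<le> exp (\<theta> * (Acur h + g)) / 2 * (u (Some (cur h)) - 2 * \<theta> * g)"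
        using gappot_step[OF sa] mult_left_mono[of "Pcur h gappot" "gappot (Some (cur h)) - g" "2 * \<theta>"] \<theta>
        by (intro mult_left_mono) (auto simp: u_def g_def algebra_simps)
      also have "\<dots> \<le> exp (\<theta> * (Acur h + g)) / 2 * (u (Some (cur h)) * exp (- (\<theta> * g)))"
      proof (rule mult_left_mono)
        have "u (Some (cur h)) * (\<theta> * g) \<le> 2 * (\<theta> * g)"
          using u(2)[of "Some (cur h)"] sa \<theta> g by (intro mult_right_mono) auto
        then have "u (Some (cur h)) - 2 * \<theta> * g \<le> u (Some (cur h)) * (1 + - (\<theta> * g))" by (simp add: algebra_simps)
        also have "\<dots> \<le> u (Some (cur h)) * exp (- (\<theta> * g))"
          using ucur by (intro mult_left_mono exp_ge_add_one_self) auto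
        finally show "u (Some (cur h)) - 2 * \<theta> * g \<le> u (Some (cur h)) * exp (- (\<theta> * g))" .
      qed simp
      also have "\<dots> = W k h"
      proof -
        have "exp (\<theta> * (Acur h + g)) * exp (- (\<theta> * g)) = exp (\<theta> * Acur h)" by (simp add: algebra_simps flip: exp_add)
        then show ?thesis by (simp add: W_def True)
      qed
      finally show ?thesis .
    next
      case False
      have "W k (h @ [cur_tr h y]) \<le> W k h" for y
        using False u(2)[of "Some (s_init M)"] by (cases y) (auto simp: W_def Acur_def)
      then have "stepE (W k) h \<le> Pcur h (\<lambda>_. W k h)" unfolding stepE_eq[OF h] by (intro Pv_mono)
      then show ?thesis by (simp add: Pv_const[OF sa])
    qed
  next
    fix k
    show "W k [] \<le> 1" using u(2)[of "Some (s_init M)"] by (simp add: W_def Acur_def)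
  qed (rule \<delta>)
  also have "{\<omega>. \<exists>k n. real (k + 1) * real (k + 2) / \<delta> \<le> W k (prefix_of \<omega> n)} =
      {\<omega>. \<exists>n. \<exists>k. real (k + 1) * real (k + 2) / \<delta> \<le> W k (prefix_of \<omega> n)}" by blast
  finally have le: "prob_ever (\<lambda>h. \<exists>k. real (k + 1) * real (k + 2) / \<delta> \<le> W k h) \<le> \<delta>" .
  have "prob_ever (\<lambda>h. good_hist M h \<and>
     \<not> Acur h \<le> 4 * Rmax M *
        ln (2 * (real (nep h + 1) * real (nep h + 2) / \<delta>))) \<le>
     prob_ever (\<lambda>h. \<exists>k. real (k + 1) * real (k + 2) / \<delta> \<le> W k h)"
  proof (rule measure_bad_mono, elim conjE)
    fix h assume h: "good_hist M h"
    define q where "q = real (nep h + 1) * real (nep h + 2) / \<delta>"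
    have q: "0 < q" using \<delta> by (simp add: q_def)
    assume "\<not> Acur h \<le> 4 * Rmax M * ln (2 * (real (nep h + 1) * real (nep h + 2) / \<delta>))"
    then have "\<theta> * (4 * Rmax M * ln (2 * q)) \<le> \<theta> * Acur h"
      unfolding q_def using \<theta> by (intro mult_left_mono) auto
    then have "ln (2 * q) \<le> \<theta> * Acur h" using R by (simp add: \<theta>_def)
    then have "exp (ln (2 * q)) \<le> exp (\<theta> * Acur h)" by (simp only: exp_le_cancel_iff)
    moreover have "exp (ln (2 * q)) = 2 * q" using q by (intro exp_ln) simp
    moreover have "exp (\<theta> * Acur h) * 1 \<le> exp (\<theta> * Acur h) * u (Some (cur h))"
      using u(1)[of "Some (cur h)"] cur_in_states[OF h] by (intro mult_left_mono) auto
    ultimately have "2 * q \<le> exp (\<theta> * Acur h) * u (Some (cur h))" by linarith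
    then have "q \<le> W (nep h) h" by (simp add: W_def)
    then show "\<exists>k. real (k + 1) * real (k + 2) / \<delta> \<le> W k h" unfolding q_def by blast
  qed
  with le show ?thesis by linarith
qed

end

context vi_run
begin

section \<open>The favourable event and its probability\<close>

definition nX :: real where "nX = real (card (next_states M))"

lemma nX_eq: "nX = real (card (states M)) + 1"
  by (simp add: nX_def next_states_def card_image)

lemma nX_ge: "1 \<le> nX" and nX_le: "nX \<le> 2 * real (card (states M))"
  using card_pos by (auto simp: nX_eq)

text \<open>Zero at an unvisited pair, by the convention for division by zero.\<close>

definition kap :: "('s, 'a) transition list \<Rightarrow> 's \<Rightarrow> 'a \<Rightarrow> real" where
  "kap h s a = io (N h s a) / real (N h s a)"

lemma kap_nonneg: "0 \<le> kap h s a"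
  using io_ge[of "N h s a"] by (simp add: kap_def)

definition deviation_at :: "('s, 'a) transition list \<Rightarrow> 's \<Rightarrow> 'a \<Rightarrow> bool" where
  "deviation_at h s a \<longleftrightarrow> (0 < N h s a \<longrightarrow>
     Eb h s a Vs - Pv M s a Vs \<le> 11 * (sqrt (Vr s a Vs * kap h s a) + 2 * B * kap h s a))"

text \<open>Controls all functions of the next state simultaneously, including those chosen by the
  data.\<close>

definition frequency_at :: "('s, 'a) transition list \<Rightarrow> 's \<Rightarrow> 'a \<Rightarrow> 's option \<Rightarrow> bool" where
  "frequency_at h s a y \<longleftrightarrow> (0 < N h s a \<longrightarrow>
     \<bar>Pb h s a y - pmf (trans M s a) y\<bar> \<le> 33 * (sqrt (pmf (trans M s a) y * kap h s a) + kap h s a))"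

definition nice_at :: "('s, 'a) transition list \<Rightarrow> bool" where
  "nice_at h \<longleftrightarrow> optimistic_at h \<and>
     (\<forall>s\<in>states M. \<forall>a\<in>actions M. deviation_at h s a) \<and>
     (\<forall>s\<in>states M. \<forall>a\<in>actions M. \<forall>y\<in>next_states M. frequency_at h s a y) \<and>
     sumh (\<lambda>h x. trP x Vs - Vs (nxt x)) h \<le> 11 * (sqrt (YY h * io (len1 h)) + 2 * B * io (len1 h)) \<and>
     sumh (\<lambda>h x. trP x (Xc h) - Xc h (nxt x)) h \<le> 11 * (sqrt (ZZ h * io (len1 h)) + 2 * B * io (len1 h)) \<and>
     sumh (\<lambda>h x. trP x (\<lambda>y. (Xc h y)\<^sup>2) - (Xc h (nxt x))\<^sup>2) h \<le> ZZ h / 2 + 32 * B\<^sup>2 * ln (1 / \<delta>) \<and>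
     YY h / 2 \<le> SG h + 2 * (R_bound M)\<^sup>2 * real (nep h) + 18 * (Rmax M)\<^sup>2 * ln (2 / \<delta>) \<and>
     Acur h \<le> 4 * Rmax M * ln (2 * (real (nep h + 1) * real (nep h + 2) / \<delta>))"

lemma SA_card: "real (card (states M \<times> actions M)) * (\<delta> / SA) = \<delta>"
  using card_pos by (auto simp: SA_def card_cartesian_product)

lemma prob_not_optimistic:
  "prob_ever (\<lambda>h. good_hist M h \<and> \<not> optimistic_at h) \<le> \<delta>"
proof -
  let ?bad = "\<lambda>(s, a) h. good_hist M h \<and> 0 < N h s a \<and> \<not> Pv M s a Vs \<le> Eb h s a Vs + bonus h s a Vs"
  have "prob_ever (\<lambda>h. good_hist M h \<and> \<not> optimistic_at h) \<le>
      prob_ever (\<lambda>h. \<exists>sa\<in>states M \<times> actions M. ?bad sa h)"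
    by (rule measure_bad_mono) (force simp: optimistic_at_def)
  also have "\<dots> \<le> real (card (states M \<times> actions M)) * (\<delta> / SA)"
  proof (rule measure_bad_UN)
    fix sa assume "sa \<in> states M \<times> actions M"
    then obtain s a where sa: "sa = (s, a)" "s \<in> states M" "a \<in> actions M" by blast
    show "prob_ever (\<lambda>h. ?bad sa h) \<le> \<delta> / SA"
      unfolding sa(1) prod.case by (rule optimism_event[OF sa(2,3)])
  qed simp
  finally show ?thesis unfolding SA_card .
qed

lemma prob_not_deviation:
  "prob_ever (\<lambda>h. good_hist M h \<and> \<not> (\<forall>s\<in>states M. \<forall>a\<in>actions M. deviation_at h s a)) \<le> \<delta>"
proof -
  let ?bad = "\<lambda>(s, a) h. good_hist M h \<and> \<not> deviation_at h s a"
  have "prob_ever (\<lambda>h. good_hist M h \<and> \<not> (\<forall>s\<in>states M. \<forall>a\<in>actions M. deviation_at h s a)) \<le>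
      prob_ever (\<lambda>h. \<exists>sa\<in>states M \<times> actions M. ?bad sa h)"
    by (rule measure_bad_mono) force
  also have "\<dots> \<le> real (card (states M \<times> actions M)) * (\<delta> / SA)"
  proof (rule measure_bad_UN)
    fix sa assume "sa \<in> states M \<times> actions M"
    then obtain s a where sa: "sa = (s, a)" and s: "s \<in> states M" and a: "a \<in> actions M" by blast
    have Vd: "\<bar>Vs y - Pv M s a Vs\<bar> \<le> 2 * B" if "y \<in> next_states M" for y
      using Pv_abs_le[OF s a, of Vs B] Vs_abs_le_B Vs_abs_le_B[OF that] by fastforce
    have l: "1 \<le> ln (1 / (\<delta> / SA))" using ln_delta ln_delta_le by linarith
    have "prob_ever (\<lambda>h. ?bad sa h) \<le>
      prob_ever (\<lambda>h. good_hist M h \<and> (0 < N h s a \<and>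
     \<not> Eb h s a Vs - Pv M s a Vs \<le>
      11 * (sqrt (Vr s a Vs * (ln (1 / (\<delta> / SA)) + ln (ln1 (real (N h s a)))) / real (N h s a))
        + 2 * B * (ln (1 / (\<delta> / SA)) + ln (ln1 (real (N h s a)))) / real (N h s a))))"
      unfolding sa prod.case
    proof (rule measure_bad_mono, elim conjE, intro conjI)
      fix h assume "\<not> deviation_at h s a"
      then have Np: "0 < N h s a" and bad: "\<not> Eb h s a Vs - Pv M s a Vs \<le> 11 * (sqrt (Vr s a Vs * kap h s a) + 2 * B * kap h s a)"
        by (auto simp: deviation_at_def)
      show "0 < N h s a" by (rule Np)
      let ?n = "real (N h s a)"
      let ?L = "ln (1 / (\<delta> / SA)) + ln (ln1 ?n)"
      have "?L \<le> io (N h s a)" using Np by (intro L_le_io) simp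
      then have Lk: "?L / ?n \<le> kap h s a" unfolding kap_def by (intro divide_right_mono) auto
      have "11 * (sqrt (Vr s a Vs * (?L / ?n)) + 2 * B * (?L / ?n)) \<le> 11 * (sqrt (Vr s a Vs * kap h s a) + 2 * B * kap h s a)"
        using Lk Vr_nonneg[OF s a, of Vs] B1 by (intro mult_left_mono add_mono real_sqrt_le_mono) auto
      then show "\<not> Eb h s a Vs - Pv M s a Vs \<le> 11 * (sqrt (Vr s a Vs * ?L / ?n) + 2 * B * ?L / ?n)"
        using bad by simp
    qed
    also have "\<dots> \<le> \<delta> / SA"
      by (rule deviation_event[OF s a _ Vd dSA l]) (use B1 in auto)
    finally show "prob_ever (\<lambda>h. ?bad sa h) \<le> \<delta> / SA" .
  qed simp
  finally show ?thesis unfolding SA_card .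
qed

lemma Pv_indicator: "y \<in> next_states M \<Longrightarrow> Pv M s a (indicat_real {y}) = pmf (trans M s a) y"
  by (simp add: Pv_def expect_def indicator_def)

lemma Eb_indicator: "y \<in> next_states M \<Longrightarrow> Eb h s a (indicat_real {y}) = Pb h s a y"
  by (simp add: Eb_def expect_def indicator_def)

text \<open>The confidence is split further over the next states. As \<open>nX\<close> is at most
  \<open>2 * (SA / \<delta>)\<close>, the logarithm at most triples, which turns 11 into 33. The
  variance of an indicator is at most its mean, whence the probability under the root.\<close>

lemma frequency_one_sided:
  assumes s: "s \<in> states M" and a: "a \<in> actions M" and y: "y \<in> next_states M" and \<sigma>: "\<sigma> = 1 \<or> \<sigma> = - (1::real)"
  shows "prob_ever (\<lambda>h. good_hist M h \<and> 0 < N h s a \<and>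
     \<not> \<sigma> * (Pb h s a y - pmf (trans M s a) y) \<le>
       33 * (sqrt (pmf (trans M s a) y * kap h s a) + kap h s a)) \<le> \<delta> / (SA * nX)"
proof -
  let ?p = "pmf (trans M s a) y" and ?d = "\<delta> / (SA * nX)" and ?g = "\<lambda>z. \<sigma> * indicat_real {y} z"
  have Pg: "Pv M s a ?g = \<sigma> * ?p" using y by (simp add: Pv_cmult Pv_indicator)
  have p01: "0 \<le> ?p" "?p \<le> 1" by (auto simp: pmf_le_1)
  have gd: "\<bar>?g z - Pv M s a ?g\<bar> \<le> 1" for z
    unfolding Pg using \<sigma> p01 by (auto simp: indicator_def)
  have SAn: "1 \<le> SA * nX" using mult_mono[OF SA_ge nX_ge] SA_ge by simp
  have d: "0 < ?d" "?d \<le> 1" using \<delta> SAn by (auto simp: field_simps)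
  have l1: "ln (1 / ?d) \<le> 3 * ln (1 / (\<delta> / SA))"
  proof -
    have S: "nX \<le> 2 * (SA / \<delta>)"
    proof -
      have "real (card (states M)) * 1 \<le> SA" unfolding SA_def using card_pos by (intro mult_left_mono) auto
      moreover have "SA * 1 \<le> SA * (1 / \<delta>)" using SA_ge \<delta> by (intro mult_left_mono) (auto simp: field_simps)
      ultimately show ?thesis using nX_le by simp
    qed
    have pos: "0 < SA / \<delta>" using SA_ge \<delta> by simp
    have "1 / ?d = (SA / \<delta>) * nX" by simp
    also have "\<dots> \<le> (SA / \<delta>) * (2 * (SA / \<delta>))" using S pos by (intro mult_left_mono) auto
    finally have "ln (1 / ?d) \<le> ln ((SA / \<delta>) * (2 * (SA / \<delta>)))"
      by (rule ln_mono) (use d(1) in \<open>simp only: zero_less_divide_1_iff\<close>)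
    also have "\<dots> = ln 2 + 2 * ln (SA / \<delta>)" 
    proof -
      have "ln (q * (2 * q)) = ln 2 + 2 * ln q" if "0 < q" for q :: real
        using ln_mult[of q "2 * q"] ln_mult[of 2 q] that by simp
      then show ?thesis using pos by blast
    qed
    also have "\<dots> \<le> 3 * ln (1 / (\<delta> / SA))" using ln_2_less_1 ln_delta ln_delta_le by simp
    finally show ?thesis .
  qed
  have l2: "1 \<le> ln (1 / ?d)"
  proof -
    have "ln (1 / \<delta>) \<le> ln (1 / ?d)" using SAn \<delta> by (intro ln_mono) (auto simp: field_simps)
    then show ?thesis using ln_delta by linarith
  qed
  have Vrg: "Vr s a ?g \<le> ?p"
  proof -
    have "Pv M s a (\<lambda>z. (?g z)\<^sup>2) = Pv M s a (indicat_real {y})"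
      by (rule Pv_cong) (use \<sigma> in \<open>auto simp: indicator_def\<close>)
    then show ?thesis using y by (simp add: Vr_def Pv_indicator)
  qed
  have "prob_ever (\<lambda>h. good_hist M h \<and> 0 < N h s a \<and>
     \<not> \<sigma> * (Pb h s a y - ?p) \<le> 33 * (sqrt (?p * kap h s a) + kap h s a)) \<le>
    prob_ever (\<lambda>h. good_hist M h \<and> (0 < N h s a \<and>
     \<not> Eb h s a ?g - Pv M s a ?g \<le>
      11 * (sqrt (Vr s a ?g * (ln (1 / ?d) + ln (ln1 (real (N h s a)))) / real (N h s a))
        + 1 * (ln (1 / ?d) + ln (ln1 (real (N h s a)))) / real (N h s a))))"
  proof (rule measure_bad_mono, elim conjE, intro conjI)
    fix h assume Np: "0 < N h s a" and bad: "\<not> \<sigma> * (Pb h s a y - ?p) \<le> 33 * (sqrt (?p * kap h s a) + kap h s a)"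
    let ?n = "real (N h s a)"
    let ?L = "ln (1 / ?d) + ln (ln1 ?n)"
    have "?L \<le> 3 * (ln (1 / (\<delta> / SA)) + ln (ln1 ?n))" using l1 lnln1_nonneg[of ?n] by (simp only: distrib_left)
    also have "\<dots> \<le> 3 * io (N h s a)" using L_le_io[of "N h s a"] Np by simp
    finally have Lk: "?L / ?n \<le> 3 * kap h s a" unfolding kap_def using divide_right_mono[of ?L "3 * io (N h s a)" ?n] by simp
    have L0: "0 \<le> ?L / ?n" using l2 lnln1_nonneg[of ?n] by simp
    have "sqrt (Vr s a ?g * (?L / ?n)) \<le> sqrt (?p * (3 * kap h s a))"
      using Lk Vrg L0 p01 by (intro real_sqrt_le_mono mult_mono) auto
    also have "\<dots> \<le> sqrt (3\<^sup>2 * (?p * kap h s a))"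
      using p01 kap_nonneg[of h s a] by (intro real_sqrt_le_mono) (simp add: mult_right_mono)
    also have "\<dots> = 3 * sqrt (?p * kap h s a)" by (simp add: real_sqrt_mult)
    finally have "11 * (sqrt (Vr s a ?g * (?L / ?n)) + ?L / ?n) \<le> 33 * (sqrt (?p * kap h s a) + kap h s a)"
      using Lk unfolding distrib_left[of 11] distrib_left[of 33] by linarith
    moreover have "Eb h s a ?g - Pv M s a ?g = \<sigma> * (Pb h s a y - ?p)"
      using y by (simp add: Eb_cmult Eb_indicator Pg right_diff_distrib)
    ultimately show "\<not> Eb h s a ?g - Pv M s a ?g \<le> 11 * (sqrt (Vr s a ?g * ?L / ?n) + 1 * ?L / ?n)"
      using bad by simp
  qed
  also have "\<dots> \<le> ?d"
    by (rule deviation_event[OF s a zero_less_one gd d l2])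
  finally show ?thesis .
qed

lemma prob_not_frequency:
  "prob_ever (\<lambda>h. good_hist M h \<and>
     \<not> (\<forall>s\<in>states M. \<forall>a\<in>actions M. \<forall>y\<in>next_states M. frequency_at h s a y)) \<le> 2 * \<delta>"
proof -
  let ?I = "(states M \<times> actions M \<times> next_states M) \<times> {1, - (1::real)}"
  let ?bad = "\<lambda>((s, a, y), \<sigma>) h. good_hist M h \<and> 0 < N h s a \<and>
     \<not> \<sigma> * (Pb h s a y - pmf (trans M s a) y) \<le> 33 * (sqrt (pmf (trans M s a) y * kap h s a) + kap h s a)"
  have "prob_ever (\<lambda>h. good_hist M h \<and>
       \<not> (\<forall>s\<in>states M. \<forall>a\<in>actions M. \<forall>y\<in>next_states M. frequency_at h s a y)) \<le>
      prob_ever (\<lambda>h. \<exists>i\<in>?I. ?bad i h)"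
  proof (rule measure_bad_mono)
    fix h assume "good_hist M h \<and> \<not> (\<forall>s\<in>states M. \<forall>a\<in>actions M. \<forall>y\<in>next_states M. frequency_at h s a y)"
    then obtain s a y where h: "good_hist M h" and sa: "s \<in> states M" "a \<in> actions M" "y \<in> next_states M"
      and nf: "\<not> frequency_at h s a y" by blast
    let ?d = "Pb h s a y - pmf (trans M s a) y" and ?b = "33 * (sqrt (pmf (trans M s a) y * kap h s a) + kap h s a)"
    have Np: "0 < N h s a" and "\<not> \<bar>?d\<bar> \<le> ?b" using nf by (auto simp: frequency_at_def)
    then have "\<not> 1 * ?d \<le> ?b \<or> \<not> - 1 * ?d \<le> ?b" unfolding abs_le_iff by simp
    then have "?bad ((s, a, y), 1) h \<or> ?bad ((s, a, y), - 1) h"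
      using h Np by simp
    then show "\<exists>i\<in>?I. ?bad i h" using sa by blast
  qed
  also have "\<dots> \<le> real (card ?I) * (\<delta> / (SA * nX))"
  proof (rule measure_bad_UN)
    fix i assume "i \<in> ?I"
    then obtain s a y \<sigma> where i: "i = ((s, a, y), \<sigma>)" and sa: "s \<in> states M" "a \<in> actions M" "y \<in> next_states M"
      and \<sigma>: "\<sigma> = 1 \<or> \<sigma> = - (1::real)" by blast
    show "prob_ever (\<lambda>h. ?bad i h) \<le> \<delta> / (SA * nX)"
      unfolding i prod.case by (rule frequency_one_sided[OF sa \<sigma>])
  qed simp
  also have "real (card ?I) * (\<delta> / (SA * nX)) = 2 * \<delta>"
  proof -
    have eq: "real (card ?I) = 2 * (SA * nX)" by (simp add: card_cartesian_product SA_def nX_def)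
    have "SA \<noteq> 0" "nX \<noteq> 0" using SA_ge nX_ge by auto
    then show ?thesis unfolding eq by simp
  qed
  finally show ?thesis .
qed

text \<open>The nine consists of two for the frequencies and one each for optimism, deviations of
  \<open>Vs\<close>, two linear martingales, the squares, the variances and the gaps.\<close>

lemma prob_not_nice:
  assumes R: "0 < Rmax M"
  shows "prob_ever (\<lambda>h. good_hist M h \<and> \<not> nice_at h) \<le> 9 * \<delta>"
proof -
  have Vd: "Vs y - Vs y' \<le> 2 * B" if "y \<in> next_states M" "y' \<in> next_states M" for y y'
    using Vs_abs_le_B[OF that(1)] Vs_abs_le_B[OF that(2)] by linarith
  have Va: "\<bar>Vs y\<bar> \<le> 2 * B" if "y \<in> next_states M" for y
    using Vs_abs_le_B[OF that] B1 by linarith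
  have Xd: "Xc h y - Xc h y' \<le> 2 * B" if "y \<in> next_states M" "y' \<in> next_states M" for h y y'
    using Xc_bounds[OF that(1), of h] Xc_bounds[OF that(2), of h] by linarith
  have Xa: "\<bar>Xc h y\<bar> \<le> 2 * B" if "y \<in> next_states M" for h y
    using Xc_bounds[OF that, of h] by linarith
  have m4: "prob_ever (\<lambda>h. good_hist M h \<and>
     \<not> sumh (\<lambda>h x. trP x Vs - Vs (nxt x)) h \<le>
      11 * (sqrt (YY h * io (len1 h)) + 2 * B * io (len1 h))) \<le> \<delta>"
    using martingale_event[of "\<lambda>_. Vs", OF Va Vd] unfolding YY_def by simp
  have m5: "prob_ever (\<lambda>h. good_hist M h \<and>
     \<not> sumh (\<lambda>h x. trP x (Xc h) - Xc h (nxt x)) h \<le>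
      11 * (sqrt (ZZ h * io (len1 h)) + 2 * B * io (len1 h))) \<le> \<delta>"
    using martingale_event[of Xc, OF Xa Xd] unfolding ZZ_def by simp
  note all = measure_bad_disj[OF prob_not_optimistic measure_bad_disj[OF prob_not_deviation
    measure_bad_disj[OF prob_not_frequency measure_bad_disj[OF m4 measure_bad_disj[OF m5
    measure_bad_disj[OF square_martingale_event measure_bad_disj[OF variance_event[OF R] gap_event[OF R]]]]]]]]
  show ?thesis
    by (rule order_trans[OF measure_bad_mono order_trans[OF all]]) (auto simp: nice_at_def)
qed

end

section \<open>Regret on the favourable event\<close>

lemma sum_sqrt_le:
  fixes p q :: "'i \<Rightarrow> real"
  assumes "\<And>i. i \<in> I \<Longrightarrow> 0 \<le> p i" "\<And>i. i \<in> I \<Longrightarrow> 0 \<le> q i"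
  shows "(\<Sum>i\<in>I. sqrt (p i * q i)) \<le> sqrt ((\<Sum>i\<in>I. p i) * (\<Sum>i\<in>I. q i))"
proof (rule real_le_rsqrt)
  have "(\<Sum>i\<in>I. sqrt (p i) * sqrt (q i))\<^sup>2 \<le> (\<Sum>i\<in>I. (sqrt (p i))\<^sup>2) * (\<Sum>i\<in>I. (sqrt (q i))\<^sup>2)"
    by (rule Cauchy_Schwarz_ineq_sum)
  also have "(\<Sum>i\<in>I. (sqrt (p i))\<^sup>2) = (\<Sum>i\<in>I. p i)" using assms by (intro sum.cong) auto
  also have "(\<Sum>i\<in>I. (sqrt (q i))\<^sup>2) = (\<Sum>i\<in>I. q i)" using assms by (intro sum.cong) auto
  finally show "(\<Sum>i\<in>I. sqrt (p i * q i))\<^sup>2 \<le> (\<Sum>i\<in>I. p i) * (\<Sum>i\<in>I. q i)"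
    by (simp add: real_sqrt_mult)
qed

text \<open>The three constants collect the coefficients arising in \<open>backup_error\<close>,
  \<open>ET_le\<close> and \<open>Gam_le'\<close>, in this order.\<close>

definition C_backup :: "real \<Rightarrow> real \<Rightarrow> real" where
  "C_backup c1 c2 = 100 + 35 * c1 + c2"

definition C_err :: "real \<Rightarrow> real \<Rightarrow> real" where
  "C_err c1 c2 = 5 + 6 * C_backup c1 c2"

definition C_gap :: "real \<Rightarrow> real \<Rightarrow> real" where
  "C_gap c1 c2 = 12 * (16 * (C_err c1 c2)\<^sup>2 + 6 * C_err c1 c2) + 169"

context vi_run
begin

section \<open>Error of a single backup\<close>

lemma Vr_centred: "s \<in> states M \<Longrightarrow> a \<in> actions M \<Longrightarrow> Vr s a v = Pv M s a (\<lambda>y. (v y - Pv M s a v)\<^sup>2)"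
  using Pv_square_shift[of s a "- Pv M s a v" v] by (simp add: add.commute)

lemma Vr_le_square: "Vr s a v \<le> Pv M s a (\<lambda>y. (v y)\<^sup>2)"
  by (simp add: Vr_def)

lemma Vr_add_le:
  assumes sa: "s \<in> states M" "a \<in> actions M"
  shows "Vr s a (\<lambda>y. v y + w y) \<le> 2 * Vr s a v + 2 * Vr s a w"
proof -
  have "Vr s a (\<lambda>y. v y + w y) = Pv M s a (\<lambda>y. ((v y - Pv M s a v) + (w y - Pv M s a w))\<^sup>2)"
    unfolding Vr_centred[OF sa] by (simp add: Pv_add algebra_simps)
  also have "\<dots> \<le> Pv M s a (\<lambda>y. 2 * (v y - Pv M s a v)\<^sup>2 + 2 * (w y - Pv M s a w)\<^sup>2)"
  proof (rule Pv_mono)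
    fix y
    have "(x + z)\<^sup>2 \<le> 2 * x\<^sup>2 + 2 * z\<^sup>2" for x z :: real
      using sum_squares_bound[of x z] by (simp add: power2_sum)
    then show "((v y - Pv M s a v) + (w y - Pv M s a w))\<^sup>2 \<le> 2 * (v y - Pv M s a v)\<^sup>2 + 2 * (w y - Pv M s a w)\<^sup>2" .
  qed
  also have "\<dots> = 2 * Vr s a v + 2 * Vr s a w"
    unfolding Vr_centred[OF sa] by (simp only: Pv_add Pv_cmult)
  finally show ?thesis .
qed

text \<open>Centring \<open>v\<close> at its mean is free, since both weights sum to 1. The
  frequency bound is then used for each next state separately, and Cauchy-Schwarz over the next
  states produces the factor \<open>nX\<close>.\<close>

lemma empirical_deviation:
  assumes sa: "s \<in> states M" "a \<in> actions M" and h: "good_hist M h" and Np: "0 < N h s a"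
    and fr: "\<And>y. y \<in> next_states M \<Longrightarrow> frequency_at h s a y"
    and v: "\<And>y. y \<in> next_states M \<Longrightarrow> 0 \<le> v y \<and> v y \<le> 2 * B"
  shows "Eb h s a v - Pv M s a v \<le> 33 * (sqrt (nX * kap h s a * Vr s a v) + 2 * B * (nX * kap h s a))"
proof -
  let ?m = "Pv M s a v" and ?p = "pmf (trans M s a)" and ?k = "kap h s a"
  have k: "0 \<le> ?k" by (rule kap_nonneg)
  have m: "0 \<le> ?m" "?m \<le> 2 * B"
    using Pv_ge_const[OF sa, of 0 v] Pv_le_const[OF sa, of v "2 * B"] v by auto
  have vm: "\<bar>v y - ?m\<bar> \<le> 2 * B" if "y \<in> next_states M" for y
    using m v[OF that] by linarith
  have "Eb h s a v - ?m = Eb h s a (\<lambda>y. v y - ?m)"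
    by (simp add: Eb_diff Eb_const[OF h Np])
  also have "\<dots> = (\<Sum>y\<in>next_states M. Pb h s a y * (v y - ?m)) - Pv M s a (\<lambda>y. v y - ?m)"
    using sa by (simp add: Eb_def expect_def Pv_diff Pv_const)
  also have "\<dots> = (\<Sum>y\<in>next_states M. (Pb h s a y - ?p y) * (v y - ?m))"
    by (simp add: Pv_def expect_def left_diff_distrib sum_subtractf)
  also have "\<dots> \<le> (\<Sum>y\<in>next_states M. 33 * (sqrt ?k * sqrt (1 * (?p y * (v y - ?m)\<^sup>2)) + 2 * B * ?k))"
  proof (rule sum_mono)
    fix y assume y: "y \<in> next_states M"
    have "(Pb h s a y - ?p y) * (v y - ?m) \<le> \<bar>Pb h s a y - ?p y\<bar> * \<bar>v y - ?m\<bar>"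
      by (metis abs_ge_self abs_mult)
    also have "\<dots> \<le> (33 * (sqrt (?p y * ?k) + ?k)) * \<bar>v y - ?m\<bar>"
      using fr[OF y] Np by (intro mult_right_mono) (auto simp: frequency_at_def)
    also have "\<dots> = 33 * (sqrt ?k * (sqrt (?p y) * \<bar>v y - ?m\<bar>)) + 33 * (?k * \<bar>v y - ?m\<bar>)"
      by (simp add: real_sqrt_mult algebra_simps)
    also have "sqrt (?p y) * \<bar>v y - ?m\<bar> = sqrt (1 * (?p y * (v y - ?m)\<^sup>2))" by (simp add: real_sqrt_mult)
    also have "?k * \<bar>v y - ?m\<bar> \<le> ?k * (2 * B)" by (rule mult_left_mono[OF vm[OF y] k])
    finally show "(Pb h s a y - ?p y) * (v y - ?m) \<le> 33 * (sqrt ?k * sqrt (1 * (?p y * (v y - ?m)\<^sup>2)) + 2 * B * ?k)"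
      by (simp add: algebra_simps)
  qed
  also have "\<dots> = 33 * (sqrt ?k * (\<Sum>y\<in>next_states M. sqrt (1 * (?p y * (v y - ?m)\<^sup>2))) + 2 * B * (nX * ?k))"
    by (simp add: sum_distrib_left[symmetric] sum.distrib nX_def algebra_simps)
  also have "(\<Sum>y\<in>next_states M. sqrt (1 * (?p y * (v y - ?m)\<^sup>2))) \<le>
      sqrt ((\<Sum>y\<in>next_states M. 1) * (\<Sum>y\<in>next_states M. ?p y * (v y - ?m)\<^sup>2))"
    by (rule sum_sqrt_le) auto
  also have "\<dots> = sqrt (nX * Vr s a v)"
    unfolding Vr_centred[OF sa] by (simp add: nX_def Pv_def expect_def)
  finally have "Eb h s a v - ?m \<le> 33 * (sqrt ?k * sqrt (nX * Vr s a v) + 2 * B * (nX * ?k))"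
    using k by (simp add: mult_left_mono)
  also have "sqrt ?k * sqrt (nX * Vr s a v) = sqrt (nX * ?k * Vr s a v)"
    by (simp add: real_sqrt_mult mult_ac)
  finally show ?thesis .
qed

lemma empirical_variance:
  assumes sa: "s \<in> states M" "a \<in> actions M" and h: "good_hist M h" and Np: "0 < N h s a"
    and fr: "\<And>y. y \<in> next_states M \<Longrightarrow> frequency_at h s a y"
    and v: "\<And>y. y \<in> next_states M \<Longrightarrow> \<bar>v y\<bar> \<le> B"
  shows "Vb h s a v \<le> 2 * Vr s a v + 1225 * nX * B\<^sup>2 * kap h s a"
proof -
  let ?m = "Pv M s a v" and ?p = "pmf (trans M s a)" and ?k = "kap h s a"
  have k: "0 \<le> ?k" by (rule kap_nonneg)
  have m: "\<bar>?m\<bar> \<le> B" by (rule Pv_abs_le[OF sa v])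
  have "Vb h s a v \<le> Eb h s a (\<lambda>y. (?m - v y)\<^sup>2)"
    unfolding Eb_shift_square[OF h Np] by simp
  also have "\<dots> \<le> (\<Sum>y\<in>next_states M. 2 * (?p y * (v y - ?m)\<^sup>2) + 1225 * B\<^sup>2 * ?k)"
    unfolding Eb_def expect_def
  proof (rule sum_mono)
    fix y assume y: "y \<in> next_states M"
    \<comment> \<open>The square of \<open>33 / 2\<close> is below 273. Later
      \<open>4 * (273 + 33)\<close> is rounded up to 1225, the square of 35, so that
      \<open>backup_error\<close> can take an exact root.\<close>
    have "33 * sqrt (?p y * ?k) \<le> ?p y + 273 * ?k"
    proof -
      have "2 * sqrt (?p y) * (33 / 2 * sqrt ?k) \<le> (sqrt (?p y))\<^sup>2 + (33 / 2 * sqrt ?k)\<^sup>2" by (rule sum_squares_bound)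
      then show ?thesis using k by (simp add: real_sqrt_mult power_mult_distrib power2_eq_square)
    qed
    moreover have "Pb h s a y \<le> ?p y + 33 * sqrt (?p y * ?k) + 33 * ?k"
      using fr[OF y] Np by (auto simp: frequency_at_def abs_le_iff algebra_simps)
    ultimately have "Pb h s a y \<le> 2 * ?p y + 306 * ?k" by linarith
    then have "Pb h s a y * (?m - v y)\<^sup>2 \<le> (2 * ?p y + 306 * ?k) * (?m - v y)\<^sup>2" by (rule mult_right_mono) simp
    also have "\<dots> = 2 * (?p y * (v y - ?m)\<^sup>2) + 306 * ?k * (?m - v y)\<^sup>2"
      by (simp add: power2_commute[of "v y"] algebra_simps)
    also have "306 * ?k * (?m - v y)\<^sup>2 \<le> 306 * ?k * (2 * B)\<^sup>2"
    proof (rule mult_left_mono)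
      have "\<bar>?m - v y\<bar> \<le> 2 * B" using m v[OF y] by linarith
      then show "(?m - v y)\<^sup>2 \<le> (2 * B)\<^sup>2" using power_mono[of "\<bar>?m - v y\<bar>" "2 * B" 2] by simp
    qed (use k in simp)
    also have "\<dots> \<le> 1225 * B\<^sup>2 * ?k" using k by (simp add: power_mult_distrib mult_right_mono)
    finally show "Pb h s a y * (?m - v y)\<^sup>2 \<le> 2 * (?p y * (v y - ?m)\<^sup>2) + 1225 * B\<^sup>2 * ?k" by simp
  qed
  also have "\<dots> = 2 * Vr s a v + 1225 * nX * B\<^sup>2 * ?k"
    unfolding Vr_centred[OF sa] by (simp add: Pv_def expect_def sum.distrib sum_distrib_left nX_def)
  finally show ?thesis .
qed

abbreviation CC :: real where "CC \<equiv> C_backup c1 c2"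

lemma CC_ge: "100 \<le> CC"
  using c1 c2 by (simp add: C_backup_def)

text \<open>The over-estimation of a value by one backup with an outdated estimate \<open>l\<close>.\<close>

lemma backup_error:
  assumes sa: "s \<in> states M" "a \<in> actions M" and h: "good_hist M h" and Np: "0 < N h s a" and nice: "nice_at h"
    and l: "\<And>y. y \<in> next_states M \<Longrightarrow> Vs y \<le> l y \<and> l y \<le> B"
  shows "Eb h s a l + bonus h s a l \<le> Pv M s a l +
     CC * (sqrt (kap h s a * Vr s a Vs) + sqrt (nX * kap h s a * Vr s a (\<lambda>y. l y - Vs y)) + B * (nX * kap h s a))"
proof -
  let ?k = "kap h s a" and ?u = "\<lambda>y. l y - Vs y"
  have k: "0 \<le> ?k" by (rule kap_nonneg)
  have fr: "frequency_at h s a y" if "y \<in> next_states M" for y using nice sa that by (simp add: nice_at_def)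
  have u: "0 \<le> ?u y \<and> ?u y \<le> 2 * B" if "y \<in> next_states M" for y
    using l[OF that] Vs_abs_le_B[OF that] by linarith
  have lB: "\<bar>l y\<bar> \<le> B" if "y \<in> next_states M" for y
    using l[OF that] Vs_abs_le_B[OF that] by linarith
  define X1 where "X1 = sqrt (?k * Vr s a Vs)"
  define X2 where "X2 = sqrt (nX * ?k * Vr s a ?u)"
  define X3 where "X3 = B * (nX * ?k)"
  have X3: "0 \<le> X3" and X1: "0 \<le> X1" and X2: "0 \<le> X2"
    using k B1 nX_ge Vr_nonneg[OF sa] by (auto simp: X1_def X2_def X3_def)
  have kX3: "B * ?k \<le> X3"
    unfolding X3_def using B1 k nX_ge mult_right_mono[of 1 nX ?k] by (intro mult_left_mono) auto
  \<comment> \<open>The estimate is split as \<open>Vs\<close> plus the excess \<open>?u\<close>.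
    The fixed part pays no factor \<open>nX\<close> in its leading term; the data-dependent part
    pays it together with its own variance.\<close>
  have d1: "Eb h s a Vs - Pv M s a Vs \<le> 11 * X1 + 22 * (B * ?k)"
    using nice sa Np by (simp add: nice_at_def deviation_at_def X1_def mult.commute)
  have d2: "Eb h s a ?u - Pv M s a ?u \<le> 33 * X2 + 66 * X3"
    using empirical_deviation[OF sa h Np fr u] by (simp add: X2_def X3_def)
  have d3: "bonus h s a l \<le> c1 * (2 * X1 + 2 * X2 + 35 * X3) + c2 * X3"
  proof -
    have "Vr s a l = Vr s a (\<lambda>y. Vs y + ?u y)" by simp
    also have "\<dots> \<le> 2 * Vr s a Vs + 2 * Vr s a ?u" by (rule Vr_add_le[OF sa])
    finally have Vl: "Vr s a l \<le> 2 * Vr s a Vs + 2 * Vr s a ?u" .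
    have "Vb h s a l * ?k \<le> (2 * Vr s a l + 1225 * nX * B\<^sup>2 * ?k) * ?k"
      using k by (intro mult_right_mono empirical_variance[OF sa h Np fr lB]) auto
    also have "\<dots> \<le> (4 * Vr s a Vs + 4 * Vr s a ?u + 1225 * nX * B\<^sup>2 * ?k) * ?k"
      using Vl k by (intro mult_right_mono) auto
    also have "\<dots> \<le> 4 * (?k * Vr s a Vs) + (4 * (nX * ?k * Vr s a ?u) + (35 * X3)\<^sup>2)"
    proof -
      have "1 * (?k * Vr s a ?u) \<le> nX * (?k * Vr s a ?u)"
        using nX_ge k Vr_nonneg[OF sa, of ?u] by (intro mult_right_mono) auto
      moreover have "nX * (B\<^sup>2 * ?k\<^sup>2) \<le> (nX * nX) * (B\<^sup>2 * ?k\<^sup>2)"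
        using nX_ge mult_left_mono[of 1 nX nX] by (intro mult_right_mono) auto
      moreover have "(35 * X3)\<^sup>2 = 1225 * ((nX * nX) * (B\<^sup>2 * ?k\<^sup>2))"
        by (simp add: X3_def power_mult_distrib power2_eq_square)
      ultimately show ?thesis by (simp add: algebra_simps power2_eq_square)
    qed
    finally have "sqrt (Vb h s a l * ?k) \<le> sqrt (4 * (?k * Vr s a Vs) + (4 * (nX * ?k * Vr s a ?u) + (35 * X3)\<^sup>2))"
      by (rule real_sqrt_le_mono)
    also have "\<dots> \<le> sqrt (4 * (?k * Vr s a Vs)) + sqrt (4 * (nX * ?k * Vr s a ?u) + (35 * X3)\<^sup>2)"
      using k Vr_nonneg[OF sa] nX_ge by (intro sqrt_add_le_add_sqrt) auto
    also have "sqrt (4 * (nX * ?k * Vr s a ?u) + (35 * X3)\<^sup>2) \<le> sqrt (4 * (nX * ?k * Vr s a ?u)) + sqrt ((35 * X3)\<^sup>2)"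
      using k Vr_nonneg[OF sa] nX_ge by (intro sqrt_add_le_add_sqrt) auto
    also have "sqrt (4 * (?k * Vr s a Vs)) = 2 * X1" by (simp add: X1_def real_sqrt_mult)
    also have "sqrt (4 * (nX * ?k * Vr s a ?u)) = 2 * X2" by (simp add: X2_def real_sqrt_mult)
    also have "sqrt ((35 * X3)\<^sup>2) = 35 * X3" unfolding real_sqrt_abs using X3 by simp
    finally have "sqrt (Vb h s a l * ?k) \<le> 2 * X1 + 2 * X2 + 35 * X3" by simp
    then have "c1 * sqrt (Vb h s a l * ?k) \<le> c1 * (2 * X1 + 2 * X2 + 35 * X3)" using c1 by (intro mult_left_mono) auto
    moreover have "c2 * (B * ?k) \<le> c2 * X3" using kX3 c2 by (intro mult_left_mono) auto
    moreover have "0 \<le> c1 * (2 * X1 + 2 * X2 + 35 * X3)" "0 \<le> c2 * X3" using c1 c2 X1 X2 X3 by auto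
    ultimately show ?thesis unfolding bonus_def kap_def[symmetric] by (simp add: mult.assoc)
  qed
  have "Eb h s a l = Eb h s a Vs + Eb h s a ?u" "Pv M s a l = Pv M s a Vs + Pv M s a ?u"
    by (simp_all add: Eb_diff Pv_diff)
  then have "Eb h s a l + bonus h s a l \<le> Pv M s a l + (11 * X1 + 33 * X2 + 88 * X3 + (c1 * (2 * X1 + 2 * X2 + 35 * X3) + c2 * X3))"
    using d1 d2 d3 kX3 by linarith
  also have "11 * X1 + 33 * X2 + 88 * X3 + (c1 * (2 * X1 + 2 * X2 + 35 * X3) + c2 * X3) \<le> CC * (X1 + X2 + X3)"
  proof -
    have "(11 + 2 * c1) * X1 \<le> CC * X1" "(33 + 2 * c1) * X2 \<le> CC * X2" "(88 + 35 * c1 + c2) * X3 \<le> CC * X3"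
      using X1 X2 X3 c1 c2 by (auto simp: C_backup_def intro!: mult_right_mono)
    then show ?thesis by (simp add: algebra_simps)
  qed
  finally show ?thesis by (simp add: X1_def X2_def X3_def)
qed

lemma Pb_snoc_other:
  assumes "\<not> (s = st x \<and> a = ac x)"
  shows "Pb (h @ [x]) s a = Pb h s a" "N (h @ [x]) s a = N h s a"
  using assms by (auto simp: Pb_def N_snoc N3_snoc fun_eq_iff)

end

text \<open>Probability has left the argument here: one trajectory is fixed on which all favourable
  inequalities hold at all times.\<close>

locale good_run = vi_run M c1 c2 B \<delta> f for M :: "('s::countable, 'a::countable) sp" and c1 c2 B \<delta> f +
  fixes \<omega> :: "nat \<Rightarrow> ('s, 'a) transition"
  assumes cons: "consistent \<omega>" and nice: "\<And>n. nice_at (prefix_of \<omega> n)"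
    and Rpos: "1 \<le> R_bound M"
begin

abbreviation H :: "nat \<Rightarrow> ('s, 'a) transition list" where "H n \<equiv> prefix_of \<omega> n"
abbreviation S :: "nat \<Rightarrow> 's" where "S n \<equiv> st (\<omega> n)"
abbreviation Ac :: "nat \<Rightarrow> 'a" where "Ac n \<equiv> ac (\<omega> n)"
abbreviation Y :: "nat \<Rightarrow> 's option" where "Y n \<equiv> nxt (\<omega> n)"

definition V :: "nat \<Rightarrow> 's option \<Rightarrow> real" where "V n = VV (H n)"
definition X :: "nat \<Rightarrow> 's option \<Rightarrow> real" where "X n y = V n y - Vs y"
definition n_vis :: "nat \<Rightarrow> nat" where "n_vis n = N (H n) (S n) (Ac n)"
definition \<kappa> :: "nat \<Rightarrow> real" where "\<kappa> n = kap (H n) (S n) (Ac n)"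

lemma good_H: "good_hist M (H n)" and good_tr_n: "good_tr M (\<omega> n)"
  using cons unfolding consistent_def by blast+

lemma cur_H: "cur (H n) = S n" and act_H: "f (H n) (S n) = Ac n"
  using cons unfolding consistent_def by metis+

lemma S_in [simp]: "S n \<in> states M" and Ac_in [simp]: "Ac n \<in> actions M" and Y_in [simp]: "Y n \<in> next_states M"
  using good_tr_n[of n] unfolding good_tr_def by auto

lemma H_Suc: "H (Suc n) = H n @ [\<omega> n]"
  by simp

lemma S_Suc: "S (Suc n) = (case Y n of None \<Rightarrow> s_init M | Some s \<Rightarrow> s)"
  unfolding cur_H[symmetric, of "Suc n"] H_Suc by (rule cur_state_snoc)

lemma optimistic: "s \<in> states M \<Longrightarrow> a \<in> actions M \<Longrightarrow> rew M s a + Pv M s a Vs \<le> QQ (H n) s a"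
  "y \<in> next_states M \<Longrightarrow> Vs y \<le> V n y"
proof -
  have "optimistic_at (take k (H n))" if "k \<le> length (H n)" for k
  proof -
    have "take k (H n) = H k" using that by (simp add: take_map)
    then show ?thesis using nice[of k] by (simp add: nice_at_def)
  qed
  from optimism[OF this good_H]
  show "s \<in> states M \<Longrightarrow> a \<in> actions M \<Longrightarrow> rew M s a + Pv M s a Vs \<le> QQ (H n) s a"
    "y \<in> next_states M \<Longrightarrow> Vs y \<le> V n y"
    unfolding V_def by blast+
qed

lemma V_le_B: "V n y \<le> B" and V_Suc_le: "V (Suc n) y \<le> V n y" and V_None [simp]: "V n None = 0"
  unfolding V_def H_Suc by (rule VV_le_B, rule VV_snoc_le, rule VV_None)

lemma X_bounds: "y \<in> next_states M \<Longrightarrow> 0 \<le> X n y" "y \<in> next_states M \<Longrightarrow> X n y \<le> 2 * B"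
  using optimistic(2)[of y n] V_le_B[of n y] Vs_abs_le_B[of y] unfolding X_def by linarith+

lemma Xc_eq: "Xc (H n) = X n"
  unfolding X_def[abs_def] V_def using optimistic(2)[of _ n] by (auto simp: Xc_def V_def fun_eq_iff)

lemma X_None [simp]: "X n None = 0"
  by (simp add: X_def)

text \<open>The estimate that entered the latest backup of \<open>(s, a)\<close>, namely
  \<open>V\<close> at the last visit strictly before time \<open>n\<close>.\<close>

primrec lastV :: "nat \<Rightarrow> 's \<Rightarrow> 'a \<Rightarrow> 's option \<Rightarrow> real" where
  "lastV 0 s a = V 0"
| "lastV (Suc n) s a = (if S n = s \<and> Ac n = a then V n else lastV n s a)"

lemma V_le_lastV: "V n y \<le> lastV n s a y"
proof (induction n)
  case (Suc n) then show ?case using V_Suc_le[of n y] by auto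
qed simp

lemma lastV_le_B: "lastV n s a y \<le> B"
  by (induction n) (auto simp: V_le_B)

lemma lastV_None [simp]: "lastV n s a None = 0"
  by (induction n) auto

lemma Vs_le_lastV: "y \<in> next_states M \<Longrightarrow> Vs y \<le> lastV n s a y"
  using optimistic(2)[of y n] V_le_lastV[of n y s a] by linarith

text \<open>The entry, the counts and the empirical law of a pair change only when it is visited,
  and that is exactly when \<open>lastV\<close> records the value function used.\<close>

lemma QQ_le_backup:
  assumes "0 < N (H n) s a"
  shows "QQ (H n) s a \<le> rew M s a + Eb (H n) s a (lastV n s a) + bonus (H n) s a (lastV n s a)"
  using assms
proof (induction n)
  case (Suc n)
  show ?case
  proof (cases "s = S n \<and> a = Ac n")
    case True
    then show ?thesis unfolding H_Suc QQ_snoc by (simp add: V_def)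
  next
    case False
    have eq: "Eb (H n @ [\<omega> n]) s a = Eb (H n) s a" "bonus (H n @ [\<omega> n]) s a = bonus (H n) s a"
      unfolding Eb_def[abs_def] bonus_def[abs_def] Vb_def[abs_def] Pb_snoc_other[OF False] by simp_all
    have l: "lastV (Suc n) s a = lastV n s a" using False by auto
    have q: "QQ (H n @ [\<omega> n]) s a = QQ (H n) s a" using False by (auto simp: QQ_snoc)
    show ?thesis unfolding H_Suc eq l q
      using Suc unfolding H_Suc Pb_snoc_other[OF False] by blast
  qed
qed simp

text \<open>The decrease is summed over all next states without their probabilities; this is cruder
  but telescopes.\<close>

definition drift :: "nat \<Rightarrow> real" where
  "drift n = (\<Sum>y\<in>next_states M. lastV n (S n) (Ac n) y - V n y)"

text \<open>An unvisited pair has no backup to compare with; the \<open>3 * B\<close> bounds its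
  error by means of \<open>QQ_le_B\<close>, the reward and the expected value each contributing at
  most \<open>B\<close>.\<close>

definition err :: "nat \<Rightarrow> real" where
  "err n = drift n + (if n_vis n = 0 then 3 * B else 0) +
     CC * (sqrt (\<kappa> n * Vr (S n) (Ac n) Vs) +
       sqrt (nX * \<kappa> n * Vr (S n) (Ac n) (\<lambda>y. lastV n (S n) (Ac n) y - Vs y)) + B * (nX * \<kappa> n))"

lemma \<kappa>_nonneg: "0 \<le> \<kappa> n"
  unfolding \<kappa>_def by (rule kap_nonneg)

lemma drift_nonneg: "0 \<le> drift n"
  unfolding drift_def by (intro sum_nonneg) (simp add: V_le_lastV)

lemma Pv_le_drift: "Pv M (S n) (Ac n) (\<lambda>y. lastV n (S n) (Ac n) y - V n y) \<le> drift n"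
  unfolding Pv_def expect_def drift_def
proof (rule sum_mono)
  fix y
  have "pmf (trans M (S n) (Ac n)) y * (lastV n (S n) (Ac n) y - V n y) \<le> 1 * (lastV n (S n) (Ac n) y - V n y)"
    by (rule mult_right_mono) (auto simp: pmf_le_1 V_le_lastV)
  then show "pmf (trans M (S n) (Ac n)) y * (lastV n (S n) (Ac n) y - V n y) \<le> lastV n (S n) (Ac n) y - V n y" by simp
qed

lemma err_nonneg: "0 \<le> err n"
  unfolding err_def using drift_nonneg[of n] B1 CC_ge \<kappa>_nonneg[of n] nX_ge
  by (intro add_nonneg_nonneg mult_nonneg_nonneg) (auto intro!: Vr_nonneg mult_nonneg_nonneg)

lemma QQ_err: "QQ (H n) (S n) (Ac n) - (rew M (S n) (Ac n) + Pv M (S n) (Ac n) Vs) \<le> Pv M (S n) (Ac n) (X n) + err n"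
proof -
  let ?s = "S n" and ?a = "Ac n"
  let ?rest = "CC * (sqrt (\<kappa> n * Vr ?s ?a Vs) +
       sqrt (nX * \<kappa> n * Vr ?s ?a (\<lambda>y. lastV n ?s ?a y - Vs y)) + B * (nX * \<kappa> n))"
  have rest: "0 \<le> ?rest"
    using B1 CC_ge \<kappa>_nonneg[of n] nX_ge
    by (intro add_nonneg_nonneg mult_nonneg_nonneg) (auto intro!: Vr_nonneg mult_nonneg_nonneg)
  have PX: "Pv M ?s ?a (X n) = Pv M ?s ?a (V n) - Pv M ?s ?a Vs"
    unfolding X_def[abs_def] by (rule Pv_diff)
  show ?thesis
  proof (cases "n_vis n = 0")
    case True
    have "- B \<le> Pv M ?s ?a (V n)"
      by (rule Pv_ge_const) (use optimistic(2)[of _ n] Vs_abs_le_B in \<open>fastforce simp: abs_le_iff\<close>)+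
    moreover have "QQ (H n) ?s ?a \<le> B" by (rule QQ_le_B)
    moreover have "\<bar>rew M ?s ?a\<bar> \<le> B" using rew_le[of ?s ?a] B1 by simp
    ultimately have "QQ (H n) ?s ?a - rew M ?s ?a - Pv M ?s ?a (V n) \<le> 3 * B" by linarith
    then show ?thesis using rest drift_nonneg[of n] True unfolding err_def PX by simp
  next
    case False
    then have Np: "0 < N (H n) ?s ?a" by (simp add: n_vis_def)
    have "QQ (H n) ?s ?a \<le> rew M ?s ?a + (Eb (H n) ?s ?a (lastV n ?s ?a) + bonus (H n) ?s ?a (lastV n ?s ?a))"
      using QQ_le_backup[OF Np] by simp
    also have "\<dots> \<le> rew M ?s ?a + (Pv M ?s ?a (lastV n ?s ?a) + ?rest)"
      unfolding \<kappa>_def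
      by (intro add_left_mono backup_error good_H nice Np) (auto simp: Vs_le_lastV lastV_le_B)
    finally show ?thesis
      using Pv_le_drift[of n] False unfolding err_def PX Pv_diff by simp
  qed
qed

lemma V_S: "V n (Some (S n)) = QQ (H n) (S n) (Ac n)"
  using VV_cur[OF good_H, of n] unfolding V_def cur_H act_H .

lemma X_S_le: "X n (Some (S n)) \<le> Pv M (S n) (Ac n) (X n) + err n"
  using QQ_err[of n] V_S[of n] Vs_ge[of "S n" "Ac n"] unfolding X_def by simp

text \<open>The greedy choice makes \<open>V n\<close> at the current state equal to the entry
  \<open>QQ\<close> that is played. The excess at the next state is inserted so that the second
  summand is a martingale increment and the third nearly telescopes.\<close>

lemma adv_eq: "adv (S n) (Ac n) \<le> err n + (Pv M (S n) (Ac n) (X n) - X n (Y n)) + (X n (Y n) - X n (Some (S n)))"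
  using QQ_err[of n] V_S[of n] unfolding X_def adv_def by simp

end

lemma sqrt_mult_le_scaled:
  assumes "0 \<le> a" "0 \<le> b" "0 < \<theta>"
  shows "sqrt (a * b) \<le> \<theta> * a / 2 + b / (2 * \<theta>)"
proof -
  have "sqrt (a * b) = sqrt ((\<theta> * a) * (b / \<theta>))" using assms by simp
  also have "\<dots> \<le> (\<theta> * a + b / \<theta>) / 2" using assms by (intro arith_geo_mean_sqrt) auto
  finally show ?thesis using assms by (simp add: add_divide_distrib)
qed

text \<open>The term with \<open>i = 0\<close> vanishes, as \<open>1 / 0 = 0\<close>.\<close>

lemma sum_inverse_le: "1 \<le> n \<Longrightarrow> (\<Sum>i<Suc n. 1 / real i) \<le> 1 + ln (real n)"
proof (induction n rule: nat_induct_at_least)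
  case base
  then show ?case by simp
next
  case (Suc n)
  have "ln (real n / real (Suc n)) \<le> real n / real (Suc n) - 1"
    using Suc.hyps by (intro ln_le_minus_one) auto
  also have "\<dots> = - (1 / real (Suc n))" by (simp add: field_simps)
  finally have "1 / real (Suc n) \<le> ln (real (Suc n)) - ln (real n)"
    using Suc.hyps by (simp add: ln_div)
  then show ?case using Suc.IH by simp
qed

context good_run
begin

text \<open>A potential \<open>G\<close> kept for each pair and changed only at visits to it turns a
  sum over time into a sum over pairs. It serves for the drift, for first visits and for the
  harmonic sums.\<close>

lemma sum_over_visits:
  assumes "\<And>t s a. G (Suc t) s a = G t s a + (if S t = s \<and> Ac t = a then d t else (0::real))"
  shows "(\<Sum>t<T. d t) = (\<Sum>s\<in>states M. \<Sum>a\<in>actions M. G T s a) - (\<Sum>s\<in>states M. \<Sum>a\<in>actions M. G 0 s a)"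
proof (induction T)
  case (Suc T)
  have "(\<Sum>s\<in>states M. \<Sum>a\<in>actions M. G (Suc T) s a) =
      (\<Sum>s\<in>states M. \<Sum>a\<in>actions M. G T s a) + (\<Sum>s\<in>states M. \<Sum>a\<in>actions M. (if S T = s \<and> Ac T = a then d T else 0))"
    unfolding assms by (simp only: sum.distrib)
  also have "(\<Sum>s\<in>states M. \<Sum>a\<in>actions M. (if S T = s \<and> Ac T = a then d T else 0)) =
      (\<Sum>s\<in>states M. if S T = s then d T else 0)"
    by (intro sum.cong refl) auto
  also have "\<dots> = d T" by simp
  finally show ?case using Suc by simp
qed simp

lemma sum_pairs_const: "(\<Sum>s\<in>states M. \<Sum>a\<in>actions M. c) = SA * c"
  by (simp add: SA_def)

lemma sum_drift: "(\<Sum>t<T. drift t) \<le> 2 * B * (nX * SA)"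
proof -
  define G where "G t s a = - (\<Sum>y\<in>next_states M. lastV t s a y)" for t s a
  have eq: "(\<Sum>t<T. drift t) = (\<Sum>s\<in>states M. \<Sum>a\<in>actions M. G T s a) - (\<Sum>s\<in>states M. \<Sum>a\<in>actions M. G 0 s a)"
    by (rule sum_over_visits) (auto simp: G_def drift_def sum_subtractf)
  have hi: "(\<Sum>s\<in>states M. \<Sum>a\<in>actions M. G T s a) \<le> (\<Sum>s\<in>states M. \<Sum>a\<in>actions M. nX * B)"
  proof (intro sum_mono)
    fix s a
    have "(\<Sum>y\<in>next_states M. - B) \<le> (\<Sum>y\<in>next_states M. lastV T s a y)"
    proof (rule sum_mono)
      fix y assume "y \<in> next_states M"
      then show "- B \<le> lastV T s a y" using Vs_le_lastV[of y T s a] Vs_abs_le_B[of y] by linarith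
    qed
    then show "G T s a \<le> nX * B" by (simp add: G_def nX_def)
  qed
  have lo: "(\<Sum>s\<in>states M. \<Sum>a\<in>actions M. - (nX * B)) \<le> (\<Sum>s\<in>states M. \<Sum>a\<in>actions M. G 0 s a)"
  proof (intro sum_mono)
    fix s a
    have "(\<Sum>y\<in>next_states M. lastV 0 s a y) \<le> (\<Sum>y\<in>next_states M. B)" by (intro sum_mono lastV_le_B)
    then show "- (nX * B) \<le> G 0 s a" by (simp add: G_def nX_def)
  qed
  show ?thesis unfolding eq using hi lo unfolding sum_pairs_const by (simp add: algebra_simps)
qed

lemma N_le: "N (H n) s a \<le> n"
  by (induction n) (auto simp: N_snoc)

lemma N_H_Suc: "N (H (Suc t)) s a = N (H t) s a + (if S t = s \<and> Ac t = a then 1 else 0)"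
  unfolding H_Suc N_snoc by auto

lemma sum_first_visits: "(\<Sum>t<T. if n_vis t = 0 then 1 else (0::real)) \<le> SA"
proof -
  define G where "G t s a = (if N (H t) s a = 0 then 0 else 1 :: real)" for t s a
  have "(\<Sum>t<T. if n_vis t = 0 then 1 else (0::real)) = (\<Sum>s\<in>states M. \<Sum>a\<in>actions M. G T s a) - (\<Sum>s\<in>states M. \<Sum>a\<in>actions M. G 0 s a)"
    by (rule sum_over_visits) (auto simp: G_def N_H_Suc n_vis_def simp del: upt_Suc)
  also have "\<dots> = (\<Sum>s\<in>states M. \<Sum>a\<in>actions M. G T s a)" by (simp add: G_def)
  also have "\<dots> \<le> (\<Sum>s\<in>states M. \<Sum>a\<in>actions M. 1)"
    by (intro sum_mono) (simp add: G_def)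
  finally show ?thesis unfolding sum_pairs_const by simp
qed

lemma sum_inverse_visits: "1 \<le> T \<Longrightarrow> (\<Sum>t<T. 1 / real (n_vis t)) \<le> 2 * SA * ln1 (real T)"
proof -
  assume T: "1 \<le> T"
  define G where "G t s a = (\<Sum>i<N (H t) s a. 1 / real i)" for t s a
  have "(\<Sum>t<T. 1 / real (n_vis t)) = (\<Sum>s\<in>states M. \<Sum>a\<in>actions M. G T s a) - (\<Sum>s\<in>states M. \<Sum>a\<in>actions M. G 0 s a)"
    by (rule sum_over_visits) (auto simp: G_def N_H_Suc n_vis_def simp del: upt_Suc)
  also have "\<dots> \<le> (\<Sum>s\<in>states M. \<Sum>a\<in>actions M. 2 * ln1 (real T))"
  proof -
    have "G T s a \<le> 2 * ln1 (real T)" for s a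
    proof -
      have "G T s a \<le> (\<Sum>i<Suc T. 1 / real i)"
        unfolding G_def using N_le[of T s a] by (intro sum_mono2) auto
      also have "\<dots> \<le> 1 + ln (real T)" by (rule sum_inverse_le[OF T])
      also have "\<dots> \<le> 2 * ln1 (real T)" using ln1_ge_1[of "real T"] ln_le_ln1[of "real T"] by linarith
      finally show ?thesis .
    qed
    then have "(\<Sum>s\<in>states M. \<Sum>a\<in>actions M. G T s a) \<le> (\<Sum>s\<in>states M. \<Sum>a\<in>actions M. 2 * ln1 (real T))"
      by (intro sum_mono)
    moreover have "(\<Sum>s\<in>states M. \<Sum>a\<in>actions M. G 0 s a) = 0" by (simp add: G_def)
    ultimately show ?thesis by linarith
  qed
  finally show ?thesis unfolding sum_pairs_const by (simp add: mult_ac)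
qed

section \<open>Cumulative quantities up to a fixed time\<close>

context
  fixes T :: nat
  assumes T: "1 \<le> T"
begin

text \<open>Up to a constant, \<open>W0\<close> bounds the sum of all \<open>\<kappa>\<close>, and
  \<open>GG\<close> absorbs every lower-order term.\<close>

definition W0 :: real where "W0 = SA * (io T * ln1 (real T))"
definition GG :: real where "GG = B * (nX * W0)"
definition YT :: real where "YT = (\<Sum>t<T. Vr (S t) (Ac t) Vs)"
definition ZT :: real where "ZT = (\<Sum>t<T. Vr (S t) (Ac t) (X t))"
definition ET :: real where "ET = (\<Sum>t<T. err t)"
definition Gam :: real where "Gam = (\<Sum>t<T. adv (S t) (Ac t))"

lemma io_ln1: "4 \<le> io T * ln1 (real T)" "io T \<le> io T * ln1 (real T)"
proof -
  have "io T * 1 \<le> io T * ln1 (real T)" using io_ge[of T] ln1_ge_1 by (intro mult_left_mono) auto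
  then show *: "io T \<le> io T * ln1 (real T)" by simp
  show "4 \<le> io T * ln1 (real T)" using * io_ge[of T] by linarith
qed

lemma W0_ge: "4 \<le> W0" "io T \<le> W0" "SA \<le> W0"
proof -
  have "1 * (io T * ln1 (real T)) \<le> W0"
    unfolding W0_def using SA_ge io_ln1 by (intro mult_right_mono) auto
  then show "4 \<le> W0" "io T \<le> W0" using io_ln1 by simp_all
  have "SA * 1 \<le> W0" unfolding W0_def using SA_ge io_ln1 by (intro mult_left_mono) auto
  then show "SA \<le> W0" by simp
qed

lemma nXW0_ge: "W0 \<le> nX * W0"
  using mult_right_mono[OF nX_ge, of W0] W0_ge by simp

lemma GG_ge: "B * W0 \<le> GG" "B * (nX * SA) \<le> GG" "B * nX \<le> GG" "B * io T \<le> GG" "0 \<le> GG"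
proof -
  show *: "B * W0 \<le> GG" unfolding GG_def using nXW0_ge B1 by (intro mult_left_mono) auto
  show "B * (nX * SA) \<le> GG" unfolding GG_def using W0_ge nX_ge B1 by (intro mult_left_mono) auto
  have "nX * 1 \<le> nX * W0" using W0_ge nX_ge by (intro mult_left_mono) auto
  then show "B * nX \<le> GG" unfolding GG_def using B1 by (intro mult_left_mono) auto
  have "B * io T \<le> B * W0" using W0_ge B1 by (intro mult_left_mono) auto
  then show "B * io T \<le> GG" using * by linarith
  show "0 \<le> GG" unfolding GG_def using B1 nX_ge W0_ge by simp
qed

lemma YT_nonneg: "0 \<le> YT" and ZT_nonneg: "0 \<le> ZT" and ET_nonneg: "0 \<le> ET"
  unfolding YT_def ZT_def ET_def by (intro sum_nonneg Vr_nonneg err_nonneg; simp)+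

lemma Gam_nonneg: "0 \<le> Gam"
  unfolding Gam_def by (intro sum_nonneg adv_nonneg) auto

lemma sum_\<kappa>: "(\<Sum>t<T. \<kappa> t) \<le> 2 * W0"
proof -
  have "(\<Sum>t<T. \<kappa> t) \<le> (\<Sum>t<T. io T * (1 / real (n_vis t)))"
  proof (rule sum_mono)
    fix t assume t: "t \<in> {..<T}"
    show "\<kappa> t \<le> io T * (1 / real (n_vis t))"
    proof (cases "n_vis t = 0")
      case False
      have "n_vis t \<le> T" using N_le[of t "S t" "Ac t"] t by (simp add: n_vis_def)
      then have "io (n_vis t) \<le> io T" using False by (intro io_mono) auto
      then show ?thesis by (simp add: \<kappa>_def kap_def n_vis_def divide_right_mono)
    qed (simp add: \<kappa>_def kap_def n_vis_def)
  qed
  also have "\<dots> \<le> io T * (2 * SA * ln1 (real T))"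
    unfolding sum_distrib_left[symmetric] using sum_inverse_visits[OF T] io_ge[of T] by (intro mult_left_mono) auto
  finally show ?thesis by (simp add: W0_def mult_ac)
qed

abbreviation CE :: real where "CE \<equiv> C_err c1 c2"

lemma CE_ge: "100 \<le> CE"
  using CC_ge by (simp add: C_err_def)

text \<open>Cauchy-Schwarz over time for both roots in \<open>err\<close>. The backed-up estimate is
  outdated, so its excess is split into the current \<open>X\<close> and the decrease since the last
  visit; the latter is at most \<open>2 * B\<close>, which reduces its square to the drift.\<close>

lemma ET_le: "ET \<le> CE * (sqrt (W0 * YT) + sqrt (nX * W0 * ZT) + GG)"
proof -
  define U where "U t = Vr (S t) (Ac t) (\<lambda>y. lastV t (S t) (Ac t) y - Vs y)" for t
  have U0: "0 \<le> U t" for t unfolding U_def by (rule Vr_nonneg) auto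
  have UZ: "(\<Sum>t<T. U t) \<le> 2 * ZT + 8 * (B * (B * (nX * SA)))"
  proof -
    have "U t \<le> 2 * Vr (S t) (Ac t) (X t) + 4 * B * drift t" for t
    proof -
      let ?w = "\<lambda>y. lastV t (S t) (Ac t) y - V t y"
      have "U t = Vr (S t) (Ac t) (\<lambda>y. X t y + ?w y)" by (simp add: U_def X_def)
      also have "\<dots> \<le> 2 * Vr (S t) (Ac t) (X t) + 2 * Vr (S t) (Ac t) ?w" by (rule Vr_add_le) auto
      also have "Vr (S t) (Ac t) ?w \<le> Pv M (S t) (Ac t) (\<lambda>y. (?w y)\<^sup>2)" by (rule Vr_le_square)
      also have "\<dots> \<le> Pv M (S t) (Ac t) (\<lambda>y. 2 * B * ?w y)"
      proof (rule Pv_mono)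
        fix y assume y: "y \<in> next_states M"
        have "0 \<le> ?w y" by (simp add: V_le_lastV)
        moreover have "?w y \<le> 2 * B"
          using lastV_le_B[of t "S t" "Ac t" y] optimistic(2)[OF y, of t] Vs_abs_le_B[OF y] by linarith
        ultimately show "(?w y)\<^sup>2 \<le> 2 * B * ?w y" unfolding power2_eq_square by (intro mult_right_mono)
      qed
      also have "\<dots> \<le> 2 * B * drift t"
        unfolding Pv_cmult using Pv_le_drift[of t] B1 by (intro mult_left_mono) auto
      finally show ?thesis by simp
    qed
    then have "(\<Sum>t<T. U t) \<le> (\<Sum>t<T. 2 * Vr (S t) (Ac t) (X t) + 4 * B * drift t)" by (intro sum_mono)
    also have "\<dots> = 2 * ZT + 4 * B * (\<Sum>t<T. drift t)"
      by (simp add: sum.distrib sum_distrib_left ZT_def)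
    also have "4 * B * (\<Sum>t<T. drift t) \<le> 4 * B * (2 * B * (nX * SA))"
      using sum_drift B1 by (intro mult_left_mono) auto
    finally show ?thesis by simp
  qed
  have s1: "(\<Sum>t<T. sqrt (\<kappa> t * Vr (S t) (Ac t) Vs)) \<le> 2 * sqrt (W0 * YT)"
  proof -
    have "(\<Sum>t<T. sqrt (\<kappa> t * Vr (S t) (Ac t) Vs)) \<le> sqrt ((\<Sum>t<T. \<kappa> t) * YT)"
      unfolding YT_def by (rule sum_sqrt_le) (auto simp: \<kappa>_nonneg intro!: Vr_nonneg)
    also have "\<dots> \<le> sqrt (4 * (W0 * YT))"
      using mult_right_mono[OF sum_\<kappa> YT_nonneg] mult_nonneg_nonneg[OF _ YT_nonneg, of W0] W0_ge
      by (intro real_sqrt_le_mono) simp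
    finally show ?thesis by (simp add: real_sqrt_mult)
  qed
  have s2: "(\<Sum>t<T. sqrt (nX * \<kappa> t * U t)) \<le> 2 * sqrt (nX * W0 * ZT) + 4 * GG"
  proof -
    have nW: "0 \<le> nX * W0" using nX_ge W0_ge by simp
    have "(\<Sum>t<T. sqrt (nX * \<kappa> t * U t)) \<le> sqrt ((\<Sum>t<T. nX * \<kappa> t) * (\<Sum>t<T. U t))"
      by (rule sum_sqrt_le) (use \<kappa>_nonneg U0 nX_ge in auto)
    also have "\<dots> \<le> sqrt ((nX * (2 * W0)) * (2 * ZT + 8 * (B * (B * (nX * SA)))))"
    proof (intro real_sqrt_le_mono mult_mono UZ)
      have "(\<Sum>t<T. nX * \<kappa> t) = nX * (\<Sum>t<T. \<kappa> t)" by (simp add: sum_distrib_left)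
      also have "\<dots> \<le> nX * (2 * W0)" using sum_\<kappa> nX_ge by (intro mult_left_mono) auto
      finally show "(\<Sum>t<T. nX * \<kappa> t) \<le> nX * (2 * W0)" .
    qed (use nW sum_nonneg[of "{..<T}" U] U0 in auto)
    also have "\<dots> = sqrt (4 * (nX * W0 * ZT) + 16 * (GG * (B * (nX * SA))))"
      by (simp add: GG_def algebra_simps)
    also have "\<dots> \<le> sqrt (4 * (nX * W0 * ZT) + (4 * GG)\<^sup>2)"
    proof (rule real_sqrt_le_mono)
      have "GG * (B * (nX * SA)) \<le> GG * GG" using GG_ge by (intro mult_left_mono) auto
      then show "4 * (nX * W0 * ZT) + 16 * (GG * (B * (nX * SA))) \<le> 4 * (nX * W0 * ZT) + (4 * GG)\<^sup>2"
        by (simp add: power2_eq_square)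
    qed
    also have "\<dots> \<le> sqrt (4 * (nX * W0 * ZT)) + sqrt ((4 * GG)\<^sup>2)"
      using nW ZT_nonneg by (intro sqrt_add_le_add_sqrt) auto
    also have "sqrt ((4 * GG)\<^sup>2) = 4 * GG" unfolding real_sqrt_abs using GG_ge by simp
    also have "sqrt (4 * (nX * W0 * ZT)) = 2 * sqrt (nX * W0 * ZT)" by (simp add: real_sqrt_mult)
    finally show ?thesis by simp
  qed
  have s3: "(\<Sum>t<T. B * (nX * \<kappa> t)) \<le> 2 * GG"
  proof -
    have "(\<Sum>t<T. B * (nX * \<kappa> t)) = B * (nX * (\<Sum>t<T. \<kappa> t))" by (simp add: sum_distrib_left)
    also have "\<dots> \<le> B * (nX * (2 * W0))" using sum_\<kappa> B1 nX_ge by (intro mult_left_mono) auto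
    finally show ?thesis by (simp add: GG_def)
  qed
  have s4: "(\<Sum>t<T. if n_vis t = 0 then 3 * B else 0) \<le> 3 * GG"
  proof -
    have "(\<Sum>t<T. if n_vis t = 0 then 3 * B else 0) = 3 * B * (\<Sum>t<T. if n_vis t = 0 then 1 else 0)"
      unfolding sum_distrib_left by (intro sum.cong) auto
    also have "\<dots> \<le> 3 * B * W0" using sum_first_visits[of T] W0_ge B1 by (intro mult_left_mono) auto
    finally show ?thesis using GG_ge by simp
  qed
  have "ET = (\<Sum>t<T. drift t) + (\<Sum>t<T. if n_vis t = 0 then 3 * B else 0) +
      CC * ((\<Sum>t<T. sqrt (\<kappa> t * Vr (S t) (Ac t) Vs)) + (\<Sum>t<T. sqrt (nX * \<kappa> t * U t)) + (\<Sum>t<T. B * (nX * \<kappa> t)))"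
    unfolding ET_def err_def U_def by (simp only: sum.distrib flip: sum_distrib_left)
  also have "\<dots> \<le> 2 * GG + 3 * GG + CC * (2 * sqrt (W0 * YT) + (2 * sqrt (nX * W0 * ZT) + 4 * GG) + 2 * GG)"
  proof (intro add_mono mult_left_mono s1 s2 s3 s4)
    show "(\<Sum>t<T. drift t) \<le> 2 * GG" using sum_drift[of T] GG_ge by simp
  qed (use CC_ge in auto)
  also have "\<dots> \<le> CE * (sqrt (W0 * YT) + sqrt (nX * W0 * ZT) + GG)"
  proof -
    have "0 \<le> sqrt (W0 * YT)" "0 \<le> sqrt (nX * W0 * ZT)"
      using W0_ge YT_nonneg ZT_nonneg nX_ge by auto
    then have "(2 * CC) * sqrt (W0 * YT) \<le> CE * sqrt (W0 * YT)" "(2 * CC) * sqrt (nX * W0 * ZT) \<le> CE * sqrt (nX * W0 * ZT)"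
      using CC_ge unfolding C_err_def by (intro mult_right_mono; simp)+
    then show ?thesis unfolding C_err_def by (simp add: algebra_simps)
  qed
  finally show ?thesis .
qed

text \<open>The state at which the drop is measured varies with time. Adding the nonnegative drops
  at all other states makes the sum telescope.\<close>

lemma V_drop_sum: "(\<Sum>t<T. V t (Y t) - V (Suc t) (Y t)) \<le> 2 * B * nX"
proof -
  have "(\<Sum>t<T. V t (Y t) - V (Suc t) (Y t)) \<le> (\<Sum>t<T. \<Sum>y\<in>next_states M. V t y - V (Suc t) y)"
  proof (rule sum_mono)
    fix t
    show "V t (Y t) - V (Suc t) (Y t) \<le> (\<Sum>y\<in>next_states M. V t y - V (Suc t) y)"
      by (rule member_le_sum) (use V_Suc_le in auto)
  qed
  also have "\<dots> = (\<Sum>y\<in>next_states M. V 0 y - V T y)"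
    by (subst sum.swap) (intro sum.cong refl sum_lessThan_telescope')
  also have "\<dots> \<le> (\<Sum>y\<in>next_states M. 2 * B)"
  proof (rule sum_mono)
    fix y assume y: "y \<in> next_states M"
    show "V 0 y - V T y \<le> 2 * B" using V_le_B[of 0 y] optimistic(2)[OF y, of T] Vs_abs_le_B[OF y] by linarith
  qed
  finally show ?thesis by (simp add: nX_def mult_ac)
qed

text \<open>Episode boundaries only help: \<open>X\<close> vanishes at the terminal state and is
  nonnegative at the restart.\<close>

lemma X_next: "X t (Y t) \<le> X (Suc t) (Some (S (Suc t))) + (V t (Y t) - V (Suc t) (Y t))"
proof (cases "Y t")
  case None
  then show ?thesis using X_bounds(1)[of "Some (S (Suc t))" "Suc t"] by simp
next
  case (Some s)
  then have "S (Suc t) = s" by (simp add: S_Suc)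
  then show ?thesis using Some by (simp add: X_def)
qed

lemma X_step_sum: "(\<Sum>t<T. X t (Y t) - X t (Some (S t))) \<le> 4 * B * nX"
proof -
  have "(\<Sum>t<T. X t (Y t) - X t (Some (S t))) \<le>
      (\<Sum>t<T. (X (Suc t) (Some (S (Suc t))) - X t (Some (S t))) + (V t (Y t) - V (Suc t) (Y t)))"
    by (rule sum_mono) (use X_next in \<open>simp add: algebra_simps\<close>)
  also have "\<dots> = X T (Some (S T)) - X 0 (Some (S 0)) + (\<Sum>t<T. V t (Y t) - V (Suc t) (Y t))"
    unfolding sum.distrib by (simp only: sum_lessThan_telescope[of "\<lambda>t. X t (Some (S t))"])
  also have "\<dots> \<le> 2 * B + 2 * B * nX"
    using X_bounds(2)[of "Some (S T)" T] X_bounds(1)[of "Some (S 0)" 0] V_drop_sum by simp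
  also have "\<dots> \<le> 4 * B * nX" using B1 nX_ge mult_left_mono[OF nX_ge, of B] by simp
  finally show ?thesis .
qed

lemma X_square_step_sum: "(\<Sum>t<T. (X t (Y t))\<^sup>2 - (X t (Some (S t)))\<^sup>2) \<le> 12 * (B * (B * nX))"
proof -
  have st: "(X t (Y t))\<^sup>2 - (X t (Some (S t)))\<^sup>2 \<le>
      ((X (Suc t) (Some (S (Suc t))))\<^sup>2 - (X t (Some (S t)))\<^sup>2) + 4 * B * (V t (Y t) - V (Suc t) (Y t))" for t
  proof -
    let ?x = "X t (Y t)" and ?x' = "X (Suc t) (Some (S (Suc t)))" and ?z = "V t (Y t) - V (Suc t) (Y t)"
    have z: "0 \<le> ?z" using V_Suc_le by simp
    have b: "0 \<le> ?x" "?x \<le> 2 * B" "0 \<le> ?x'" "?x' \<le> 2 * B" using X_bounds by auto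
    have "?x\<^sup>2 - ?x'\<^sup>2 \<le> 4 * B * ?z"
    proof (cases "?x \<le> ?x'")
      case True
      then have "?x\<^sup>2 \<le> ?x'\<^sup>2" using b by (intro power_mono) auto
      moreover have "0 \<le> 4 * B * ?z" using B1 z by simp
      ultimately show ?thesis by linarith
    next
      case False
      have "?x\<^sup>2 - ?x'\<^sup>2 = (?x + ?x') * (?x - ?x')" by (simp add: power2_eq_square algebra_simps)
      also have "\<dots> \<le> (4 * B) * ?z" using b False X_next[of t] B1 by (intro mult_mono) auto
      finally show ?thesis .
    qed
    then show ?thesis by linarith
  qed
  have "(\<Sum>t<T. (X t (Y t))\<^sup>2 - (X t (Some (S t)))\<^sup>2) \<le>
     (\<Sum>t<T. ((X (Suc t) (Some (S (Suc t))))\<^sup>2 - (X t (Some (S t)))\<^sup>2) + 4 * B * (V t (Y t) - V (Suc t) (Y t)))"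
    by (intro sum_mono st)
  also have "\<dots> = (X T (Some (S T)))\<^sup>2 - (X 0 (Some (S 0)))\<^sup>2 + 4 * B * (\<Sum>t<T. V t (Y t) - V (Suc t) (Y t))"
    unfolding sum.distrib sum_distrib_left[symmetric] by (simp only: sum_lessThan_telescope[of "\<lambda>t. (X t (Some (S t)))\<^sup>2"])
  also have "\<dots> \<le> (2 * B)\<^sup>2 + 4 * B * (2 * B * nX)"
  proof -
    have "(X T (Some (S T)))\<^sup>2 \<le> (2 * B)\<^sup>2" using X_bounds[of "Some (S T)" T] by (intro power_mono) auto
    moreover have "4 * B * (\<Sum>t<T. V t (Y t) - V (Suc t) (Y t)) \<le> 4 * B * (2 * B * nX)"
      using V_drop_sum B1 by (intro mult_left_mono) auto
    ultimately show ?thesis using zero_le_power2[of "X 0 (Some (S 0))"] by linarith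
  qed
  also have "\<dots> \<le> 12 * (B * (B * nX))"
    using mult_left_mono[OF nX_ge, of "B * B"] by (simp add: power2_eq_square)
  finally show ?thesis .
qed

lemma len1_H: "len1 (H T) = T"
  using T by simp

lemma YY_H: "YY (H T) = YT" and ZZ_H: "ZZ (H T) = ZT"
  unfolding YY_def ZZ_def YT_def ZT_def sumh_prefix_of Xc_eq by simp_all

lemma ln_delta_io: "ln (1 / \<delta>) \<le> io T"
  using ln_delta_le lnln1_nonneg[of "B * real T"] unfolding io_SA by linarith

text \<open>Each variance splits into a martingale difference of squares, a telescoping difference,
  and the square of \<open>X\<close> at the current state minus the square of its backup. The last
  part is at most \<open>4 * B * err t\<close>, because \<open>X\<close> exceeds its backup by at
  most the error. The martingale part returns \<open>ZT / 2\<close>, which is moved to the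
  left.\<close>

lemma ZT_le: "ZT \<le> 88 * (B * GG) + 8 * (B * ET)"
proof -
  have m3: "(\<Sum>t<T. Pv M (S t) (Ac t) (\<lambda>y. (X t y)\<^sup>2) - (X t (Y t))\<^sup>2) \<le> ZT / 2 + 32 * B\<^sup>2 * ln (1 / \<delta>)"
    using nice[of T] unfolding nice_at_def sumh_prefix_of Xc_eq ZZ_H by blast
  have sq: "(X t (Some (S t)))\<^sup>2 - (Pv M (S t) (Ac t) (X t))\<^sup>2 \<le> 4 * B * err t" for t
  proof -
    let ?x = "X t (Some (S t))" and ?m = "Pv M (S t) (Ac t) (X t)"
    have m: "0 \<le> ?m" "?m \<le> 2 * B"
      using Pv_ge_const[of "S t" "Ac t" 0 "X t"] Pv_le_const[of "S t" "Ac t" "X t" "2 * B"] X_bounds by auto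
    have x: "0 \<le> ?x" "?x \<le> 2 * B" using X_bounds by auto
    show ?thesis
    proof (cases "?x \<le> ?m")
      case True
      then have "?x\<^sup>2 \<le> ?m\<^sup>2" using x by (intro power_mono) auto
      moreover have "0 \<le> 4 * B * err t" using B1 err_nonneg by simp
      ultimately show ?thesis by linarith
    next
      case False
      have "?x\<^sup>2 - ?m\<^sup>2 = (?x + ?m) * (?x - ?m)" by (simp add: power2_eq_square algebra_simps)
      also have "\<dots> \<le> (4 * B) * err t"
        using m x False X_S_le[of t] by (intro mult_mono) auto
      finally show ?thesis .
    qed
  qed
  have "ZT = (\<Sum>t<T. (Pv M (S t) (Ac t) (\<lambda>y. (X t y)\<^sup>2) - (X t (Y t))\<^sup>2) + ((X t (Y t))\<^sup>2 - (X t (Some (S t)))\<^sup>2) +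
      ((X t (Some (S t)))\<^sup>2 - (Pv M (S t) (Ac t) (X t))\<^sup>2))"
    unfolding ZT_def Vr_def by (intro sum.cong refl) simp
  also have "\<dots> \<le> (ZT / 2 + 32 * B\<^sup>2 * ln (1 / \<delta>)) + 12 * (B * (B * nX)) + (\<Sum>t<T. 4 * B * err t)"
    unfolding sum.distrib by (intro add_mono m3 X_square_step_sum sum_mono sq)
  also have "(\<Sum>t<T. 4 * B * err t) = 4 * (B * ET)" by (simp add: ET_def sum_distrib_left mult_ac)
  finally have "ZT \<le> 64 * (B\<^sup>2 * ln (1 / \<delta>)) + 24 * (B * (B * nX)) + 8 * (B * ET)" by simp
  moreover have "B\<^sup>2 * ln (1 / \<delta>) \<le> B * GG"
  proof -
    have "B * (B * ln (1 / \<delta>)) \<le> B * (B * io T)" using ln_delta_io B1 by (intro mult_left_mono) auto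
    also have "\<dots> \<le> B * GG" using GG_ge B1 by (intro mult_left_mono) auto
    finally show ?thesis by (simp add: power2_eq_square mult.assoc)
  qed
  moreover have "B * (B * nX) \<le> B * GG" using GG_ge B1 by (intro mult_left_mono) auto
  ultimately show ?thesis by linarith
qed

text \<open>\<open>ZT_le\<close> contains a factor \<open>B\<close>, and \<open>B * nX * W0\<close>
  is \<open>GG\<close>. The weight \<open>\<theta>\<close> stays free so that each use can choose
  the coefficient of \<open>ET\<close>.\<close>

lemma nXZ_le: "0 < \<theta> \<Longrightarrow> sqrt (nX * W0 * ZT) \<le> \<theta> * GG / 2 + (88 * GG + 8 * ET) / (2 * \<theta>)"
proof -
  assume \<theta>: "0 < \<theta>"
  have "nX * W0 * ZT \<le> nX * W0 * (88 * (B * GG) + 8 * (B * ET))"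
    using ZT_le nX_ge W0_ge by (intro mult_left_mono) auto
  also have "\<dots> = GG * (88 * GG + 8 * ET)" by (simp add: GG_def algebra_simps)
  finally have "sqrt (nX * W0 * ZT) \<le> sqrt (GG * (88 * GG + 8 * ET))" by simp
  also have "\<dots> \<le> \<theta> * GG / 2 + (88 * GG + 8 * ET) / (2 * \<theta>)"
    using \<theta> GG_ge ET_nonneg by (intro sqrt_mult_le_scaled) auto
  finally show ?thesis .
qed

lemma ET_le': "ET \<le> (16 * CE\<^sup>2 + 6 * CE) * (sqrt (W0 * YT) + GG)"
proof -
  let ?q = "sqrt (W0 * YT)"
  note CE = CE_ge
  have q: "0 \<le> ?q" using W0_ge YT_nonneg by simp
  \<comment> \<open>With the weight \<open>16 * CE\<close>, multiplication by \<open>CE\<close>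
    leaves only \<open>ET / 4\<close>, which is moved to the left.\<close>
  have "sqrt (nX * W0 * ZT) \<le> (16 * CE) * GG / 2 + (88 * GG + 8 * ET) / (2 * (16 * CE))"
    by (rule nXZ_le) (use CE in simp)
  then have "CE * sqrt (nX * W0 * ZT) \<le> CE * ((16 * CE) * GG / 2 + (88 * GG + 8 * ET) / (2 * (16 * CE)))"
    using CE by (intro mult_left_mono) auto
  also have "\<dots> = 8 * CE\<^sup>2 * GG + 88 / 32 * GG + ET / 4"
    using CE by (simp add: field_simps power2_eq_square)
  also have "88 / 32 * GG \<le> CE * GG" using CE GG_ge by (intro mult_right_mono) auto
  finally have "CE * sqrt (nX * W0 * ZT) \<le> 8 * CE\<^sup>2 * GG + CE * GG + ET / 4" by simp
  moreover have "ET \<le> CE * ?q + CE * sqrt (nX * W0 * ZT) + CE * GG"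
    using ET_le by (simp only: distrib_left)
  ultimately have "ET \<le> 2 * (CE * ?q) + 16 * CE\<^sup>2 * GG + 4 * (CE * GG)"
    using ET_nonneg CE q GG_ge mult_nonneg_nonneg[of CE ?q] mult_nonneg_nonneg[of CE GG]
      mult_nonneg_nonneg[of "CE\<^sup>2" GG] by linarith
  moreover have "2 * (CE * ?q) \<le> (16 * CE\<^sup>2 + 6 * CE) * ?q"
  proof -
    have "(2 * CE) * ?q \<le> (16 * CE\<^sup>2 + 6 * CE) * ?q" using q CE by (intro mult_right_mono) auto
    then show ?thesis by (simp only: mult.assoc)
  qed
  moreover have "0 \<le> 2 * (CE * GG)" using CE GG_ge by simp
  ultimately show ?thesis by (simp add: distrib_left distrib_right)
qed

text \<open>Sum of \<open>adv_eq\<close> over time. The 169 is made of 143 from the root, 22 from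
  the rest of the martingale bound and 4 from the telescoping part.\<close>

lemma Gam_le: "Gam \<le> 12 * ET + 169 * GG"
proof -
  have m2: "(\<Sum>t<T. Pv M (S t) (Ac t) (X t) - X t (Y t)) \<le> 11 * (sqrt (ZT * io T) + 2 * B * io T)"
    using nice[of T] unfolding nice_at_def sumh_prefix_of Xc_eq ZZ_H len1_H by blast
  have "sqrt (ZT * io T) \<le> sqrt (nX * W0 * ZT)"
  proof (rule real_sqrt_le_mono)
    have "io T \<le> nX * W0" using W0_ge nXW0_ge by linarith
    from mult_right_mono[OF this ZT_nonneg] show "ZT * io T \<le> nX * W0 * ZT" by (simp only: mult.commute)
  qed
  also have "\<dots> \<le> 4 * GG / 2 + (88 * GG + 8 * ET) / (2 * 4)" by (rule nXZ_le) simp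
  also have "\<dots> = 13 * GG + ET" by simp
  finally have "11 * sqrt (ZT * io T) \<le> 143 * GG + 11 * ET" by simp
  moreover have "Gam \<le> ET + (\<Sum>t<T. Pv M (S t) (Ac t) (X t) - X t (Y t)) + (\<Sum>t<T. X t (Y t) - X t (Some (S t)))"
    unfolding Gam_def ET_def sum.distrib[symmetric] by (intro sum_mono adv_eq)
  ultimately show ?thesis
    using m2 X_step_sum GG_ge unfolding distrib_left[of 11] by linarith
qed

text \<open>At the end of an episode \<open>Vs (Y t)\<close> is zero although the next state is the
  initial one. Each finished episode thus leaves one copy of the optimal initial value, and the sum
  becomes the regret.\<close>

definition regT :: real where
  "regT = (\<Sum>t<T. Vs (Some (S t)) - rew M (S t) (Ac t) - Vs (Y t))"

abbreviation CG :: real where "CG \<equiv> C_gap c1 c2"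

lemma CG_ge: "1 \<le> CG"
  using CE_ge zero_le_power2[of CE] unfolding C_gap_def by (simp add: algebra_simps)

lemma Gam_le': "Gam \<le> CG * (sqrt (W0 * YT) + GG)"
proof -
  let ?q = "sqrt (W0 * YT)"
  have q: "0 \<le> ?q" using W0_ge YT_nonneg by simp
  have "12 * ET \<le> 12 * ((16 * CE\<^sup>2 + 6 * CE) * (?q + GG))" using ET_le' by simp
  moreover have "169 * GG \<le> 169 * (?q + GG)" using q by simp
  ultimately have "Gam \<le> 12 * ((16 * CE\<^sup>2 + 6 * CE) * (?q + GG)) + 169 * (?q + GG)"
    using Gam_le by linarith
  also have "\<dots> = CG * (?q + GG)" unfolding C_gap_def by (simp only: distrib_right mult.assoc)
  finally show ?thesis .
qed

lemma regT_le: "regT \<le> (CG + 22) * (sqrt (W0 * YT) + GG)"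
proof -
  let ?q = "sqrt (W0 * YT)"
  have q: "0 \<le> ?q" using W0_ge YT_nonneg by simp
  have "regT = Gam + (\<Sum>t<T. Pv M (S t) (Ac t) Vs - Vs (Y t))"
    unfolding regT_def Gam_def sum.distrib[symmetric] by (intro sum.cong refl) (simp add: adv_def)
  also have "(\<Sum>t<T. Pv M (S t) (Ac t) Vs - Vs (Y t)) \<le> 11 * (sqrt (YT * io T) + 2 * B * io T)"
    using nice[of T] unfolding nice_at_def sumh_prefix_of YY_H len1_H by blast
  also have "sqrt (YT * io T) \<le> ?q"
    using mult_left_mono[OF W0_ge(2) YT_nonneg] by (simp add: mult.commute)
  finally have "regT \<le> Gam + 11 * (?q + 2 * B * io T)" by simp
  then have "regT \<le> Gam + 22 * (?q + GG)" using GG_ge q unfolding distrib_left[of 11] distrib_left[of 22] by linarith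
  then have "regT \<le> CG * (?q + GG) + 22 * (?q + GG)" using Gam_le' by linarith
  then show ?thesis by (simp only: distrib_right)
qed

section \<open>Solving the quadratic inequality\<close>

definition K :: nat where "K = nep (H T)"

definition ell :: real where "ell = ln (Rmax M * real K / (R_bound M * \<delta>))"

lemma R_le: "R_bound M \<le> Rmax M"
  unfolding R_bound_def by (rule R_from_le_Rmax) simp

context
  assumes K: "1 \<le> K"
begin

lemma ell_ge: "ln (real K / \<delta>) \<le> ell" "4 \<le> ell" "ln (1 / \<delta>) \<le> ell"
proof -
  have Kd: "0 < real K / \<delta>" using K \<delta> by simp
  have "1 * (real K / \<delta>) \<le> (Rmax M / R_bound M) * (real K / \<delta>)"
    using R_le Rpos Kd by (intro mult_right_mono) auto
  then show 1: "ln (real K / \<delta>) \<le> ell" unfolding ell_def using Kd by (intro ln_mono) auto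
  have "ln (1 / \<delta>) \<le> ln (real K / \<delta>)" using K \<delta> by (intro ln_mono divide_right_mono) auto
  then show "4 \<le> ell" "ln (1 / \<delta>) \<le> ell" using 1 ln_delta by linarith+
qed

lemma nep_H_le: "t \<le> T \<Longrightarrow> nep (H t) \<le> K"
  unfolding K_def by (rule lift_Suc_mono_le[of "\<lambda>t. nep (H t)"]) (auto simp: H_Suc simp del: upt_Suc)

text \<open>At most \<open>K\<close> episodes are finished, so the argument of the logarithm is at
  most \<open>12 * (real K)\<^sup>2 / \<delta>\<close>. As \<open>ln 12\<close> is below 4 and hence
  below \<open>ln (1 / \<delta>)\<close>, the logarithm is at most \<open>3 * ell\<close>.\<close>

lemma Acur_H_le: "t \<le> T \<Longrightarrow> Acur (H t) \<le> 12 * (Rmax M * ell)"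
proof -
  assume t: "t \<le> T"
  let ?k = "nep (H t)"
  have k: "real ?k \<le> real K" using nep_H_le[OF t] by simp
  have K1: "1 \<le> real K" using K by simp
  have "2 * (real (?k + 1) * real (?k + 2) / \<delta>) \<le> 12 * ((real K)\<^sup>2 / \<delta>)"
  proof -
    have "real (?k + 1) * real (?k + 2) \<le> (2 * real K) * (3 * real K)"
      using k K1 by (intro mult_mono) auto
    then have "real (?k + 1) * real (?k + 2) / \<delta> \<le> (6 * (real K)\<^sup>2) / \<delta>"
      using \<delta> by (intro divide_right_mono) (auto simp: power2_eq_square)
    then show ?thesis by simp
  qed
  then have "ln (2 * (real (?k + 1) * real (?k + 2) / \<delta>)) \<le> ln (12 * ((real K)\<^sup>2 / \<delta>))"
    by (rule ln_mono) (use \<delta> in \<open>auto intro!: mult_pos_pos divide_pos_pos\<close>)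
  also have "\<dots> = ln 12 + 2 * ln (real K) + ln (1 / \<delta>)"
    using K1 \<delta> by (simp add: ln_mult ln_div ln_realpow)
  also have "ln (12::real) \<le> 4"
  proof -
    have "ln (12::real) = 2 * ln 2 + ln 3" using ln_mult[of 4 "3::real"] ln_realpow[of "2::real" 2] by simp
    then show ?thesis using ln_2_less_1 ln_le_minus_one[of "3::real"] by simp
  qed
  also have "4 + 2 * ln (real K) + ln (1 / \<delta>) \<le> 3 * ell"
  proof -
    have "ln (real K / \<delta>) = ln (real K) + ln (1 / \<delta>)" using K1 \<delta> by (simp add: ln_div)
    then show ?thesis using ell_ge ln_delta by linarith
  qed
  finally have "ln (2 * (real (?k + 1) * real (?k + 2) / \<delta>)) \<le> 3 * ell" by simp
  then have "4 * Rmax M * ln (2 * (real (?k + 1) * real (?k + 2) / \<delta>)) \<le> 4 * Rmax M * (3 * ell)"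
    using Rmax_nonneg by (intro mult_left_mono) auto
  moreover have "Acur (H t) \<le> 4 * Rmax M * ln (2 * (real (?k + 1) * real (?k + 2) / \<delta>))"
    using nice[of t] unfolding nice_at_def by blast
  ultimately show ?thesis by linarith
qed

text \<open>In each term of \<open>SG\<close> the bracket is at most
  \<open>13 * (Rmax M * ell)\<close>: 12 for the gaps so far and 1 for the current gap, which is at
  most \<open>2 * Rmax M\<close> while \<open>ell\<close> is at least 4. The 104 is
  \<open>2 * 4 * 13\<close>.\<close>

lemma YT_le: "YT \<le> 104 * (Rmax M * ell * Gam) + (4 * ((R_bound M)\<^sup>2 * real K) + 72 * ((Rmax M)\<^sup>2 * ell))"
proof -
  have "SG (H T) = (\<Sum>t<T. 4 * adv (S t) (Ac t) * (Acur (H t) + adv (S t) (Ac t)))"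
    unfolding SG_def sumh_prefix_of ..
  also have "\<dots> \<le> (\<Sum>t<T. 4 * adv (S t) (Ac t) * (13 * (Rmax M * ell)))"
  proof (intro sum_mono mult_left_mono)
    fix t assume "t \<in> {..<T}"
    then have "Acur (H t) \<le> 12 * (Rmax M * ell)" by (intro Acur_H_le) simp
    moreover have "adv (S t) (Ac t) \<le> Rmax M * ell"
    proof -
      have "adv (S t) (Ac t) \<le> Rmax M * 2" using adv_le[of "S t" "Ac t"] by simp
      also have "\<dots> \<le> Rmax M * ell" using ell_ge Rmax_nonneg by (intro mult_left_mono) auto
      finally show ?thesis .
    qed
    ultimately show "Acur (H t) + adv (S t) (Ac t) \<le> 13 * (Rmax M * ell)" by linarith
  qed (auto intro!: mult_nonneg_nonneg adv_nonneg)
  also have "\<dots> = 52 * (Rmax M * ell * Gam)" by (simp add: Gam_def sum_distrib_left sum_distrib_right mult_ac)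
  finally have SG: "SG (H T) \<le> 52 * (Rmax M * ell * Gam)" .
  have "YT / 2 \<le> SG (H T) + 2 * (R_bound M)\<^sup>2 * real K + 18 * (Rmax M)\<^sup>2 * ln (2 / \<delta>)"
    using nice[of T] unfolding nice_at_def YY_H K_def by blast
  moreover have "18 * (Rmax M)\<^sup>2 * ln (2 / \<delta>) \<le> 18 * (Rmax M)\<^sup>2 * (2 * ell)"
  proof (rule mult_left_mono)
    have "ln (2 / \<delta>) = ln 2 + ln (1 / \<delta>)" using \<delta> by (simp add: ln_div)
    then show "ln (2 / \<delta>) \<le> 2 * ell" using ell_ge ln_2_less_1 by linarith
  qed simp
  ultimately show ?thesis using SG by linarith
qed

text \<open>Here the loop closes: \<open>YT\<close> is bounded through \<open>Gam\<close>, and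
  \<open>Gam\<close> through \<open>?q\<close>. The weight \<open>CG\<close> in the
  arithmetic-geometric mean cancels the constant of \<open>Gam_le'\<close>, so exactly half of
  \<open>?q\<close> comes back and is absorbed.\<close>

lemma q_le: "sqrt (W0 * YT) \<le> (104 * CG + 18) * (W0 * (Rmax M * ell)) + GG + 4 * (R_bound M * sqrt (W0 * real K))"
proof -
  let ?q = "sqrt (W0 * YT)" and ?W = "W0 * (Rmax M * ell)"
  note CG = CG_ge
  have W: "0 \<le> ?W" using W0_ge ell_ge Rmax_nonneg by simp
  have "W0 * YT \<le> W0 * (104 * (Rmax M * ell * Gam) + (4 * ((R_bound M)\<^sup>2 * real K) + 72 * ((Rmax M)\<^sup>2 * ell)))"
    using YT_le W0_ge by (intro mult_left_mono) auto
  also have "\<dots> = (104 * ?W) * Gam + (4 * ((R_bound M)\<^sup>2 * (W0 * real K)) + 72 * ((Rmax M)\<^sup>2 * (W0 * ell)))"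
    by (simp add: algebra_simps)
  finally have "?q \<le> sqrt ((104 * ?W) * Gam + (4 * ((R_bound M)\<^sup>2 * (W0 * real K)) + 72 * ((Rmax M)\<^sup>2 * (W0 * ell))))"
    by (rule real_sqrt_le_mono)
  also have "\<dots> \<le> sqrt ((104 * ?W) * Gam) + sqrt (4 * ((R_bound M)\<^sup>2 * (W0 * real K)) + 72 * ((Rmax M)\<^sup>2 * (W0 * ell)))"
    using W Gam_nonneg W0_ge ell_ge by (intro sqrt_add_le_add_sqrt) auto
  also have "sqrt (4 * ((R_bound M)\<^sup>2 * (W0 * real K)) + 72 * ((Rmax M)\<^sup>2 * (W0 * ell))) \<le>
      sqrt (4 * ((R_bound M)\<^sup>2 * (W0 * real K))) + sqrt (72 * ((Rmax M)\<^sup>2 * (W0 * ell)))"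
    using W0_ge ell_ge by (intro sqrt_add_le_add_sqrt) auto
  also have "sqrt (4 * ((R_bound M)\<^sup>2 * (W0 * real K))) = 2 * (R_bound M * sqrt (W0 * real K))"
    using Rpos by (simp add: real_sqrt_mult)
  also have "sqrt (72 * ((Rmax M)\<^sup>2 * (W0 * ell))) \<le> 9 * ?W"
  proof (rule real_le_lsqrt)
    have "1 * 1 \<le> W0 * ell" using W0_ge ell_ge by (intro mult_mono) auto
    then have "(W0 * ell) * 1 \<le> (W0 * ell) * (W0 * ell)" by (intro mult_left_mono) auto
    then have "72 * ((Rmax M)\<^sup>2 * (W0 * ell)) \<le> 81 * ((Rmax M)\<^sup>2 * ((W0 * ell) * (W0 * ell)))"
      using W0_ge ell_ge by (intro mult_mono) auto
    then show "72 * ((Rmax M)\<^sup>2 * (W0 * ell)) \<le> (9 * ?W)\<^sup>2" by (simp add: power2_eq_square mult_ac)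
  qed (use W in auto)
  also have "sqrt ((104 * ?W) * Gam) \<le> CG * (104 * ?W) / 2 + Gam / (2 * CG)"
    using W Gam_nonneg CG by (intro sqrt_mult_le_scaled) auto
  also have "Gam / (2 * CG) \<le> (CG * (?q + GG)) / (2 * CG)"
    using Gam_le' CG by (intro divide_right_mono) auto
  also have "\<dots> = ?q / 2 + GG / 2" using CG by (simp add: add_divide_distrib)
  finally have "?q \<le> CG * (104 * ?W) / 2 + (?q / 2 + GG / 2) + (2 * (R_bound M * sqrt (W0 * real K)) + 9 * ?W)" by simp
  then have "?q \<le> 104 * (CG * ?W) + GG + 4 * (R_bound M * sqrt (W0 * real K)) + 18 * ?W" by linarith
  then show ?thesis by (simp only: distrib_right mult.assoc)
qed

lemma regT_bound:
  "regT \<le> 4 * ((CG + 22) * (104 * CG + 18)) * regret_bound M B \<delta> K T"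
proof -
  let ?W = "W0 * (Rmax M * ell)" and ?r = "R_bound M * sqrt (W0 * real K)"
  define St where "St = real (card (states M))"
  define An where "An = real (card (actions M))"
  define Lm where "Lm = io T * ln1 (real T)"
  have Sge: "1 \<le> St" and Age: "1 \<le> An" using card_pos by (simp_all add: St_def An_def)
  have Lge: "4 \<le> Lm" using io_ln1 by (simp add: Lm_def)
  note CG = CG_ge
  have W: "0 \<le> ?W" using W0_ge ell_ge Rmax_nonneg by simp
  have r: "0 \<le> ?r" using Rpos W0_ge by simp
  have W0: "W0 = St * An * Lm" by (simp add: W0_def SA_def St_def An_def Lm_def)
  have G: "GG \<le> 2 * (B * St\<^sup>2 * An * Lm)"
  proof -
    have "nX * W0 \<le> (2 * St) * W0" using nX_le W0_ge by (intro mult_right_mono) (auto simp: St_def)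
    then have "B * (nX * W0) \<le> B * ((2 * St) * W0)" using B1 by (intro mult_left_mono) auto
    then show ?thesis by (simp add: GG_def W0 power2_eq_square mult_ac)
  qed
  have rb: "regret_bound M B \<delta> K T = ?r + ?W + B * St\<^sup>2 * An * Lm"
    unfolding regret_bound_def Let_def iota_tilde_def io_def[symmetric] W0 ell_def
    by (simp add: St_def An_def Lm_def mult_ac)
  let ?c = "104 * CG + 18"
  have c: "4 \<le> ?c" using CG by simp
  have Bg: "0 \<le> B * St\<^sup>2 * An * Lm" using B1 Sge Age Lge by simp
  have "sqrt (W0 * YT) + GG \<le> ?c * ?W + 4 * (B * St\<^sup>2 * An * Lm) + 4 * ?r"
    using q_le G by linarith
  also have "\<dots> \<le> ?c * ?W + ?c * (B * St\<^sup>2 * An * Lm) + ?c * ?r"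
    using c Bg r by (intro add_mono order_refl mult_right_mono)
  also have "\<dots> = ?c * regret_bound M B \<delta> K T" unfolding rb by (simp only: distrib_left)
  finally have *: "sqrt (W0 * YT) + GG \<le> ?c * regret_bound M B \<delta> K T" .
  have nn: "0 \<le> regret_bound M B \<delta> K T" unfolding rb using r W Bg by simp
  have "regT \<le> (CG + 22) * (sqrt (W0 * YT) + GG)" by (rule regT_le)
  also have "\<dots> \<le> (CG + 22) * (?c * regret_bound M B \<delta> K T)" using * CG by (intro mult_left_mono) auto
  also have "\<dots> \<le> 4 * ((CG + 22) * ?c * regret_bound M B \<delta> K T)"
  proof -
    have "0 \<le> (CG + 22) * ?c * regret_bound M B \<delta> K T" using CG c nn by (intro mult_nonneg_nonneg) auto
    then show ?thesis by (simp only: mult.assoc)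
  qed
  finally show ?thesis by (simp only: mult.assoc)
qed

end

end

end

section \<open>Counting episodes\<close>

lemma card_nxt_None: "card {i. i < t \<and> nxt (\<omega> i) = None} = nep (prefix_of \<omega> t)"
proof (induction t)
  case (Suc t)
  have "{i. i < Suc t \<and> nxt (\<omega> i) = None} =
      {i. i < t \<and> nxt (\<omega> i) = None} \<union> (if nxt (\<omega> t) = None then {t} else {})"
    by (auto simp: less_Suc_eq)
  then show ?case using Suc by (simp add: card_insert_if)
qed simp

lemma total_steps_eq: "total_steps \<omega> K = (LEAST t. nep (prefix_of \<omega> t) = K)"
  by (simp only: total_steps_def card_nxt_None)

lemma nep_prefix_mono: "s \<le> t \<Longrightarrow> nep (prefix_of \<omega> s) \<le> nep (prefix_of \<omega> t)"
  by (rule lift_Suc_mono_le[of "\<lambda>t. nep (prefix_of \<omega> t)"]) auto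

text \<open>The count grows by at most one per step, so it equals \<open>K\<close> at the first time
  it reaches \<open>K\<close>.\<close>

lemma ex_nep_eq:
  assumes inf: "\<forall>m. \<exists>i\<ge>m. nxt (\<omega> i) = None"
  shows "\<exists>t. nep (prefix_of \<omega> t) = K"
proof -
  have ex: "\<exists>t. K \<le> nep (prefix_of \<omega> t)"
  proof (induction K)
    case (Suc K)
    then obtain t where t: "K \<le> nep (prefix_of \<omega> t)" by blast
    obtain i where i: "t \<le> i" "nxt (\<omega> i) = None" using inf by blast
    have "Suc K \<le> nep (prefix_of \<omega> (Suc i))" using t nep_prefix_mono[OF i(1), of \<omega>] i(2) by simp
    then show ?case by blast
  qed simp
  define t where "t = (LEAST t. K \<le> nep (prefix_of \<omega> t))"
  have t: "K \<le> nep (prefix_of \<omega> t)" unfolding t_def by (rule LeastI_ex[OF ex])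
  have "nep (prefix_of \<omega> t) \<le> K"
  proof (cases t)
    case (Suc u)
    then have "\<not> K \<le> nep (prefix_of \<omega> u)" using not_less_Least[of u "\<lambda>t. K \<le> nep (prefix_of \<omega> t)"] t_def by simp
    then show ?thesis using Suc by simp
  qed simp
  with t show ?thesis by (intro exI[of _ t]) simp
qed

lemma nep_total_steps:
  assumes "\<forall>m. \<exists>i\<ge>m. nxt (\<omega> i) = None"
  shows "nep (prefix_of \<omega> (total_steps \<omega> K)) = K"
  unfolding total_steps_eq by (rule LeastI_ex[OF ex_nep_eq[OF assms]])

lemma total_steps_0 [simp]: "total_steps \<omega> 0 = 0"
  by (simp add: total_steps_def)

lemma total_steps_mono:
  assumes inf: "\<forall>m. \<exists>i\<ge>m. nxt (\<omega> i) = None"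
  shows "total_steps \<omega> K \<le> total_steps \<omega> (Suc K)"
  using nep_prefix_mono[of "total_steps \<omega> (Suc K)" "total_steps \<omega> K" \<omega>] nep_total_steps[OF inf]
  by (metis Suc_n_not_le_n nle_le)

lemma nxt_before_total_steps:
  assumes inf: "\<forall>m. \<exists>i\<ge>m. nxt (\<omega> i) = None" and K: "1 \<le> K"
  obtains u where "total_steps \<omega> K = Suc u" "nxt (\<omega> u) = None"
proof (cases "total_steps \<omega> K")
  case 0
  then show ?thesis using nep_total_steps[OF inf, of K] K by simp
next
  case (Suc u)
  have "nep (prefix_of \<omega> u) \<noteq> K"
    using not_less_Least[of u "\<lambda>t. nep (prefix_of \<omega> t) = K"] Suc unfolding total_steps_eq by simp
  moreover have "nep (prefix_of \<omega> (Suc u)) = K" using nep_total_steps[OF inf, of K] Suc by simp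
  ultimately have "nxt (\<omega> u) = None" by (auto split: if_splits)
  with Suc show ?thesis by (rule that)
qed

lemma regret_eq:
  assumes inf: "\<forall>m. \<exists>i\<ge>m. nxt (\<omega> i) = None"
  shows "regret M \<omega> K = real K * Vstar M (s_init M) - (\<Sum>t<total_steps \<omega> K. rew M (st (\<omega> t)) (ac (\<omega> t)))"
proof (induction K)
  case 0
  then show ?case by (simp add: regret_def)
next
  case (Suc K)
  let ?r = "\<lambda>t. rew M (st (\<omega> t)) (ac (\<omega> t))"
  have "(\<Sum>t<total_steps \<omega> (Suc K). ?r t) = (\<Sum>t<total_steps \<omega> K. ?r t) + (\<Sum>t\<in>{total_steps \<omega> K..<total_steps \<omega> (Suc K)}. ?r t)"
    using sum.atLeastLessThan_concat[of 0 "total_steps \<omega> K" "total_steps \<omega> (Suc K)" ?r] total_steps_mono[OF inf, of K]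
    by (simp add: atLeast0LessThan)
  moreover have "regret M \<omega> (Suc K) = regret M \<omega> K + (Vstar M (s_init M) - (\<Sum>t\<in>{total_steps \<omega> K..<total_steps \<omega> (Suc K)}. ?r t))"
    by (simp add: regret_def)
  ultimately show ?case using Suc by (simp add: algebra_simps)
qed

context good_run
begin

lemma sum_value_differences:
  "(\<Sum>t<T. Vs (Some (S t)) - Vs (Y t)) = Vs (Some (S 0)) - Vs (Some (S T)) + real (nep (H T)) * Vs (Some (s_init M))"
proof (induction T)
  case (Suc T)
  have "Vs (Y T) = Vs (Some (S (Suc T))) - (if Y T = None then Vs (Some (s_init M)) else 0)"
    unfolding S_Suc by (simp split: option.split)
  moreover have "real (nep (H (Suc T))) = real (nep (H T)) + (if Y T = None then 1 else 0)" by simp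
  ultimately show ?case using Suc by (cases "Y T = None") (simp_all add: algebra_simps del: upt_Suc)
qed simp

lemma regret_le:
  assumes inf: "\<forall>m. \<exists>i\<ge>m. nxt (\<omega> i) = None" and K: "1 \<le> k"
  shows "regret M \<omega> k \<le> 4 * ((C_gap c1 c2 + 22) * (104 * C_gap c1 c2 + 18)) * regret_bound M B \<delta> k (total_steps \<omega> k)"
proof -
  define T where "T = total_steps \<omega> k"
  obtain u where u: "T = Suc u" "nxt (\<omega> u) = None"
    using nxt_before_total_steps[OF inf K] unfolding T_def by metis
  have T1: "1 \<le> T" using u by simp
  have nepT: "nep (H T) = k" unfolding T_def by (rule nep_total_steps[OF inf])
  have ST: "S T = s_init M" unfolding u(1) S_Suc u(2) by simp
  have S0: "S 0 = s_init M" using cur_H[of 0] by simp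
  have "regT T = (\<Sum>t<T. Vs (Some (S t)) - Vs (Y t)) - (\<Sum>t<T. rew M (S t) (Ac t))"
    unfolding regT_def[OF T1] sum_subtractf[symmetric] by (intro sum.cong refl) simp
  also have "\<dots> = regret M \<omega> k"
    unfolding sum_value_differences regret_eq[OF inf] ST S0 nepT by (simp add: Vs_def T_def)
  finally have "regret M \<omega> k = regT T" ..
  also have "\<dots> \<le> 4 * ((C_gap c1 c2 + 22) * (104 * C_gap c1 c2 + 18)) * regret_bound M B \<delta> (nep (H T)) T"
    using regT_bound[OF T1] K nepT unfolding K_def[OF T1] by simp
  finally show ?thesis unfolding T_def nepT[unfolded T_def] .
qed

end

section \<open>Almost sure termination and the final probability bound\<close>

context vi_run
begin

text \<open>Properness speaks of policies within one episode, whereas the learner uses all earlier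
  ones; termination is therefore deduced from \<open>ht\<close>, which covers every choice of
  actions. From time \<open>m\<close> on, elapsed time plus \<open>ht\<close> is a nonnegative
  supermartingale, set to zero once an episode ends. If none ended it would exceed every level,
  which has probability zero.\<close>

lemma AE_every_episode_terminates: "AE \<omega> in space_meas. \<forall>m. \<exists>i\<ge>m. nxt (\<omega> i) = None"
proof (subst AE_all_countable, rule allI)
  fix m
  interpret prob_space space_meas unfolding interaction_def by (rule prob_space_seq_measure)
  define W where "W h = (if length h < m then htmax else if alive (drop m h)
      then real (length h - m) + ht (Some (cur h)) else 0)" for h
  have le: "ht (Some (cur h)) \<le> htmax" "0 \<le> ht (Some (cur h))" if "good_hist M h" for h
    using cur_in_states[OF that] by (auto intro: ht_le ht_nonneg)
  have step: "stepE W h \<le> W h" if h: "good_hist M h" for h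
  proof -
    note sa = cur_in_states[OF h] act_in_actions[OF h]
    show ?thesis
    proof (cases "length h < m")
      case True
      have "W (h @ [cur_tr h y]) \<le> htmax" if y: "y \<in> next_states M" for y
      proof -
        have "good_hist M (h @ [cur_tr h y])" using h sa y by (simp add: good_tr_def)
        from le(1)[OF this] have "ht (Some (cur (h @ [cur_tr h y]))) \<le> htmax" .
        moreover have "drop m (h @ [cur_tr h y]) = []" "length (h @ [cur_tr h y]) - m = 0" using True by simp_all
        ultimately show ?thesis unfolding W_def by (simp only: alive_simps if_True split: if_split) simp
      qed
      then have "stepE W h \<le> htmax" unfolding stepE_eq[OF h] by (intro Pv_le_const sa)
      then show ?thesis using True by (simp add: W_def)
    next
      case False
      show ?thesis
      proof (cases "alive (drop m h)")
        case True
        have "stepE W h \<le> Pcur h (\<lambda>y. (real (length h - m) + 1) + ht y)"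
          unfolding stepE_eq[OF h]
        proof (rule Pv_mono)
          fix y assume "y \<in> next_states M"
          show "W (h @ [cur_tr h y]) \<le> real (length h - m) + 1 + ht y"
            using False True by (cases y) (auto simp: W_def Suc_diff_le)
        qed
        also have "\<dots> = (real (length h - m) + 1) + Pcur h ht" by (rule Pv_add_const[OF sa])
        also have "\<dots> \<le> W h" using ht_step[OF sa] False True by (simp add: W_def)
        finally show ?thesis .
      next
        case dead: False
        have "W (h @ [cur_tr h y]) = 0" for y using False dead by (simp add: W_def)
        then show ?thesis unfolding stepE_eq[OF h] using False dead by (simp add: W_def Pv_const[OF sa])
      qed
    qed
  qed
  have W0: "W [] \<le> htmax" using le(1)[of "[]"] by (simp add: W_def)
  define A :: "(nat \<Rightarrow> ('s, 'a) transition) set" where "A = {\<omega>. \<forall>n. alive (drop m (prefix_of \<omega> n))}"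
  have A: "A \<in> events"
  proof -
    have "{\<omega>. \<exists>n. \<not> alive (drop m (prefix_of \<omega> n))} \<in> events"
      unfolding interaction_def by (rule sets_ex_prefix)
    then have "space space_meas - {\<omega>. \<exists>n. \<not> alive (drop m (prefix_of \<omega> n))} \<in> events" by (rule sets.compl_sets)
    moreover have "space space_meas - {\<omega>. \<exists>n. \<not> alive (drop m (prefix_of \<omega> n))} = A"
      by (auto simp: A_def interaction_def)
    ultimately show ?thesis by simp
  qed
  have pA: "prob A \<le> htmax / c" if c: "0 < c" for c
  proof -
    have "prob A \<le> prob {\<omega>. \<exists>n. good_hist M (prefix_of \<omega> n) \<longrightarrow> c \<le> W (prefix_of \<omega> n)}"
    proof (rule finite_measure_mono)
      show "A \<subseteq> {\<omega>. \<exists>n. good_hist M (prefix_of \<omega> n) \<longrightarrow> c \<le> W (prefix_of \<omega> n)}"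
      proof safe
        fix \<omega> assume \<omega>: "\<omega> \<in> A"
        let ?n = "m + nat \<lceil>c\<rceil>"
        have "c \<le> W (prefix_of \<omega> ?n)" if h: "good_hist M (prefix_of \<omega> ?n)"
        proof -
          have "alive (drop m (prefix_of \<omega> ?n))" using \<omega> unfolding A_def by blast
          then have "W (prefix_of \<omega> ?n) = real (nat \<lceil>c\<rceil>) + ht (Some (cur (prefix_of \<omega> ?n)))"
            unfolding W_def by (simp del: drop_map)
          moreover have "c \<le> real (nat \<lceil>c\<rceil>)" using c by linarith
          ultimately show ?thesis using le(2)[OF h] by linarith
        qed
        then show "\<exists>n. good_hist M (prefix_of \<omega> n) \<longrightarrow> c \<le> W (prefix_of \<omega> n)" by blast
      qed
      show "{\<omega>. \<exists>n. good_hist M (prefix_of \<omega> n) \<longrightarrow> c \<le> W (prefix_of \<omega> n)} \<in> events"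
        unfolding interaction_def by (rule sets_ex_prefix)
    qed
    also have "\<dots> \<le> prob {\<omega>. \<exists>n. c \<le> W (prefix_of \<omega> n)}"
    proof (rule finite_measure_mono_AE)
      show "AE \<omega> in space_meas. \<omega> \<in> {\<omega>. \<exists>n. good_hist M (prefix_of \<omega> n) \<longrightarrow> c \<le> W (prefix_of \<omega> n)} \<longrightarrow>
          \<omega> \<in> {\<omega>. \<exists>n. c \<le> W (prefix_of \<omega> n)}"
        using AE_consistent
      proof eventually_elim
        case (elim \<omega>)
        then have g: "good_hist M (prefix_of \<omega> n)" for n unfolding consistent_def by blast
        show ?case unfolding mem_Collect_eq
        proof
          assume "\<exists>n. good_hist M (prefix_of \<omega> n) \<longrightarrow> c \<le> W (prefix_of \<omega> n)"
          then obtain n where n: "good_hist M (prefix_of \<omega> n) \<longrightarrow> c \<le> W (prefix_of \<omega> n)" ..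
          show "\<exists>n. c \<le> W (prefix_of \<omega> n)" by (rule exI[of _ n]) (rule mp[OF n g])
        qed
      qed
    qed (unfold interaction_def, rule sets_ex_prefix)
    also have "\<dots> \<le> W [] / c"
      unfolding interaction_def
    proof (rule maximal_inequality[OF _ step c])
      fix h assume "good_hist M h"
      from le[OF this] show "0 \<le> W h" by (simp add: W_def)
    qed
    also have "\<dots> \<le> htmax / c" using W0 c by (intro divide_right_mono) auto
    finally show ?thesis .
  qed
  have "prob A \<le> e" if e: "0 < e" for e
  proof -
    have "prob A \<le> htmax / ((htmax + 1) / e)" using htmax_nonneg e by (intro pA) auto
    also have "\<dots> \<le> e" using htmax_nonneg e by (simp add: field_simps)
    finally show ?thesis .
  qed
  then have "prob A \<le> 0 + e" if "0 < e" for e using that by simp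
  then have "prob A \<le> 0" by (rule field_le_epsilon)
  then have "prob A = 0" using measure_nonneg[of space_meas A] by linarith
  then have "AE \<omega> in space_meas. \<omega> \<notin> A" using prob_eq_0[OF A] by simp
  then show "AE \<omega> in space_meas. \<exists>i\<ge>m. nxt (\<omega> i) = None"
  proof eventually_elim
    case (elim \<omega>)
    then obtain n where "\<not> alive (drop m (prefix_of \<omega> n))" unfolding A_def by blast
    then obtain i where "i \<in> {m..<n}" "nxt (\<omega> i) = None" by (auto simp: alive_def drop_map)
    then show ?case by auto
  qed
qed

lemma measurable_total_steps [measurable]:
  "(\<lambda>\<omega>. total_steps \<omega> K) \<in> measurable space_meas (count_space UNIV)"
  unfolding interaction_def total_steps_eq
  by (rule measurable_Least) (rule measurable_compose[OF measurable_prefix_of], simp)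

lemma measurable_sum_interval:
  fixes w :: "('s, 'a) transition \<Rightarrow> real"
  shows "(\<lambda>\<omega>. \<Sum>t\<in>{total_steps \<omega> j..<total_steps \<omega> k}. w (\<omega> t)) \<in> borel_measurable space_meas"
proof -
  have w: "(\<lambda>\<omega>. w (\<omega> t)) \<in> borel_measurable space_meas" for t
    unfolding interaction_def by (rule measurable_compose[OF measurable_coord]) simp
  have "(\<lambda>\<omega>. \<Sum>t\<in>{a..<b}. w (\<omega> t)) \<in> borel_measurable space_meas" for a b
    by (rule borel_measurable_sum) (rule w)
  then have "(\<lambda>\<omega>. \<Sum>t\<in>{a..<total_steps \<omega> k}. w (\<omega> t)) \<in> borel_measurable space_meas" for a
    by (rule measurable_compose_countable[where f="\<lambda>b \<omega>. \<Sum>t\<in>{a..<b}. w (\<omega> t)" and g="\<lambda>\<omega>. total_steps \<omega> k"])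
      (rule measurable_total_steps)
  then show ?thesis
    by (rule measurable_compose_countable[where f="\<lambda>a \<omega>. \<Sum>t\<in>{a..<total_steps \<omega> k}. w (\<omega> t)" and g="\<lambda>\<omega>. total_steps \<omega> j"])
      (rule measurable_total_steps)
qed

lemma measurable_regret [measurable]: "(\<lambda>\<omega>. regret M \<omega> K) \<in> borel_measurable space_meas"
  unfolding regret_def
proof (rule borel_measurable_sum)
  fix k
  show "(\<lambda>\<omega>. Vstar M (s_init M) - (\<Sum>t\<in>{total_steps \<omega> (k - 1)..<total_steps \<omega> k}. rew M (st (\<omega> t)) (ac (\<omega> t))))
      \<in> borel_measurable space_meas"
    by (rule borel_measurable_diff[OF borel_measurable_const
        measurable_sum_interval[where w="\<lambda>x. rew M (st x) (ac x)"]])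
qed

theorem regret_bound_probability:
  assumes R: "1 \<le> R_bound M"
  defines "C \<equiv> 4 * ((C_gap c1 c2 + 22) * (104 * C_gap c1 c2 + 18))"
  shows "1 - 9 * \<delta> \<le> measure space_meas {\<omega> \<in> space space_meas.
     \<forall>K\<ge>1. regret M \<omega> K \<le> C * regret_bound M B \<delta> K (total_steps \<omega> K)}"
proof -
  interpret prob_space space_meas unfolding interaction_def by (rule prob_space_seq_measure)
  let ?bad = "{\<omega>. \<exists>n. good_hist M (prefix_of \<omega> n) \<and> \<not> nice_at (prefix_of \<omega> n)}"
  let ?good = "{\<omega> \<in> space space_meas. \<forall>K\<ge>1. regret M \<omega> K \<le> C * regret_bound M B \<delta> K (total_steps \<omega> K)}"
  have bad: "?bad \<in> events" unfolding interaction_def by (rule sets_ex_prefix)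
  \<comment> \<open>Measurability matters here: \<open>measure\<close> is zero on sets that are not
    measurable, so an almost sure inclusion alone would not give a lower bound.\<close>
  have good: "?good \<in> events"
  proof -
    define G where "G K = {\<omega> \<in> space space_meas. regret M \<omega> K \<le> C * regret_bound M B \<delta> K (total_steps \<omega> K)}" for K
    have "(\<lambda>\<omega>. C * regret_bound M B \<delta> K (total_steps \<omega> K)) \<in> borel_measurable space_meas" for K
      by (rule measurable_compose[OF measurable_total_steps, where g="\<lambda>T. C * regret_bound M B \<delta> K T"]) simp
    then have "G K \<in> events" for K
      unfolding G_def by (rule borel_measurable_le[OF measurable_regret])
    then have "(\<Inter>K\<in>{1..}. G K) \<in> events" by (intro sets.countable_INT') auto
    moreover have "(\<Inter>K\<in>{1..}. G K) = ?good" unfolding G_def by fastforce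
    ultimately show ?thesis by (simp only:)
  qed
  have R0: "0 < Rmax M"
    using R R_from_le_Rmax[of "s_init M"] by (simp add: R_bound_def)
  have "1 - 9 * \<delta> \<le> 1 - prob ?bad" using prob_not_nice[OF R0] by simp
  also have "\<dots> = prob (space space_meas - ?bad)" by (rule prob_compl[OF bad, symmetric])
  also have "\<dots> \<le> prob ?good"
  proof (rule finite_measure_mono_AE[OF _ good])
    show "AE \<omega> in space_meas. \<omega> \<in> space space_meas - ?bad \<longrightarrow> \<omega> \<in> ?good"
      using AE_consistent AE_every_episode_terminates
    proof eventually_elim
      case (elim \<omega>)
      show ?case
      proof
        assume \<omega>: "\<omega> \<in> space space_meas - ?bad"
        have "nice_at (prefix_of \<omega> n)" for n
        proof (rule ccontr)
          assume "\<not> nice_at (prefix_of \<omega> n)"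
          moreover have "good_hist M (prefix_of \<omega> n)" using elim(1) unfolding consistent_def by blast
          ultimately have "\<omega> \<in> ?bad" by (intro CollectI exI[of _ n] conjI)
          then show False using \<omega> by (rule DiffD2[rotated])
        qed
        then interpret good_run M c1 c2 B \<delta> f \<omega>
          using elim(1) R by unfold_locales
        have "\<forall>K\<ge>1. regret M \<omega> K \<le> C * regret_bound M B \<delta> K (total_steps \<omega> K)"
          unfolding C_def by (intro allI impI regret_le[OF elim(2)])
        moreover have "\<omega> \<in> space space_meas" using \<omega> by (rule DiffD1)
        ultimately show "\<omega> \<in> ?good" unfolding mem_Collect_eq by (intro conjI)
      qed
    qed
  qed
  finally show ?thesis .
qed

end

theorem theorem2:
  "\<exists>c0 > (0::real). \<forall>c1 \<ge> c0. \<forall>c2 \<ge> c0. 2 * c1\<^sup>2 \<le> c2 \<longrightarrow>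
    (\<exists>C > (0::real). \<exists>D > (0::real).
      \<forall>(M :: (nat, nat) sp) (B :: real) (\<delta> :: real) (f :: (nat, nat) agent).
        valid_sp M \<and> (\<forall>\<pi>\<in>HD_policies M. proper M \<pi>) \<and>
        1 \<le> Vstar_init M \<and> 1 \<le> Bstar M \<and> 1 \<le> R_bound M \<and> 1 \<le> Rmax M \<and> 1 \<le> Tmax M \<and>
        Bstar M \<le> B \<and> 0 < \<delta> \<and> \<delta> < 1 \<and> vi_sp_agent M c1 c2 B \<delta> f
        \<longrightarrow>
        measure (interaction M (s_init M) f)
          {\<omega> \<in> space (interaction M (s_init M) f).
             \<forall>K\<ge>1. regret M \<omega> K \<le> C * regret_bound M B \<delta> K (total_steps \<omega> K)}
        \<ge> 1 - D * \<delta>)"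
proof (rule exI[of _ "400::real"], rule conjI, simp, intro allI impI)
  fix c1 c2 :: real
  assume c: "400 \<le> c1" "400 \<le> c2" "2 * c1\<^sup>2 \<le> c2"
  define C where "C = 4 * ((C_gap c1 c2 + 22) * (104 * C_gap c1 c2 + 18))"
  have "0 \<le> C_err c1 c2" using c by (simp add: C_err_def C_backup_def)
  then have "0 \<le> C_gap c1 c2" by (simp add: C_gap_def)
  then have C: "0 < C" unfolding C_def by (intro mult_pos_pos) auto
  show "\<exists>C > (0::real). \<exists>D > (0::real).
      \<forall>(M :: (nat, nat) sp) (B :: real) (\<delta> :: real) (f :: (nat, nat) agent).
        valid_sp M \<and> (\<forall>\<pi>\<in>HD_policies M. proper M \<pi>) \<and>
        1 \<le> Vstar_init M \<and> 1 \<le> Bstar M \<and> 1 \<le> R_bound M \<and> 1 \<le> Rmax M \<and> 1 \<le> Tmax M \<and>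
        Bstar M \<le> B \<and> 0 < \<delta> \<and> \<delta> < 1 \<and> vi_sp_agent M c1 c2 B \<delta> f
        \<longrightarrow>
        measure (interaction M (s_init M) f)
          {\<omega> \<in> space (interaction M (s_init M) f).
             \<forall>K\<ge>1. regret M \<omega> K \<le> C * regret_bound M B \<delta> K (total_steps \<omega> K)}
        \<ge> 1 - D * \<delta>"
  \<comment> \<open>The constant 100 makes the claim trivial for \<open>\<delta>\<close> above
    \<open>1 / 100\<close>, the range excluded in \<open>vi_run\<close>.\<close>
  proof (rule exI[of _ C], rule conjI[OF C], rule exI[of _ 100], rule conjI, simp, intro allI impI, elim conjE)
    fix M :: "(nat, nat) sp" and B \<delta> :: real and f :: "(nat, nat) agent"
    assume M: "valid_sp M" "\<forall>\<pi>\<in>HD_policies M. proper M \<pi>" and B: "1 \<le> Bstar M" "Bstar M \<le> B"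
      and R: "1 \<le> R_bound M" and \<delta>: "0 < \<delta>" and f: "vi_sp_agent M c1 c2 B \<delta> f"
    let ?good = "{\<omega> \<in> space (interaction M (s_init M) f).
             \<forall>K\<ge>1. regret M \<omega> K \<le> C * regret_bound M B \<delta> K (total_steps \<omega> K)}"
    show "1 - 100 * \<delta> \<le> measure (interaction M (s_init M) f) ?good"
    proof (cases "\<delta> \<le> 1 / 100")
      case True
      interpret vi_run M c1 c2 B \<delta> f
        using M B \<delta> True f c by unfold_locales auto
      have "1 - 9 * \<delta> \<le> measure (interaction M (s_init M) f) ?good"
        unfolding C_def by (rule regret_bound_probability[OF R])
      then show ?thesis using \<delta> by linarith
    next
      case False
      have "1 - 100 * \<delta> \<le> 0" using False by simp
      also have "0 \<le> measure (interaction M (s_init M) f) ?good" by (rule measure_nonneg)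
      finally show ?thesis .
    qed
  qed
qed

end
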